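(* Let $G$ be a sequentially $3$-rank-connected graph with $|V(G)|\geq 13$. Then $G$ has a sequentially $3$-rank-connected vertex-minor $H$ with $|V(H)|=|V(G)|-1$.
   Context: All graphs are finite and simple. For a vertex $v$ of $G$, the local complementation $G*v$ is obtained from $G$ by replacing the subgraph induced on the neighbourhood $N_G(v)$ by its complement. A graph $H$ is a vertex-minor of $G$ if $H$ can be obtained from $G$ by a sequence of local complementations and vertex deletions. For $X\subseteq V(G)$, the cut-rank $\rho_G(X)$ is the rank over $\mathrm{GF}(2)$ of the $X\times (V(G)-X)$ submatrix of the adjacency matrix of $G$. A graph $G$ is prime if there is no partition $(A,B)$ of $V(G)$ with $|A|,|B|\geq 2$ and $\rho_G(A)\leq 1$. A set $A\subseteq V(G)$ is sequential in $G$ if there is an ordering $a_1,\dots,a_{|A|}$ of $A$ with $\rho_G(\{a_1,\dots,a_i\})\leq 2$ for all $1\le i\le |A|$. A graph $G$ is sequentially $3$-rank-connected if it is prime and for every $X\subseteq V(G)$ with $\rho_G(X)\leq 2$, $X$ or $V(G)-X$ is sequential in $G$. *)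

theory Defs
  imports
    "HOL-Library.Z2"
    "HOL-Library.Function_Algebras"
    "Graph_Theory.Pair_Digraph"
begin

text \<open>
  Finite simple graphs are the \<^locale>\<open>pair_graph\<close>s of the Graph-Theory library: finite vertex set,
  and a symmetric irreflexive arc set, each edge being a pair of opposite arcs.
\<close>

definition neighbourhood :: "'a pair_pre_digraph \<Rightarrow> 'a \<Rightarrow> 'a set" where
  "neighbourhood G v = {u \<in> pverts G. (v, u) \<in> parcs G}"

definition local_complement :: "'a pair_pre_digraph \<Rightarrow> 'a \<Rightarrow> 'a pair_pre_digraph" where
  "local_complement G v =
    (let N = neighbourhood G v in
     \<lparr> pverts = pverts G,
       parcs = {(x, y) \<in> parcs G. \<not> (x \<in> N \<and> y \<in> N)} \<union>
               {(x, y) \<in> N \<times> N. x \<noteq> y \<and> (x, y) \<notin> parcs G} \<rparr>)"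

definition delete_vertex :: "'a pair_pre_digraph \<Rightarrow> 'a \<Rightarrow> 'a pair_pre_digraph" where
  "delete_vertex G v =
    \<lparr> pverts = pverts G - {v}, parcs = {(x, y) \<in> parcs G. x \<noteq> v \<and> y \<noteq> v} \<rparr>"

inductive vertex_minor :: "'a pair_pre_digraph \<Rightarrow> 'a pair_pre_digraph \<Rightarrow> bool"
  for G :: "'a pair_pre_digraph" where
  refl: "vertex_minor G G"
| local_complement:
    "vertex_minor G H \<Longrightarrow> v \<in> pverts H \<Longrightarrow> vertex_minor G (local_complement H v)"
| delete_vertex:
    "vertex_minor G H \<Longrightarrow> v \<in> pverts H \<Longrightarrow> vertex_minor G (delete_vertex H v)"

lemma pair_graph_local_complement:
  assumes "pair_graph G"
  shows "pair_graph (local_complement G v)"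
proof -
  interpret pair_graph G by fact
  have sub: "parcs (local_complement G v) \<subseteq> pverts G \<times> pverts G"
    by (auto simp: local_complement_def neighbourhood_def Let_def dest: in_arcsD1 in_arcsD2)
  show ?thesis
  proof
    show "finite (parcs (local_complement G v))"
      using sub pair_finite_verts by (meson finite_SigmaI finite_subset)
    show "symmetric (with_proj (local_complement G v))"
      unfolding symmetric_def sym_def
      by (auto simp: local_complement_def Let_def dest: arcs_symmetric)
  qed (use pair_finite_verts no_loops' in
      \<open>auto simp: local_complement_def neighbourhood_def Let_def dest: in_arcsD1 in_arcsD2\<close>)
qed

lemma pair_graph_delete_vertex:
  assumes "pair_graph G"
  shows "pair_graph (delete_vertex G v)"
proof -
  interpret pair_graph G by fact
  show ?thesis
  proof
    show "finite (parcs (delete_vertex G v))"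
      by (rule finite_subset[OF _ pair_finite_arcs]) (auto simp: delete_vertex_def)
    show "symmetric (with_proj (delete_vertex G v))"
      unfolding symmetric_def sym_def
      by (auto simp: delete_vertex_def dest: arcs_symmetric)
  qed (use pair_finite_verts no_loops' in
      \<open>auto simp: delete_vertex_def dest: in_arcsD1 in_arcsD2\<close>)
qed

lemma pair_graph_vertex_minor:
  assumes "vertex_minor G H" "pair_graph G"
  shows "pair_graph H"
  using assms
  by induction (auto intro: pair_graph_local_complement pair_graph_delete_vertex)

text \<open>
  Vectors over GF(2) with coordinates indexed by \<^typ>\<open>'a\<close>, the field GF(2) being \<^typ>\<open>bit\<close>.
\<close>

interpretation gf2: vector_space "\<lambda>(c :: bit) (f :: 'a \<Rightarrow> bit) x. c * f x"
  by unfold_locales (auto simp: algebra_simps fun_eq_iff)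

definition adjacency :: "'a pair_pre_digraph \<Rightarrow> 'a \<Rightarrow> 'a \<Rightarrow> bit" where
  "adjacency G x y = of_bool ((x, y) \<in> parcs G)"

text \<open>
  The rank of a matrix is the dimension of the span of its rows. A row of the
  \<open>X \<times> (V(G) - X)\<close> submatrix is encoded as a function on all of \<^typ>\<open>'a\<close> by padding with zeros
  outside \<open>V(G) - X\<close>.
\<close>

definition cut_row :: "'a pair_pre_digraph \<Rightarrow> 'a set \<Rightarrow> 'a \<Rightarrow> 'a \<Rightarrow> bit" where
  "cut_row G X x = (\<lambda>y. if y \<in> pverts G - X then adjacency G x y else 0)"

definition cut_rank :: "'a pair_pre_digraph \<Rightarrow> 'a set \<Rightarrow> nat" where
  "cut_rank G X = gf2.dim (cut_row G X ` X)"

definition prime_graph :: "'a pair_pre_digraph \<Rightarrow> bool" where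
  "prime_graph G \<longleftrightarrow>
    \<not> (\<exists>A B. A \<union> B = pverts G \<and> A \<inter> B = {} \<and> card A \<ge> 2 \<and> card B \<ge> 2 \<and> cut_rank G A \<le> 1)"

definition sequential :: "'a pair_pre_digraph \<Rightarrow> 'a set \<Rightarrow> bool" where
  "sequential G A \<longleftrightarrow> A \<subseteq> pverts G \<and>
    (\<exists>as. distinct as \<and> set as = A \<and>
      (\<forall>i. 1 \<le> i \<and> i \<le> length as \<longrightarrow> cut_rank G (set (take i as)) \<le> 2))"

definition sequentially_3_rank_connected :: "'a pair_pre_digraph \<Rightarrow> bool" where
  "sequentially_3_rank_connected G \<longleftrightarrow> prime_graph G \<and>
    (\<forall>X \<subseteq> pverts G. cut_rank G X \<le> 2 \<longrightarrow> sequential G X \<or> sequential G (pverts G - X))"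

end

theory Submission
  imports Defs "HOL-Library.Product_Plus"
begin

text \<open>
  Attach to a graph the space \<open>L\<close> of its words \<open>x \<mapsto> (f x, \<Sum>y. A x y * f y)\<close>, whose letters lie in
  GF(2) x GF(2) with its symplectic form; this is the stabilizer group of the graph state.
  It is isotropic, and the cut-rank of \<open>X\<close> is \<open>card X\<close> minus the dimension of the space of words
  supported in \<open>X\<close>. Local complementation permutes the letters at each position, so the three nonzero
  letters \<open>a\<close> at a vertex \<open>v\<close> correspond to three vertex-minors on \<open>V - {v}\<close>: keep the words with letter
  \<open>0\<close> or \<open>a\<close> at \<open>v\<close>, and erase that letter.

  Suppose that none of these is sequentially 3-rank-connected. Two words of weight three whose
  supports share two positions would make one of them so. Hence a set of rank at most 2 or its complement has at
  most three elements, and the minor for \<open>v\<close> and \<open>a\<close> is prime unless some word of weight three has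
  letter \<open>a\<close> at \<open>v\<close>. If two of the minors at \<open>v\<close> are prime, crossing their obstructions
  by submodularity yields an obstruction covered by two sets of at most three elements, and then one
  with exactly four elements, a quad. Without words of weight three, two quads at one vertex
  are contradictory. Otherwise each vertex of the support \<open>T\<close> of a word of weight three has a quad that meets
  \<open>T\<close> in one vertex, and two of these three quads force a set of six or seven vertices to have rank 2.
\<close>


subsection \<open>Elementary abelian 2-groups\<close>

text \<open>One tension drives every contradiction. Let \<open>X\<close> obstruct the minor for
  \<open>v\<close> and \<open>a\<close>. If a word has letter \<open>0\<close> or \<open>a\<close>
  at \<open>v\<close>, and all its other positions except one vertex lie on one side of
  \<open>X\<close>, then that vertex may be moved to this side without destroying the obstruction. A
  word with any other nonzero letter at \<open>v\<close> must instead have further positions on both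
  sides. The arguments produce words of both kinds that disagree. Treating the three letters alike
  pays off because sums of words supply whichever letter is required. The obstacle is that
  obstructions come with no bound on their size. Crossing two of them at one vertex provides the
  bound, and only then can the words inside an obstruction be analysed one by one. The constant 13
  enters through complements: a set of at most nine vertices leaves at least four outside, so it
  cannot pass for the large side of a set of rank at most 2. Dimensions are exponents of
  cardinalities of finite groups, which reduces linear algebra to counting fibres.\<close>

definition add_subgroup :: "'b::ab_group_add set \<Rightarrow> bool" where
  "add_subgroup S \<longleftrightarrow> finite S \<and> 0 \<in> S \<and> (\<forall>x\<in>S. \<forall>y\<in>S. x - y \<in> S)"

lemma add_subgroupD:
  assumes "add_subgroup S"
  shows "finite S" "0 \<in> S" "\<And>x y. x \<in> S \<Longrightarrow> y \<in> S \<Longrightarrow> x - y \<in> S"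
    "\<And>x y. x \<in> S \<Longrightarrow> y \<in> S \<Longrightarrow> x + y \<in> S"
proof -
  show *: "finite S" "0 \<in> S" "\<And>x y. x \<in> S \<Longrightarrow> y \<in> S \<Longrightarrow> x - y \<in> S"
    using assms by (auto simp: add_subgroup_def)
  fix x y assume "x \<in> S" "y \<in> S"
  then have "x - (0 - y) \<in> S" using * by blast
  then show "x + y \<in> S" by simp
qed

lemma card_hom:
  fixes f :: "'b::ab_group_add \<Rightarrow> 'c::ab_group_add"
  assumes S: "add_subgroup S" and f: "\<And>x y. f (x + y) = f x + f y"
  shows "card S = card (f ` S) * card {x \<in> S. f x = 0}"
proof -
  note s = add_subgroupD[OF S]
  have f': "f (x - y) = f x - f y" for x y
    using f[of "x - y" y] by (simp add: algebra_simps)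
  have fib: "card {x \<in> S. f x = c} = card {x \<in> S. f x = 0}" if c: "c \<in> f ` S" for c
  proof -
    obtain u where u: "u \<in> S" "f u = c" using c by auto
    have "bij_betw (\<lambda>x. x - u) {x \<in> S. f x = c} {x \<in> S. f x = 0}"
      by (rule bij_betw_byWitness[where f' = "\<lambda>x. x + u"])
         (use u s in \<open>auto simp: f f' algebra_simps\<close>)
    then show ?thesis by (rule bij_betw_same_card)
  qed
  have "S = (\<Union>c\<in>f ` S. {x \<in> S. f x = c})" by auto
  then have "card S = card (\<Union>c\<in>f ` S. {x \<in> S. f x = c})" by simp
  also have "\<dots> = (\<Sum>c\<in>f ` S. card {x \<in> S. f x = c})"
    by (rule card_UN_disjoint) (use s in auto)
  also have "\<dots> = card (f ` S) * card {x \<in> S. f x = 0}"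
    using fib by simp
  finally show ?thesis .
qed

lemma add_subgroup_image:
  fixes f :: "'b::ab_group_add \<Rightarrow> 'c::ab_group_add"
  assumes S: "add_subgroup S" and f: "\<And>x y. f (x + y) = f x + f y"
  shows "add_subgroup (f ` S)"
proof -
  note s = add_subgroupD[OF S]
  have f': "f (x - y) = f x - f y" for x y
    using f[of "x - y" y] by (simp add: algebra_simps)
  have "f 0 = 0" using f[of 0 0] by simp
  then have "0 \<in> f ` S" using s(2) by (metis image_eqI)
  moreover have "x - y \<in> f ` S" if "x \<in> f ` S" "y \<in> f ` S" for x y
    using that s(3) f' by (smt (verit) imageE imageI)
  ultimately show ?thesis using s(1) by (simp add: add_subgroup_def)
qed

lemma add_subgroup_Int:
  "add_subgroup S \<Longrightarrow> add_subgroup T \<Longrightarrow> add_subgroup (S \<inter> T)"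
  by (auto simp: add_subgroup_def)

text \<open>A maximal proper subgroup \<open>T\<close> has index two: adjoining one outside element
  \<open>u\<close> adds exactly the coset of \<open>u\<close>, and by maximality this is
  everything.\<close>

lemma card_add_subgroup_power2:
  fixes S :: "'b::ab_group_add set"
  assumes "add_subgroup S" and two: "\<And>x :: 'b. x + x = 0"
  shows "\<exists>n. card S = 2 ^ n"
  using assms(1)
proof (induction "card S" arbitrary: S rule: less_induct)
  case less
  have neg: "x - y = x + y" for x y :: 'b
    unfolding diff_conv_add_uminus[of x y] minus_unique[OF two[of y]] ..
  note s = add_subgroupD[OF less.prems]
  show ?case
  proof (cases "S = {0}")
    case True
    then have "card S = 2 ^ 0" by simp
    then show ?thesis by blast
  next
    case False
    let ?P = "{T. add_subgroup T \<and> T \<subset> S}"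
    have "?P \<subseteq> Pow S" by auto
    then have fin: "finite ?P" using s(1) by (metis finite_Pow_iff finite_subset)
    have "{0} \<in> ?P" using False s by (auto simp: add_subgroup_def)
    then have ne: "?P \<noteq> {}" by blast
    obtain T where T: "T \<in> ?P" "\<forall>U\<in>?P. T \<subseteq> U \<longrightarrow> T = U"
      using finite_has_maximal[OF fin ne] by blast
    have "add_subgroup T" using T(1) by simp
    note t = add_subgroupD[OF this]
    obtain u where u: "u \<in> S" "u \<notin> T" using T by blast
    let ?U = "T \<union> (+) u ` T"
    have U: "add_subgroup ?U"
    proof -
      have "x + y \<in> ?U" if xy: "x \<in> ?U" "y \<in> ?U" for x y
      proof -
        obtain p where p: "p \<in> T" "x = p \<or> x = u + p" using xy by auto
        obtain q where q: "q \<in> T" "y = q \<or> y = u + q" using xy by auto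
        have pq: "p + q \<in> T" using p q t T by blast
        have "u + p + (u + q) = (u + u) + (p + q)" by (simp only: ac_simps)
        then have e: "u + p + (u + q) = p + q" by (simp only: two add_0_left)
        have "x + y = p + q \<or> x + y = u + (p + q)"
          using p(2) q(2) e by (elim disjE) (simp_all add: ac_simps)
        then show ?thesis using pq by (elim disjE) simp_all
      qed
      moreover have "finite ?U" "0 \<in> ?U" using T t by auto
      ultimately show ?thesis unfolding add_subgroup_def by (simp only: neg) blast
    qed
    have "?U \<subseteq> S" using u T s by auto
    moreover have "u \<in> ?U" using T t(2) by force
    then have "T \<subset> ?U" using u by blast
    ultimately have "?U = S" using T(2) U by blast
    moreover have "T \<inter> (+) u ` T = {}"
    proof (rule ccontr)
      assume "T \<inter> (+) u ` T \<noteq> {}"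
      then obtain p where p: "p \<in> T" "u + p \<in> T" by blast
      then have "u + p - p \<in> T" using T t(3) by blast
      then show False using u by simp
    qed
    moreover have "card ((+) u ` T) = card T" by (simp add: card_image)
    moreover have "finite T" using T t by blast
    ultimately have c: "card S = 2 * card T"
      by (metis card_Un_disjoint finite_imageI mult_2)
    have "card T < card S" using T s(1) by (simp add: psubset_card_mono)
    then obtain n where "card T = 2 ^ n" using less.hyps T by blast
    then have "card S = 2 ^ Suc n" using c by simp
    then show ?thesis by blast
  qed
qed

text \<open>For a finite group of exponent two this is the dimension over GF(2); no basis has to be
  chosen.\<close>

definition dim2 :: "'b set \<Rightarrow> nat" where
  "dim2 S = (SOME n. card S = 2 ^ n)"

section \<open>Letters, words and their symplectic form\<close>

type_synonym letter = "bit \<times> bit"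
type_synonym 'a word = "'a \<Rightarrow> bit \<times> bit"

lemma letter_add_self [simp]: "(a :: letter) + a = 0"
  by (cases a) (simp add: zero_prod_def)

lemma letter_diff [simp]: "(a :: letter) - b = a + b"
  by (cases a; cases b) simp

lemma letter_cases: "(a :: letter) = 0 \<or> a = (0, 1) \<or> a = (1, 0) \<or> a = (1, 1)"
  by (cases a) (auto simp: zero_prod_def)

lemma letter_add_left_cancel [simp]: "(a :: letter) + (a + b) = b"
  by (simp flip: add.assoc)

lemma letter_add_eq_0_iff [simp]: "(a :: letter) + b = 0 \<longleftrightarrow> a = b"
  by (metis letter_diff right_minus_eq)

lemma letter_add_eq_iff [simp]:
  "(a :: letter) + b = a \<longleftrightarrow> b = 0" "(b :: letter) + a = a \<longleftrightarrow> b = 0"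
  "a = a + b \<longleftrightarrow> b = 0" "a = b + a \<longleftrightarrow> b = 0"
  by simp_all

lemma letter_third:
  fixes a b c :: letter
  assumes "a \<noteq> 0" "b \<noteq> 0" "a \<noteq> b" "c \<noteq> 0" "c \<noteq> a" "c \<noteq> b"
  shows "c = a + b"
  using assms letter_cases[of a] letter_cases[of b] letter_cases[of c]
  by (auto simp: zero_prod_def)

lemma word_add_self [simp]: "(g :: 'a word) + g = 0"
  by (simp add: fun_eq_iff)

lemma word_diff [simp]: "(g :: 'a word) - h = g + h"
  by (simp add: fun_eq_iff)

lemma word_add_eq_0_iff [simp]: "(g :: 'a word) + h = 0 \<longleftrightarrow> g = h"
  by (metis word_diff right_minus_eq)

text \<open>Read as Pauli operators, such letters anticommute; \<open>symp_anti\<close> identifies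
  this with symplectic product 1.\<close>

definition anti :: "letter \<Rightarrow> letter \<Rightarrow> bool" where
  "anti a b \<longleftrightarrow> a \<noteq> 0 \<and> b \<noteq> 0 \<and> a \<noteq> b"

definition symp :: "letter \<Rightarrow> letter \<Rightarrow> bit" where
  "symp a b = fst a * snd b + snd a * fst b"

lemma symp_anti: "symp a b = of_bool (anti a b)"
  using letter_cases[of a] letter_cases[of b]
  by (auto simp: symp_def anti_def zero_prod_def)

definition supp :: "'a word \<Rightarrow> 'a set" where
  "supp g = {x. g x \<noteq> 0}"

lemma supp_iff: "x \<in> supp g \<longleftrightarrow> g x \<noteq> 0"
  by (simp add: supp_def)

lemma supp_add: "supp (g + h) \<subseteq> supp g \<union> supp h"
  by (auto simp: supp_def)

lemma supp_0 [simp]: "supp 0 = {}"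
  by (simp add: supp_def)

lemma card_dim2:
  fixes S :: "'a word set"
  assumes "add_subgroup S"
  shows "card S = 2 ^ dim2 S"
  unfolding dim2_def
  by (rule someI_ex) (rule card_add_subgroup_power2[OF assms word_add_self])

lemma dim2_mono:
  fixes S :: "'a word set"
  assumes "add_subgroup S" "add_subgroup T" "S \<subseteq> T"
  shows "dim2 S \<le> dim2 T"
proof -
  have "card S \<le> card T" using assms by (meson add_subgroupD(1) card_mono)
  then show ?thesis using assms by (simp add: card_dim2)
qed

lemma dim2_less:
  fixes S :: "'a word set"
  assumes "add_subgroup S" "add_subgroup T" "S \<subset> T"
  shows "dim2 S < dim2 T"
proof -
  have "card S < card T" using assms by (meson add_subgroupD(1) psubset_card_mono)
  then show ?thesis using assms by (simp add: card_dim2)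
qed

lemma dim2_hom:
  fixes S :: "'a word set" and f :: "'a word \<Rightarrow> letter"
  assumes S: "add_subgroup S" and f: "\<And>x y. f (x + y) = f x + f y"
    and T: "add_subgroup {x \<in> S. f x = 0}"
  shows "2 ^ dim2 S = card (f ` S) * 2 ^ dim2 {x \<in> S. f x = 0}"
  using card_hom[OF S, of f] f by (simp add: card_dim2[OF S] card_dim2[OF T])

text \<open>Addition on \<open>E \<times> F\<close> has the diagonal copy of
  \<open>E \<inter> F\<close> as kernel and an image inside \<open>U\<close>. Both submodularity and
  the crossing inequality come from this count.\<close>

lemma dim2_sum_Int:
  fixes E F U :: "'a word set"
  assumes E: "add_subgroup E" and F: "add_subgroup F" and U: "add_subgroup U"
    and sub: "E \<subseteq> U" "F \<subseteq> U"
  shows "dim2 E + dim2 F \<le> dim2 (E \<inter> F) + dim2 U"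
proof -
  let ?f = "\<lambda>p :: 'a word \<times> 'a word. fst p + snd p"
  have EF: "add_subgroup (E \<times> F)"
    using E F by (auto simp: add_subgroup_def zero_prod_def)
  have I: "add_subgroup (E \<inter> F)" using E F by (rule add_subgroup_Int)
  have "card (E \<times> F) = card (?f ` (E \<times> F)) * card {p \<in> E \<times> F. ?f p = 0}"
    by (rule card_hom[OF EF]) (simp add: algebra_simps)
  also have "card {p \<in> E \<times> F. ?f p = 0} = card (E \<inter> F)"
    by (rule sym, rule bij_betw_same_card[where f = "\<lambda>x. (x, x)"])
      (auto simp: bij_betw_def inj_on_def)
  also have "card (?f ` (E \<times> F)) \<le> card U"
    using U sub by (intro card_mono) (auto dest: add_subgroupD)
  finally have "card E * card F \<le> card U * card (E \<inter> F)"
    by (simp add: card_cartesian_product)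
  then have "(2::nat) ^ (dim2 E + dim2 F) \<le> 2 ^ (dim2 (E \<inter> F) + dim2 U)"
    by (simp add: card_dim2 E F U I power_add mult.commute)
  then show ?thesis by simp
qed

subsection \<open>Sequential sets of a set function\<close>

text \<open>The inductive form allows induction on the last vertex of the ordering; inserting a
  vertex twice changes nothing. The set function is a parameter so that \<open>r\<close>,
  \<open>ra\<close> and cut-rank share one notion.\<close>

inductive seqf :: "('a set \<Rightarrow> int) \<Rightarrow> 'a set \<Rightarrow> bool" for f where
  empty: "seqf f {}"
| insert: "seqf f A \<Longrightarrow> f (insert x A) \<le> 2 \<Longrightarrow> seqf f (insert x A)"

definition primef :: "'a set \<Rightarrow> ('a set \<Rightarrow> int) \<Rightarrow> bool" where
  "primef V f \<longleftrightarrow> (\<forall>X\<subseteq>V. f X \<le> 1 \<longrightarrow> card X \<le> 1 \<or> card (V - X) \<le> 1)"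

definition seq3 :: "'a set \<Rightarrow> ('a set \<Rightarrow> int) \<Rightarrow> bool" where
  "seq3 V f \<longleftrightarrow> primef V f \<and> (\<forall>X\<subseteq>V. f X \<le> 2 \<longrightarrow> seqf f X \<or> seqf f (V - X))"

lemma finite_seqf: "seqf f A \<Longrightarrow> finite A"
  by (induction rule: seqf.induct) auto

lemma seqf_le2: "seqf f A \<Longrightarrow> A \<noteq> {} \<Longrightarrow> f A \<le> 2"
  by (auto elim: seqf.cases)

lemma seqf_small:
  assumes "finite A" "card A \<le> 3" "f A \<le> 2"
    and small: "\<And>B. B \<subseteq> A \<Longrightarrow> card B \<le> 2 \<Longrightarrow> f B \<le> 2"
  shows "seqf f A"
proof -
  have two: "seqf f B" if "finite B" "B \<subseteq> A" "card B \<le> 2" for B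
    using that
  proof (induction B rule: finite_induct)
    case (insert x B)
    then show ?case using small[of "insert x B"] by (intro seqf.insert) auto
  qed (rule seqf.empty)
  show ?thesis
  proof (cases "card A \<le> 2")
    case False
    then obtain x where x: "x \<in> A" by fastforce
    have "insert x (A - {x}) = A" using x by blast
    moreover have "seqf f (A - {x})" using two[of "A - {x}"] x assms(1,2) by simp
    ultimately show ?thesis using seqf.insert[of f "A - {x}" x] assms(3) by simp
  qed (use two assms(1) in blast)
qed

lemma seqf_mono:
  assumes "seqf f A" and "\<And>B. B \<subseteq> A \<Longrightarrow> g B \<le> f B"
  shows "seqf g A"
  using assms
proof (induction rule: seqf.induct)
  case (insert A x)
  have "g (insert x A) \<le> 2" using insert.prems[of "insert x A"] insert.hyps by force
  moreover have "seqf g A" using insert.prems by (intro insert.IH) blast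
  ultimately show ?case by (intro seqf.insert)
qed (rule seqf.empty)

text \<open>By submodularity \<open>f (C \<inter> B) + f (C \<union> B) \<le> 4\<close>
  for every initial segment \<open>C\<close> of \<open>A\<close>, and primeness bounds \<open>f (C \<union> B)\<close> from below.\<close>

lemma seqf_subset:
  assumes "seqf f A" and "A \<subseteq> V" "B \<subseteq> V" "finite V" "f B \<le> 2" "primef V f"
    and sub: "\<And>X Y. X \<subseteq> V \<Longrightarrow> Y \<subseteq> V \<Longrightarrow> f (X \<inter> Y) + f (X \<union> Y) \<le> f X + f Y"
    and small: "\<And>X. X \<subseteq> V \<Longrightarrow> card X \<le> 2 \<Longrightarrow> f X \<le> 2"
    and large: "2 \<le> card (V - (A \<union> B))"
  shows "seqf f (A \<inter> B)"
  using assms(1,2) large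
proof (induction rule: seqf.induct)
  case (insert A x)
  have "card (V - (insert x A \<union> B)) \<le> card (V - (A \<union> B))"
    using \<open>finite V\<close> by (intro card_mono) auto
  then have IH: "seqf f (A \<inter> B)" using insert by auto
  show ?case
  proof (cases "x \<in> B")
    case True
    have "f (insert x A \<inter> B) \<le> 2"
    proof (cases "card (insert x A \<inter> B) \<le> 2")
      case False
      have "finite (insert x A \<union> B)"
        using insert.prems \<open>B \<subseteq> V\<close> \<open>finite V\<close> by (meson Un_least finite_subset)
      then have "card (insert x A \<inter> B) \<le> card (insert x A \<union> B)"
        by (intro card_mono) auto
      then have "\<not> f (insert x A \<union> B) \<le> 1"
        using \<open>primef V f\<close> insert.prems \<open>B \<subseteq> V\<close> False unfolding primef_def
        by (metis Un_least Suc_1 not_less_eq_eq le_trans nat_le_linear)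
      then show ?thesis
        using sub[OF insert.prems(1) \<open>B \<subseteq> V\<close>] insert.hyps \<open>f B \<le> 2\<close> by linarith
    next
      case True
      then show ?thesis using small[of "insert x A \<inter> B"] \<open>B \<subseteq> V\<close> by blast
    qed
    then show ?thesis using seqf.insert[OF IH, of x] True by simp
  next
    case False
    then show ?thesis using IH by simp
  qed
qed (simp add: seqf.empty)

subsection \<open>The rank functions of a space of words\<close>

text \<open>\<open>ra v a\<close> is the cut-rank function of the space on \<open>V - {v}\<close> that arises from \<open>L\<close> by
  keeping the words with letter \<open>0\<close> or \<open>a\<close> at \<open>v\<close> and erasing that letter.\<close>

locale words =
  fixes V :: "'a set" and L :: "'a word set"
  assumes finV: "finite V" and subgroup_L: "add_subgroup L"
    and supp_L: "g \<in> L \<Longrightarrow> supp g \<subseteq> V"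
    and symp_L: "g \<in> L \<Longrightarrow> h \<in> L \<Longrightarrow> (\<Sum>x\<in>V. symp (g x) (h x)) = 0"
begin

definition LX :: "'a set \<Rightarrow> 'a word set" where
  "LX X = {g \<in> L. supp g \<subseteq> X}"

definition N :: "'a \<Rightarrow> letter \<Rightarrow> 'a set \<Rightarrow> 'a word set" where
  "N v a X = {g \<in> L. supp g \<subseteq> insert v X \<and> (g v = 0 \<or> g v = a)}"

definition r :: "'a set \<Rightarrow> int" where
  "r X = int (card X) - int (dim2 (LX X))"

definition ra :: "'a \<Rightarrow> letter \<Rightarrow> 'a set \<Rightarrow> int" where
  "ra v a X = int (card X) - int (dim2 (N v a X))"

lemma zero_L [simp]: "0 \<in> L"
  and add_L: "g \<in> L \<Longrightarrow> h \<in> L \<Longrightarrow> g + h \<in> L"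
  and finite_L: "finite L"
  using subgroup_L by (auto dest: add_subgroupD)

lemma add_subgroup_subset:
  assumes "S \<subseteq> L" "0 \<in> S" "\<And>g h. g \<in> S \<Longrightarrow> h \<in> S \<Longrightarrow> g + h \<in> S"
  shows "add_subgroup S"
  using assms finite_L finite_subset by (auto simp: add_subgroup_def)

lemma add_subgroup_LX [simp]: "add_subgroup (LX X)"
  using supp_add by (intro add_subgroup_subset) (auto simp: LX_def add_L dest!: subsetD[OF supp_add])

lemma add_subgroup_N [simp]: "add_subgroup (N v a X)"
  by (intro add_subgroup_subset) (auto simp: N_def add_L dest!: subsetD[OF supp_add])

lemma ra_submod:
  assumes "X \<subseteq> V - {v}" "Y \<subseteq> V - {v}"
  shows "ra v a (X \<inter> Y) + ra v a (X \<union> Y) \<le> ra v a X + ra v a Y"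
proof -
  have "N v a X \<inter> N v a Y = N v a (X \<inter> Y)" by (auto simp: N_def)
  moreover have "N v a X \<subseteq> N v a (X \<union> Y)" "N v a Y \<subseteq> N v a (X \<union> Y)" by (auto simp: N_def)
  then have "dim2 (N v a X) + dim2 (N v a Y) \<le> dim2 (N v a X \<inter> N v a Y) + dim2 (N v a (X \<union> Y))"
    by (intro dim2_sum_Int) auto
  moreover have "card X + card Y = card (X \<union> Y) + card (X \<inter> Y)"
    using assms finV by (intro card_Un_Int) (auto intro: finite_subset)
  ultimately show ?thesis by (simp add: ra_def)
qed

text \<open>A word counted for both \<open>a\<close> and \<open>b\<close> has letter
  \<open>0\<close> at \<open>v\<close>, so the two spaces meet in the words supported in
  \<open>X \<inter> Y\<close>. The summand 1 pays for the extra element \<open>v\<close> of the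
  union.\<close>

lemma crossing:
  assumes "X \<subseteq> V - {v}" "Y \<subseteq> V - {v}" "v \<in> V" "a \<noteq> b"
  shows "r (X \<inter> Y) + r (insert v (X \<union> Y)) \<le> ra v a X + ra v b Y + 1"
proof -
  have "N v a X \<inter> N v b Y = LX (X \<inter> Y)"
  proof (intro equalityI subsetI)
    fix g assume "g \<in> N v a X \<inter> N v b Y"
    moreover from this have "g v = 0" using assms(4) by (auto simp: N_def)
    ultimately show "g \<in> LX (X \<inter> Y)" by (auto simp: N_def LX_def supp_def)
  next
    fix g assume g: "g \<in> LX (X \<inter> Y)"
    then have "g v = 0" using assms(1) by (auto simp: LX_def supp_def)
    then show "g \<in> N v a X \<inter> N v b Y" using g by (auto simp: N_def LX_def)
  qed
  moreover have "N v a X \<subseteq> LX (insert v (X \<union> Y))" "N v b Y \<subseteq> LX (insert v (X \<union> Y))"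
    by (auto simp: N_def LX_def)
  then have "dim2 (N v a X) + dim2 (N v b Y)
      \<le> dim2 (N v a X \<inter> N v b Y) + dim2 (LX (insert v (X \<union> Y)))"
    by (intro dim2_sum_Int) auto
  moreover have fin: "finite (X \<union> Y)" using assms finV by (meson Un_least finite_subset finite_Diff)
  then have "card X + card Y = card (X \<union> Y) + card (X \<inter> Y)"
    by (intro card_Un_Int) auto
  moreover have "card (insert v (X \<union> Y)) = card (X \<union> Y) + 1"
    using fin assms(1,2) by (subst card_insert_disjoint) auto
  ultimately show ?thesis by (simp add: r_def ra_def)
qed

lemma ra_le_r:
  assumes "v \<notin> X"
  shows "ra v a X \<le> r X"
proof -
  have "LX X \<subseteq> N v a X" using assms by (auto simp: LX_def N_def supp_def)
  then show ?thesis by (simp add: r_def ra_def dim2_mono)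
qed

lemma ra_eq_r:
  assumes "v \<notin> X" "\<And>g. g \<in> L \<Longrightarrow> supp g \<subseteq> insert v X \<Longrightarrow> g v \<noteq> a"
  shows "ra v a X = r X"
proof -
  have "LX X = N v a X" using assms by (auto simp: LX_def N_def supp_def)
  then show ?thesis by (simp add: r_def ra_def)
qed

lemma dim2_fibre:
  fixes S :: "'a word set"
  assumes S: "add_subgroup S"
  shows "2 ^ dim2 S = card ((\<lambda>g. g y) ` S) * 2 ^ dim2 {g \<in> S. g y = 0}"
proof -
  have T: "add_subgroup {g \<in> S. g y = 0}"
    using S by (auto simp: add_subgroup_def)
  show ?thesis using dim2_hom[OF S, of "\<lambda>g. g y"] T by simp
qed

lemma letters_finite: "finite (S :: letter set)" "card (S :: letter set) \<le> 4"
proof -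
  have eq: "(UNIV :: letter set) = {0, (0,1), (1,0), (1,1)}" using letter_cases by blast
  then have "finite (UNIV :: letter set)" by (metis finite.simps)
  then show "finite S" by (rule finite_subset[rotated]) simp
  have "card S \<le> card (UNIV :: letter set)"
    using \<open>finite UNIV\<close> by (intro card_mono) auto
  also have "\<dots> \<le> 4" unfolding eq by (simp add: card_insert_if)
  finally show "card S \<le> 4" .
qed

lemma r_le_ra:
  assumes "v \<notin> X"
  shows "r X \<le> ra v a X + 1"
proof -
  have eq: "{g \<in> N v a X. g v = 0} = LX X"
    using assms by (auto simp: LX_def N_def supp_def)
  have "(\<lambda>g. g v) ` N v a X \<subseteq> {0, a}" by (auto simp: N_def)
  then have "card ((\<lambda>g. g v) ` N v a X) \<le> card {0, a}" by (intro card_mono) auto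
  also have "\<dots> \<le> 2" by (simp add: card_insert_if)
  finally have "2 ^ dim2 (N v a X) \<le> 2 * (2::nat) ^ dim2 (LX X)"
    using dim2_fibre[of "N v a X" v] by (simp add: eq)
  then have "(2::nat) ^ dim2 (N v a X) \<le> 2 ^ Suc (dim2 (LX X))" by simp
  then have "dim2 (N v a X) \<le> Suc (dim2 (LX X))" by (subst (asm) power_increasing_iff) auto
  then show ?thesis by (simp add: r_def ra_def)
qed

text \<open>The cardinality grows by one while the rank falls, so the dimension grows by at least
  two. The words vanishing at \<open>z\<close> form the old space, hence evaluation at
  \<open>z\<close> takes all four values.\<close>

lemma ra_insert_onto:
  assumes "z \<notin> X" "z \<noteq> v" "finite X" "ra v a X > ra v a (insert z X)"
  shows "\<exists>g\<in>N v a (insert z X). g z = b"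
proof -
  let ?S = "N v a (insert z X)"
  have eq: "{g \<in> ?S. g z = 0} = N v a X"
    using assms by (auto simp: N_def supp_def)
  have "dim2 (N v a X) + 2 \<le> dim2 ?S" using assms by (simp add: ra_def)
  then have "(2::nat) ^ (dim2 (N v a X) + 2) \<le> 2 ^ dim2 ?S" by (intro power_increasing) auto
  also have "\<dots> = card ((\<lambda>g. g z) ` ?S) * 2 ^ dim2 (N v a X)"
    using dim2_fibre[of ?S z] by (simp add: eq)
  finally have "4 \<le> card ((\<lambda>g. g z) ` ?S)" by (simp add: power_add)
  moreover have "card (UNIV :: letter set) \<le> 4" by (rule letters_finite)
  moreover have "card ((\<lambda>g. g z) ` ?S) \<le> card (UNIV :: letter set)"
    by (intro card_mono letters_finite) simp
  ultimately have "(\<lambda>g. g z) ` ?S = UNIV"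
    by (intro card_subset_eq letters_finite) auto
  then show ?thesis by (metis UNIV_I imageE)
qed

lemma r_insert_le_Suc:
  assumes "finite X"
  shows "r (insert y X) \<le> r X + 1"
proof -
  have "dim2 (LX X) \<le> dim2 (LX (insert y X))"
    by (intro dim2_mono add_subgroup_LX) (auto simp: LX_def)
  then show ?thesis using assms by (simp add: r_def card_insert_if)
qed

lemma r_insert_le:
  assumes "finite X" "g \<in> L" "supp g \<subseteq> insert y X" "g y \<noteq> 0"
  shows "r (insert y X) \<le> r X"
proof (cases "y \<in> X")
  case False
  have "LX X \<subset> LX (insert y X)"
    using assms False by (auto simp: LX_def supp_def)
  then have "dim2 (LX X) < dim2 (LX (insert y X))" by (intro dim2_less) auto
  then show ?thesis using assms False by (simp add: r_def)
qed (simp add: insert_absorb)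

text \<open>At \<open>y\<close> at least the three letters \<open>0\<close>, \<open>g y\<close> and
  \<open>h y\<close> occur. Since dimensions are exponents of two, a factor of three already forces
  a gain of two dimensions against one new vertex.\<close>

lemma r_insert_le2:
  assumes "finite X" "y \<notin> X" "g \<in> L" "supp g \<subseteq> insert y X" "g y \<noteq> 0"
    "h \<in> L" "supp h \<subseteq> insert y X" "h y \<noteq> 0" "g y \<noteq> h y"
  shows "r (insert y X) \<le> r X - 1"
proof -
  let ?S = "LX (insert y X)"
  have eq: "{g \<in> ?S. g y = 0} = LX X" using assms by (auto simp: LX_def supp_def)
  have "{0, g y, h y} \<subseteq> (\<lambda>g. g y) ` ?S"
  proof -
    have *: "0 \<in> ?S" "g \<in> ?S" "h \<in> ?S" using assms by (auto simp: LX_def)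
    show ?thesis
      using imageI[OF *(1), of "\<lambda>g. g y"] imageI[OF *(2), of "\<lambda>g. g y"]
        imageI[OF *(3), of "\<lambda>g. g y"] by simp
  qed
  then have "card {0, g y, h y} \<le> card ((\<lambda>g. g y) ` ?S)"
    using letters_finite by (intro card_mono) auto
  then have "3 \<le> card ((\<lambda>g. g y) ` ?S)" using assms by simp
  then have "3 * 2 ^ dim2 (LX X) \<le> (2::nat) ^ dim2 ?S"
    using dim2_fibre[of ?S y] by (simp add: eq)
  moreover have "(0::nat) < 2 ^ dim2 (LX X)" by simp
  ultimately have "2 ^ Suc (dim2 (LX X)) < (2::nat) ^ dim2 ?S" unfolding power_Suc by linarith
  then have "dim2 (LX X) + 2 \<le> dim2 ?S" by (subst (asm) power_strict_increasing_iff) auto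
  then show ?thesis using assms by (simp add: r_def)
qed

lemma ra_insert_le:
  assumes "finite X" "g \<in> L" "supp g \<subseteq> insert v (insert y X)" "g v = 0 \<or> g v = a" "y \<noteq> v" "g y \<noteq> 0"
  shows "ra v a (insert y X) \<le> ra v a X"
proof (cases "y \<in> X")
  case False
  have "N v a X \<subset> N v a (insert y X)"
    using assms False by (auto simp: N_def supp_def)
  then have "dim2 (N v a X) < dim2 (N v a (insert y X))" by (intro dim2_less) auto
  then show ?thesis using assms False by (simp add: ra_def)
qed (simp add: insert_absorb)

lemma r_le_card: "r X \<le> card X"
  by (simp add: r_def)

lemma ra_le_card: "ra v a X \<le> card X"
  by (simp add: ra_def)

lemma dim2_0: "dim2 {0 :: 'a word} = 0"
proof -
  have "add_subgroup {0 :: 'a word}" by (simp add: add_subgroup_def)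
  from card_dim2[OF this, symmetric] show ?thesis by simp
qed

lemma r_less_card:
  assumes "r X < card X"
  shows "\<exists>g\<in>L. g \<noteq> 0 \<and> supp g \<subseteq> X"
proof (rule ccontr)
  assume "\<not> ?thesis"
  then have "LX X = {0}" by (auto simp: LX_def)
  then show False using assms by (simp add: r_def dim2_0)
qed

lemma r_supp_less:
  assumes "g \<in> L" "g \<noteq> 0" "supp g \<subseteq> X"
  shows "r X \<le> card X - 1"
proof -
  have "{0} \<subset> LX X" using assms by (auto simp: LX_def)
  moreover have "add_subgroup {0 :: 'a word}" by (simp add: add_subgroup_def)
  ultimately have "dim2 {0 :: 'a word} < dim2 (LX X)" by (intro dim2_less) auto
  then show ?thesis by (simp add: r_def)
qed

lemma symp_on:
  assumes "g \<in> L" "h \<in> L" "supp g \<inter> supp h \<subseteq> F" "F \<subseteq> V"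
  shows "(\<Sum>x\<in>F. symp (g x) (h x)) = 0"
proof -
  have "(\<Sum>x\<in>F. symp (g x) (h x)) = (\<Sum>x\<in>V. symp (g x) (h x))"
    using assms(3,4) finV
    by (intro sum.mono_neutral_left) (auto simp: symp_anti anti_def supp_def)
  then show ?thesis using symp_L assms by simp
qed

end

subsection \<open>Obstructions to the minors being sequentially 3-rank-connected\<close>

text \<open>Symmetry under complement is assumed here rather than derived from the words: in the
  application \<open>r\<close> and \<open>ra\<close> are cut-rank functions of graphs.\<close>

locale seq_words = words +
  assumes r_sym: "X \<subseteq> V \<Longrightarrow> r (V - X) = r X"
    and ra_sym: "v \<in> V \<Longrightarrow> a \<noteq> 0 \<Longrightarrow> X \<subseteq> V - {v} \<Longrightarrow> ra v a (V - {v} - X) = ra v a X"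
    and seq3_r: "seq3 V r"
    and card_V: "13 \<le> card V"
begin

lemma prime_r:
  assumes "X \<subseteq> V" "2 \<le> card X" "2 \<le> card (V - X)"
  shows "2 \<le> r X"
proof (rule ccontr)
  assume "\<not> ?thesis"
  then have "r X \<le> 1" by simp
  then have "card X \<le> 1 \<or> card (V - X) \<le> 1"
    using seq3_r assms(1) unfolding seq3_def primef_def by blast
  then show False using assms by simp
qed

lemma finite_sub: "X \<subseteq> V \<Longrightarrow> finite X"
  using finV finite_subset by blast

lemma card_compl: "X \<subseteq> V \<Longrightarrow> card (V - X) = card V - card X"
  using finite_sub card_Diff_subset by blast

text \<open>A lighter nonzero word would give a two-element set of rank at most 1, against
  primeness.\<close>

lemma card_supp:
  assumes "g \<in> L" "g \<noteq> 0"
  shows "3 \<le> card (supp g)"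
proof (rule ccontr)
  assume "\<not> ?thesis"
  then have "card (supp g) \<le> 2" by simp
  moreover have "supp g \<subseteq> V" using assms supp_L by blast
  moreover have "2 \<le> card V" using card_V by simp
  ultimately obtain X where X: "supp g \<subseteq> X" "X \<subseteq> V" "card X = 2"
    using exists_subset_between[of "supp g" 2 V] finV by auto
  then have "2 \<le> r X" using prime_r[of X] card_compl[of X] card_V by simp
  then show False using r_supp_less[of g X] assms X by simp
qed

lemma supp_eqI:
  assumes "g \<in> L" "g \<noteq> 0" "supp g \<subseteq> X" "card X \<le> 3" "finite X"
  shows "supp g = X"
  using card_supp[OF assms(1,2)] assms(3-5) card_mono[OF assms(5,3)]
  by (intro card_subset_eq) auto

lemma ra_supp_less:
  assumes "g \<in> L" "g \<noteq> 0" "supp g \<subseteq> insert v X" "g v = 0 \<or> g v = a"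
  shows "ra v a X \<le> card X - 1"
proof -
  have "{0} \<subset> N v a X" using assms by (auto simp: N_def)
  moreover have "add_subgroup {0 :: 'a word}" by (simp add: add_subgroup_def)
  ultimately have "dim2 {0 :: 'a word} < dim2 (N v a X)" by (intro dim2_less) auto
  then show ?thesis by (simp add: ra_def)
qed

lemma r_compl_insert:
  assumes "v \<in> V" "X \<subseteq> V - {v}"
  shows "r (V - {v} - X) = r (insert v X)"
proof -
  have "V - {v} - X = V - insert v X" "insert v X \<subseteq> V" using assms by auto
  then show ?thesis using r_sym by simp
qed

lemma ra_ne_r_letter:
  assumes "v \<notin> X" "ra v a X \<noteq> r X"
  shows "\<exists>e\<in>L. supp e \<subseteq> insert v X \<and> e v = a"
  using ra_eq_r assms by blast

text \<open>The rank difference on the other side yields a word with letter \<open>a\<close> at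
  \<open>v\<close> supported there. It meets \<open>g\<close> at most in \<open>v\<close>, so
  isotropy forbids that the two letters at \<open>v\<close> anticommute.\<close>

lemma letter_in:
  assumes "v \<in> V" "a \<noteq> 0" "X \<subseteq> V - {v}" "ra v a (V - {v} - X) \<noteq> r (V - {v} - X)"
    and "g \<in> L" "supp g \<subseteq> insert v X"
  shows "g v = 0 \<or> g v = a"
proof -
  obtain e where e: "e \<in> L" "supp e \<subseteq> insert v (V - {v} - X)" "e v = a"
    using ra_ne_r_letter[OF _ assms(4)] by auto
  have "(\<Sum>x\<in>{v}. symp (g x) (e x)) = 0"
    by (rule symp_on) (use assms e in auto)
  then have "symp (g v) (e v) = 0" by simp
  then show ?thesis using e assms(2) by (auto simp: symp_anti anti_def)
qed

text \<open>\<open>bad v a X\<close>: the minor is prime, and \<open>X\<close> shows that it is not sequentially 3-rank-connected.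
  \<open>split v a X\<close>: \<open>X\<close> shows that the minor is not prime.\<close>

definition bad :: "'a \<Rightarrow> letter \<Rightarrow> 'a set \<Rightarrow> bool" where
  "bad v a X \<longleftrightarrow> v \<in> V \<and> a \<noteq> 0 \<and> primef (V - {v}) (ra v a) \<and> X \<subseteq> V - {v} \<and> ra v a X \<le> 2 \<and>
    \<not> seqf (ra v a) X \<and> \<not> seqf (ra v a) (V - {v} - X)"

definition split :: "'a \<Rightarrow> letter \<Rightarrow> 'a set \<Rightarrow> bool" where
  "split v a X \<longleftrightarrow> v \<in> V \<and> a \<noteq> 0 \<and> X \<subseteq> V - {v} \<and> ra v a X \<le> 1 \<and>
    2 \<le> card X \<and> 2 \<le> card (V - {v} - X)"

lemma not_seq3_bad:
  assumes "v \<in> V" "a \<noteq> 0" "primef (V - {v}) (ra v a)" "\<not> seq3 (V - {v}) (ra v a)"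
  shows "\<exists>X. bad v a X"
  using assms unfolding seq3_def bad_def by blast

lemma not_prime_split:
  assumes "v \<in> V" "a \<noteq> 0" "\<not> primef (V - {v}) (ra v a)"
  shows "\<exists>X. split v a X"
proof -
  obtain X where "X \<subseteq> V - {v}" "ra v a X \<le> 1" "\<not> card X \<le> 1" "\<not> card (V - {v} - X) \<le> 1"
    using assms unfolding primef_def by blast
  then have "split v a X" using assms by (simp add: split_def)
  then show ?thesis by blast
qed

lemma compl_compl: "X \<subseteq> V - {v} \<Longrightarrow> V - {v} - (V - {v} - X) = X"
  by blast

lemma bad_sym: "bad v a X \<Longrightarrow> bad v a (V - {v} - X)"
  using ra_sym[of v a X] compl_compl[of X v] unfolding bad_def by auto

lemma split_sym: "split v a X \<Longrightarrow> split v a (V - {v} - X)"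
  using ra_sym[of v a X] compl_compl[of X v] unfolding split_def by auto

lemma bad_card:
  assumes "bad v a X"
  shows "4 \<le> card X"
proof (rule ccontr)
  assume "\<not> ?thesis"
  moreover have "finite X" using assms finite_sub by (auto simp: bad_def)
  moreover have "ra v a B \<le> 2" if "card B \<le> 2" for B
    using ra_le_card[of v a B] that by linarith
  ultimately have "seqf (ra v a) X" using assms by (intro seqf_small) (auto simp: bad_def)
  then show False using assms by (simp add: bad_def)
qed

lemma seqf_ra_remove:
  assumes "seqf r A" "A \<subseteq> V" "v \<in> V" "a \<noteq> 0"
  shows "seqf (ra v a) (A - {v})"
  using assms(1,2)
proof (induction rule: seqf.induct)
  case (insert A x)
  have IH: "seqf (ra v a) (A - {v})" using insert by simp
  show ?case
  proof (cases "x = v")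
    case False
    let ?B = "insert x A"
    have "ra v a (?B - {v}) \<le> 2"
    proof (cases "v \<in> A")
      case True
      \<comment> \<open>The inequality between \<open>ra\<close> and \<open>r\<close> concerns sets
        avoiding \<open>v\<close>; when the initial segment contains \<open>v\<close>, its
        complement does not.\<close>
      have "ra v a (?B - {v}) = ra v a (V - {v} - (?B - {v}))"
        using insert.prems assms by (intro ra_sym[symmetric]) auto
      also have "V - {v} - (?B - {v}) = V - ?B" using True by blast
      also have "ra v a (V - ?B) \<le> r (V - ?B)" using True by (intro ra_le_r) auto
      also have "\<dots> = r ?B" using insert.prems by (rule r_sym)
      finally show ?thesis using insert.hyps by simp
    next
      case 1: False
      then have "?B - {v} = ?B" using False by auto
      moreover have "ra v a ?B \<le> r ?B" using 1 False by (intro ra_le_r) auto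
      ultimately show ?thesis using insert.hyps by simp
    qed
    moreover have "?B - {v} = insert x (A - {v})" using False by auto
    ultimately show ?thesis using seqf.insert[OF IH, of x] by simp
  qed (use IH in simp)
qed (simp add: seqf.empty)

text \<open>If \<open>r X\<close> were at most 2, then \<open>X\<close> or its complement would be
  sequential in the whole graph, and deleting \<open>v\<close> from the ordering would keep it
  sequential in the minor. Passing to the minor lowers the rank by at most one, which leaves only
  the values 3 and 2.\<close>

lemma bad_rank:
  assumes "bad v a X"
  shows "r X = 3" "ra v a X = 2"
proof -
  note b = assms[unfolded bad_def]
  have "\<not> r X \<le> 2"
  proof
    assume "r X \<le> 2"
    moreover have "X \<subseteq> V" using b by blast
    ultimately consider "seqf r X" | "seqf r (V - X)"
      using seq3_r unfolding seq3_def by blast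
    then show False
    proof cases
      case 1
      then have "seqf (ra v a) X"
        by (rule seqf_mono) (use b in \<open>intro ra_le_r, blast\<close>)
      then show False using b by blast
    next
      case 2
      then have "seqf (ra v a) (V - X - {v})"
        using b by (intro seqf_ra_remove) auto
      moreover have "V - X - {v} = V - {v} - X" by blast
      ultimately show False using b by simp
    qed
  qed
  moreover have "r X \<le> ra v a X + 1" using b by (intro r_le_ra) auto
  ultimately show "r X = 3" "ra v a X = 2" using b by linarith+
qed

lemma split_rank:
  assumes "split v a X"
  shows "r X = 2" "ra v a X = 1"
proof -
  note b = assms[unfolded split_def]
  have "card (V - {v} - X) \<le> card (V - X)" using finV by (intro card_mono) auto
  then have "2 \<le> r X" using b by (intro prime_r) auto
  moreover have "r X \<le> ra v a X + 1" using b by (intro r_le_ra) auto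
  ultimately show "r X = 2" "ra v a X = 1" using b by linarith+
qed

lemma bad_word:
  assumes "bad v a X"
  shows "\<exists>e\<in>L. supp e \<subseteq> insert v X \<and> e v = a"
  using bad_rank[OF assms] assms by (intro ra_ne_r_letter) (auto simp: bad_def)

lemma split_word:
  assumes "split v a X"
  shows "\<exists>e\<in>L. supp e \<subseteq> insert v X \<and> e v = a"
  using split_rank[OF assms] assms by (intro ra_ne_r_letter) (auto simp: split_def)

lemma bad_letter_in:
  assumes "bad v a X" "g \<in> L" "supp g \<subseteq> insert v X"
  shows "g v = 0 \<or> g v = a"
  using bad_rank[OF bad_sym[OF assms(1)]] assms by (intro letter_in[of v a X]) (auto simp: bad_def)

lemma split_letter_in:
  assumes "split v a X" "g \<in> L" "supp g \<subseteq> insert v X"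
  shows "g v = 0 \<or> g v = a"
  using split_rank[OF split_sym[OF assms(1)]] assms
  by (intro letter_in[of v a X]) (auto simp: split_def)

lemma bad_letter_out:
  assumes "bad v a X" "g \<in> L" "supp g \<inter> X = {}"
  shows "g v = 0 \<or> g v = a"
  using supp_L[OF assms(2)] assms(3) by (intro bad_letter_in[OF bad_sym[OF assms(1)] assms(2)]) auto

lemma split_letter_out:
  assumes "split v a X" "g \<in> L" "supp g \<inter> X = {}"
  shows "g v = 0 \<or> g v = a"
  using supp_L[OF assms(2)] assms(3) by (intro split_letter_in[OF split_sym[OF assms(1)] assms(2)]) auto

text \<open>If the enlarged set were sequential, so would be its intersection with \<open>X\<close>,
  by \<open>seqf_subset\<close>. If the shrunken complement were sequential, appending
  \<open>y\<close> would order the old complement.\<close>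

lemma bad_insert_rank:
  assumes b: "bad v a X" and y: "y \<in> V" "y \<noteq> v" "y \<notin> X" and le: "ra v a (insert y X) \<le> 2"
  shows "bad v a (insert y X)"
proof -
  note d = b[unfolded bad_def]
  let ?X = "insert y X" and ?Y = "V - {v} - X"
  have sub: "?X \<subseteq> V - {v}" using d y by auto
  have eq: "V - {v} - ?X = ?Y - {y}" by blast
  have "\<not> seqf (ra v a) ?X"
  proof
    assume s: "seqf (ra v a) ?X"
    have "4 \<le> card ?Y" using bad_card[OF bad_sym[OF b]] .
    moreover have "card (?Y - {y}) = card ?Y - 1" using y finV by (simp add: card_Diff_singleton)
    ultimately have "2 \<le> card (V - {v} - (?X \<union> X))"
      using eq by (simp add: Un_absorb2 subset_insertI)
    then have "seqf (ra v a) (?X \<inter> X)"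
      using s sub d finV ra_submod
    proof (intro seqf_subset[where V = "V - {v}"])
      show "ra v a Z \<le> 2" if "card Z \<le> 2" for Z
        using ra_le_card[of v a Z] that by linarith
    qed auto
    moreover have "?X \<inter> X = X" by blast
    ultimately show False using d by simp
  qed
  moreover have "\<not> seqf (ra v a) (V - {v} - ?X)"
  proof
    assume s: "seqf (ra v a) (V - {v} - ?X)"
    have "insert y (V - {v} - ?X) = ?Y" using y by auto
    moreover have "ra v a ?Y \<le> 2" using ra_sym[of v a X] d by simp
    ultimately have "seqf (ra v a) ?Y" using seqf.insert[OF s, of y] by simp
    then show False using d by simp
  qed
  ultimately show ?thesis using d le sub by (simp add: bad_def)
qed

lemma bad_remove_rank:
  assumes b: "bad v a X" and y: "y \<in> X" and le: "ra v a (X - {y}) \<le> 2"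
  shows "bad v a (X - {y})"
proof -
  have X: "v \<in> V" "a \<noteq> 0" "X \<subseteq> V - {v}" using b by (auto simp: bad_def)
  have eq: "insert y (V - {v} - X) = V - {v} - (X - {y})" using X y by auto
  have "X - {y} \<subseteq> V - {v}" using X by blast
  then have "ra v a (V - {v} - (X - {y})) \<le> 2" using ra_sym X le by metis
  then have "bad v a (insert y (V - {v} - X))"
    using X y by (intro bad_insert_rank bad_sym b) (auto simp: eq)
  moreover have "V - {v} - insert y (V - {v} - X) = X - {y}" using X by blast
  ultimately show ?thesis using bad_sym by metis
qed

lemma bad_insert:
  assumes b: "bad v a X" and g: "g \<in> L" "supp g \<subseteq> insert v (insert y X)" "g v = 0 \<or> g v = a"
    and y: "y \<noteq> v" "g y \<noteq> 0"
  shows "bad v a (insert y X)"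
proof (cases "y \<in> X")
  case False
  have "X \<subseteq> V" using b by (auto simp: bad_def)
  then have "ra v a (insert y X) \<le> 2"
    using ra_insert_le[OF finite_sub[of X] g y] bad_rank[OF b] by simp
  moreover have "y \<in> V" using supp_L[OF g(1)] y by (auto simp: supp_def)
  ultimately show ?thesis using bad_insert_rank b y False by blast
qed (use b in \<open>simp add: insert_absorb\<close>)

text \<open>This is \<open>bad_insert\<close> on the other side of the obstruction.\<close>

lemma bad_remove:
  assumes b: "bad v a X" and g: "g \<in> L" "supp g \<inter> X \<subseteq> {y}" "g v = 0 \<or> g v = a"
    and y: "y \<noteq> v" "g y \<noteq> 0"
  shows "bad v a (X - {y})"
proof -
  have X: "X \<subseteq> V - {v}" using b by (auto simp: bad_def)
  have "bad v a (insert y (V - {v} - X))"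
    using supp_L[OF g(1)] g(2) by (intro bad_insert[OF bad_sym[OF b] g(1) _ g(3) y]) auto
  moreover have "V - {v} - insert y (V - {v} - X) = X - {y}" using X by blast
  ultimately show ?thesis using bad_sym by metis
qed

text \<open>Two of the three vertices lie on the same side, and the word then moves the third one to
  them.\<close>

lemma bad_majority:
  assumes b: "bad v a X" and g: "g \<in> L" "supp g \<subseteq> {v, p, q, s}" "g v = 0 \<or> g v = a"
    and ne: "g p \<noteq> 0" "g q \<noteq> 0" "g s \<noteq> 0" "p \<noteq> v" "q \<noteq> v" "s \<noteq> v"
  shows "bad v a (X \<union> {p, q, s}) \<or> bad v a (X - {p, q, s})"
proof -
  note ins = bad_insert[OF b g(1) _ g(3)]
  note rem = bad_remove[OF b g(1) _ g(3)]
  have vX: "v \<notin> X" using b by (auto simp: bad_def)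
  consider "p \<in> X" "q \<in> X" | "p \<in> X" "s \<in> X" | "q \<in> X" "s \<in> X"
    | "p \<notin> X" "q \<notin> X" | "p \<notin> X" "s \<notin> X" | "q \<notin> X" "s \<notin> X" by blast
  then show ?thesis
  proof cases
    case 1
    then have "supp g \<subseteq> insert v (insert s X)" "X \<union> {p, q, s} = insert s X" using g(2) by auto
    then show ?thesis using ins ne by simp
  next
    case 2
    then have "supp g \<subseteq> insert v (insert q X)" "X \<union> {p, q, s} = insert q X" using g(2) by auto
    then show ?thesis using ins ne by simp
  next
    case 3
    then have "supp g \<subseteq> insert v (insert p X)" "X \<union> {p, q, s} = insert p X" using g(2) by auto
    then show ?thesis using ins ne by simp
  next
    case 4
    then have "supp g \<inter> X \<subseteq> {s}" "X - {p, q, s} = X - {s}" using g(2) vX by auto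
    then show ?thesis using rem ne by simp
  next
    case 5
    then have "supp g \<inter> X \<subseteq> {q}" "X - {p, q, s} = X - {q}" using g(2) vX by auto
    then show ?thesis using rem ne by simp
  next
    case 6
    then have "supp g \<inter> X \<subseteq> {p}" "X - {p, q, s} = X - {p}" using g(2) vX by auto
    then show ?thesis using rem ne by simp
  qed
qed

text \<open>The other side must keep two vertices after losing \<open>y\<close>, hence the bound
  3.\<close>

lemma split_insert:
  assumes b: "split v a X" and g: "g \<in> L" "supp g \<subseteq> insert v (insert y X)" "g v = 0 \<or> g v = a"
    and y: "y \<noteq> v" "g y \<noteq> 0" and large: "3 \<le> card (V - {v} - X)"
  shows "split v a (insert y X)"
proof (cases "y \<in> X")
  case False
  have X: "X \<subseteq> V - {v}" using b by (auto simp: split_def)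
  then have fin: "finite X" using finite_sub[of X] by blast
  then have "ra v a (insert y X) \<le> 1"
    using ra_insert_le[OF _ g y] split_rank[OF b] by simp
  moreover have "y \<in> V" using supp_L[OF g(1)] y by (auto simp: supp_def)
  moreover have "V - {v} - insert y X = (V - {v} - X) - {y}" by blast
  then have "card (V - {v} - insert y X) = card (V - {v} - X) - 1"
    using \<open>y \<in> V\<close> y False finV by (simp add: card_Diff_singleton)
  ultimately show ?thesis using b y False fin large by (auto simp: split_def)
qed (use b in \<open>simp add: insert_absorb\<close>)

text \<open>The two remaining positions of \<open>t\<close> form a set of rank at most 1 in the
  minor.\<close>

lemma triple_not_prime:
  assumes "t \<in> L" "card (supp t) = 3" "t v \<noteq> 0"
  shows "\<not> primef (V - {v}) (ra v (t v))"
proof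
  assume p: "primef (V - {v}) (ra v (t v))"
  let ?X = "supp t - {v}"
  have v: "v \<in> supp t" "supp t \<subseteq> V" using assms supp_L by (auto simp: supp_def)
  then have c: "card ?X = 2" using assms(2) by simp
  have sub: "?X \<subseteq> V - {v}" using v by blast
  have "ra v (t v) ?X \<le> 1"
    using ra_supp_less[of t v ?X "t v"] assms c by force
  moreover have "V - {v} - ?X = V - supp t" using v by blast
  then have "card (V - {v} - ?X) = card V - 3" using card_compl[OF v(2)] assms(2) by simp
  moreover have "card ?X \<le> 1 \<or> card (V - {v} - ?X) \<le> 1"
    using p sub calculation(1) unfolding primef_def by blast
  ultimately show False using c card_V by linarith
qed

text \<open>Two splits cross in nearly empty corners, so one of the four sides is covered by two
  corners of at most one vertex each. A two-element side together with \<open>v\<close> carries a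
  word of weight three.\<close>

lemma two_splits_triple:
  assumes v: "v \<in> V" and ab: "a \<noteq> 0" "b \<noteq> 0" "a \<noteq> b"
    and np: "\<not> primef (V - {v}) (ra v a)" "\<not> primef (V - {v}) (ra v b)"
  shows "\<exists>t\<in>L. card (supp t) = 3 \<and> (t v = a \<or> t v = b)"
proof -
  obtain X where X: "split v a X" using not_prime_split[OF v ab(1) np(1)] by blast
  obtain Y where Y: "split v b Y" using not_prime_split[OF v ab(2) np(2)] by blast
  let ?X = "V - {v} - X" and ?Y = "V - {v} - Y"
  \<comment> \<open>The crossing inequality bounds the two ranks by 1 + 1 + 1, while primeness would
    give at least 2 + 2.\<close>
  have *: "card (P \<inter> Q) \<le> 1 \<or> card ((V - {v} - P) \<inter> (V - {v} - Q)) \<le> 1"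
    if P: "split v a P" and Q: "split v b Q" for P Q
  proof (rule ccontr)
    assume "\<not> ?thesis"
    then have c: "2 \<le> card (P \<inter> Q)" "2 \<le> card ((V - {v} - P) \<inter> (V - {v} - Q))" by simp_all
    have sub: "P \<subseteq> V - {v}" "Q \<subseteq> V - {v}" using P Q by (auto simp: split_def)
    have eq: "(V - {v} - P) \<inter> (V - {v} - Q) = V - insert v (P \<union> Q)" by blast
    have "card (V - insert v (P \<union> Q)) \<le> card (V - (P \<inter> Q))"
      "card (P \<inter> Q) \<le> card (insert v (P \<union> Q))"
      using finV sub v by (auto intro!: card_mono finite_sub)
    moreover have "P \<inter> Q \<subseteq> V" "insert v (P \<union> Q) \<subseteq> V" using sub v by auto
    ultimately have "2 \<le> r (P \<inter> Q)" "2 \<le> r (insert v (P \<union> Q))"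
      using c eq by (auto intro: prime_r)
    moreover have "r (P \<inter> Q) + r (insert v (P \<union> Q)) \<le> ra v a P + ra v b Q + 1"
      using crossing[of P v Q a b] sub v ab by simp
    ultimately show False using split_rank[OF P] split_rank[OF Q] by linarith
  qed
  have tr: "\<exists>t\<in>L. card (supp t) = 3 \<and> t v = c" if Z: "split v c Z" and le: "card Z \<le> 2" for c Z
  proof -
    obtain e where e: "e \<in> L" "supp e \<subseteq> insert v Z" "e v = c" using split_word[OF Z] by blast
    have "finite Z" "c \<noteq> 0" using Z finite_sub[of Z] by (auto simp: split_def)
    then have "card (supp e) \<le> 3"
      using e le by (intro order.trans[OF card_mono[OF _ e(2)]]) (auto simp: card_insert_if)
    moreover have "e \<noteq> 0" using e \<open>c \<noteq> 0\<close> by auto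
    ultimately show ?thesis using card_supp[OF e(1)] e by force
  qed
  have un: "card Z \<le> 2" if "card (Z \<inter> Q) \<le> 1" "card (Z \<inter> (V - {v} - Q)) \<le> 1" "Z \<subseteq> V - {v}" for Z Q
  proof -
    have "Z = (Z \<inter> Q) \<union> (Z \<inter> (V - {v} - Q))" using that by blast
    then have "card Z \<le> card (Z \<inter> Q) + card (Z \<inter> (V - {v} - Q))" by (metis card_Un_le)
    then show ?thesis using that by simp
  qed
  have sub: "X \<subseteq> V - {v}" "Y \<subseteq> V - {v}" using X Y by (auto simp: split_def)
  note 1 = *[OF X Y] and 2 = *[OF X split_sym[OF Y]]
  have cc: "V - {v} - ?Y = Y" using sub by blast
  note 2 = 2[unfolded cc]
  have "card X \<le> 2 \<or> card ?X \<le> 2 \<or> card Y \<le> 2 \<or> card ?Y \<le> 2"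
    using 1 2 un[of X Y] un[of ?X Y] un[of Y X] un[of ?Y X] sub
    by (auto simp: Int_commute)
  then show ?thesis using tr X Y split_sym[OF X] split_sym[OF Y] by blast
qed

end

subsection \<open>Words of weight three\<close>

lemma of_bool_bit_add: "(of_bool P + of_bool Q = (0 :: bit)) \<longleftrightarrow> (P \<longleftrightarrow> Q)"
  by (cases P; cases Q) auto

lemma of_bool_bit_add3: "(of_bool P + (of_bool Q + of_bool R) = (0 :: bit)) \<longleftrightarrow> (P \<longleftrightarrow> Q \<noteq> R)"
  by (cases P; cases Q; cases R) auto

lemma card_3_elems:
  assumes "card S = 3" "p \<in> S" "q \<in> S" "p \<noteq> q"
  shows "\<exists>z. S = {p, q, z} \<and> z \<noteq> p \<and> z \<noteq> q"
proof -
  have "finite S" using assms(1) by (metis card.infinite zero_neq_numeral)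
  then have "card (S - {p, q}) = 1" using assms by (simp add: card_Diff_subset)
  then obtain z where z: "S - {p, q} = {z}" by (metis card_1_singletonE)
  then have "S = {p, q, z}" "z \<noteq> p" "z \<noteq> q" using assms by blast+
  then show ?thesis by blast
qed

lemma card_subset_pair:
  assumes "S \<subseteq> {p, q}"
  shows "card S \<le> 2"
proof -
  have "card S \<le> card {p, q}" using assms by (intro card_mono) auto
  also have "\<dots> \<le> 2" by (simp add: card_insert_if)
  finally show ?thesis .
qed

lemma card_3_elem:
  assumes "card S = 3" "p \<in> S"
  shows "\<exists>q z. S = {p, q, z} \<and> distinct [p, q, z]"
proof -
  have "S \<noteq> {p}" using assms by auto
  then obtain q where "q \<in> S" "q \<noteq> p" using assms by blast
  with card_3_elems[OF assms this(1)] show ?thesis by auto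
qed

lemma two_other_letters: "\<exists>a b :: letter. a \<noteq> 0 \<and> b \<noteq> 0 \<and> a \<noteq> b \<and> a \<noteq> c \<and> b \<noteq> c"
proof -
  have "(0, 1) \<noteq> (0 :: letter)" "(1, 0) \<noteq> (0 :: letter)" "(1, 1) \<noteq> (0 :: letter)"
    by (auto simp: zero_prod_def)
  moreover have "(0, 1) \<noteq> ((1, 0) :: letter)" "(0, 1) \<noteq> ((1, 1) :: letter)" "(1, 0) \<noteq> ((1, 1) :: letter)"
    by auto
  ultimately show ?thesis by metis
qed

context seq_words
begin

lemma symp_finite:
  assumes "g \<in> L" "h \<in> L" "finite F" "supp g \<inter> supp h \<subseteq> F"
  shows "(\<Sum>x\<in>F. symp (g x) (h x)) = 0"
proof -
  have "(\<Sum>x\<in>F. symp (g x) (h x)) = (\<Sum>x\<in>F \<inter> V. symp (g x) (h x))"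
    using assms(3) supp_L[OF assms(1)]
    by (intro sum.mono_neutral_right) (auto simp: symp_anti anti_def supp_def)
  also have "\<dots> = 0" using assms supp_L[OF assms(1)] by (intro symp_on) auto
  finally show ?thesis .
qed

lemma symp_one:
  assumes "g \<in> L" "h \<in> L" "supp g \<inter> supp h \<subseteq> {p}"
  shows "\<not> anti (g p) (h p)"
proof -
  have "symp (g p) (h p) = 0" using symp_finite[OF assms(1,2) _ assms(3)] by simp
  then show ?thesis by (simp add: symp_anti)
qed

lemma symp_two:
  assumes "g \<in> L" "h \<in> L" "supp g \<inter> supp h \<subseteq> {p, q}" "p \<noteq> q"
  shows "anti (g p) (h p) \<longleftrightarrow> anti (g q) (h q)"
proof -
  have "symp (g p) (h p) + symp (g q) (h q) = 0" using symp_finite[OF assms(1,2) _ assms(3)] assms(4) by simp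
  then show ?thesis unfolding symp_anti of_bool_bit_add .
qed

lemma symp_three:
  assumes "g \<in> L" "h \<in> L" "supp g \<inter> supp h \<subseteq> {p, q, s}" "distinct [p, q, s]"
  shows "anti (g p) (h p) \<longleftrightarrow> anti (g q) (h q) \<noteq> anti (g s) (h s)"
proof -
  have "symp (g p) (h p) + (symp (g q) (h q) + symp (g s) (h s)) = 0"
    using symp_finite[OF assms(1,2) _ assms(3)] assms(4) by simp
  then show ?thesis unfolding symp_anti of_bool_bit_add3 .
qed

text \<open>With \<open>p\<close> and \<open>q\<close> on the same side, the word would live on that
  side and \<open>v\<close>, where only the letters \<open>0\<close> and \<open>a\<close> are
  possible at \<open>v\<close>.\<close>

lemma bad_separates:
  assumes b: "bad v a X" and t: "t \<in> L" "supp t \<subseteq> {v, p, q}" "t v \<noteq> 0" "t v \<noteq> a"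
  shows "p \<in> X \<longleftrightarrow> q \<notin> X"
proof -
  have "v \<notin> X" using b by (auto simp: bad_def)
  then have "\<not> (p \<in> X \<and> q \<in> X)" "\<not> (p \<notin> X \<and> q \<notin> X)"
    using bad_letter_in[OF b t(1)] bad_letter_out[OF b t(1)] t(2-) by auto
  then show ?thesis by blast
qed

lemma split_separates:
  assumes b: "split v a X" and t: "t \<in> L" "supp t \<subseteq> {v, p, q}" "t v \<noteq> 0" "t v \<noteq> a"
  shows "p \<in> X \<longleftrightarrow> q \<notin> X"
proof -
  have "v \<notin> X" using b by (auto simp: split_def)
  then have "\<not> (p \<in> X \<and> q \<in> X)" "\<not> (p \<notin> X \<and> q \<notin> X)"
    using split_letter_in[OF b t(1)] split_letter_out[OF b t(1)] t(2-) by auto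
  then show ?thesis by blast
qed

lemma r_ge2: "X \<subseteq> V \<Longrightarrow> 2 \<le> card X \<Longrightarrow> card X \<le> 10 \<Longrightarrow> 2 \<le> r X"
  using prime_r[of X] card_compl[of X] card_V by simp

text \<open>At a position where two such words differ, adding that vertex to the other two would
  lower the rank from at most 2 to at most 1.\<close>

lemma triple_same_supp:
  assumes "t \<in> L" "t' \<in> L" "supp t = supp t'" "card (supp t) = 3"
  shows "t = t'"
proof (rule ccontr)
  assume "t \<noteq> t'"
  then obtain x where x: "t x \<noteq> t' x" by (auto simp: fun_eq_iff)
  then have x': "t x \<noteq> 0" "t' x \<noteq> 0" using assms(3) by (auto simp: supp_def set_eq_iff)
  let ?X = "supp t - {x}"
  have X: "insert x ?X = supp t" "x \<in> supp t" using x' by (auto simp: supp_def)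
  have fin: "finite (supp t)" using supp_L[OF assms(1)] finite_sub by blast
  then have "card ?X = 2" using assms(4) X by simp
  moreover have "r (insert x ?X) \<le> r ?X - 1"
    by (rule r_insert_le2[of _ _ t t']) (use x x' assms X fin in auto)
  moreover have "2 \<le> r (supp t)" using assms supp_L[OF assms(1)] by (intro r_ge2) auto
  ultimately show False using r_le_card[of ?X] X by simp
qed

section \<open>Fans: two words of weight three whose supports share two positions\<close>

lemma fan_anti:
  assumes t: "t \<in> L" "t' \<in> L" "supp t = {x1, x2, x3}" "supp t' = {x2, x3, x4}" "distinct [x1, x2, x3, x4]"
  shows "anti (t x2) (t' x2)" "anti (t x3) (t' x3)"
proof -
  have iff: "anti (t x2) (t' x2) \<longleftrightarrow> anti (t x3) (t' x3)"
    using t by (intro symp_two) auto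
  have nz: "t x1 \<noteq> 0" "t x2 \<noteq> 0" "t' x2 \<noteq> 0" "t x3 \<noteq> 0" "t' x3 \<noteq> 0"
    using t(3,4) by (auto simp flip: supp_iff)
  have "anti (t x2) (t' x2)"
  proof (rule ccontr)
    assume "\<not> ?thesis"
    \<comment> \<open>Nonzero letters that do not anticommute are equal, so the sum would cancel on
      both shared positions and have weight at most 2.\<close>
    then have "t x2 = t' x2" "t x3 = t' x3" using iff nz by (auto simp: anti_def)
    then have "supp (t + t') \<subseteq> {x1, x4}" using t(3,4) supp_add[of t t'] by (auto simp: supp_iff)
    then have "card (supp (t + t')) \<le> 2" by (rule card_subset_pair)
    moreover have "t' x1 = 0" using t(4,5) by (auto simp: supp_def)
    then have "t + t' \<noteq> 0" using nz by auto
    ultimately show False using card_supp[OF add_L[OF t(1,2)]] by simp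
  qed
  with iff show "anti (t x2) (t' x2)" "anti (t x3) (t' x3)" by auto
qed

end

locale stuck = seq_words +
  assumes no_seq3: "v \<in> V \<Longrightarrow> a \<noteq> 0 \<Longrightarrow> \<not> seq3 (V - {v}) (ra v a)"
begin

lemma prime_bad: "v \<in> V \<Longrightarrow> a \<noteq> 0 \<Longrightarrow> primef (V - {v}) (ra v a) \<Longrightarrow> \<exists>X. bad v a X"
  using not_seq3_bad no_seq3 by blast

text \<open>In every obstruction at \<open>y\<close>, the word \<open>t\<close> separates its two
  other positions, because \<open>a\<close> cannot be the letter of \<open>t\<close> there. The
  other word, or the sum, has an admissible letter at \<open>y\<close> and gathers those same two
  positions on one side by \<open>bad_majority\<close>.\<close>

lemma fan_not_prime_aux:
  assumes t: "t \<in> L" "t' \<in> L" "supp t = {x1, x2, x3}" "supp t' = {x2, x3, x4}" "distinct [x1, x2, x3, x4]"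
    and y: "y = x1 \<or> y = x2" and a: "a \<noteq> 0"
  shows "\<not> primef (V - {y}) (ra y a)"
proof
  assume p: "primef (V - {y}) (ra y a)"
  have "y \<in> V" using y t supp_L by blast
  then obtain X where X: "bad y a X" using prime_bad a p by blast
  have nz: "t x1 \<noteq> 0" "t x2 \<noteq> 0" "t' x2 \<noteq> 0" "t x3 \<noteq> 0" "t' x3 \<noteq> 0" "t' x4 \<noteq> 0"
    using t(3,4) by (auto simp flip: supp_iff)
  have z: "t' x1 = 0" "t x4 = 0" using t(3-5) by (auto simp: supp_def)
  have ta: "t y \<noteq> 0" "t y \<noteq> a" using triple_not_prime[of t y] t(1,3,5) p y nz by auto
  show False
    using y
  proof
    assume y: "y = x1"
    have "bad y a (X \<union> {x2, x3, x4}) \<or> bad y a (X - {x2, x3, x4})"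
      by (rule bad_majority[OF X t(2)]) (use t(4,5) nz z y in auto)
    then obtain Z where "bad y a Z" "x2 \<in> Z \<longleftrightarrow> x3 \<in> Z" by blast
    then show False using bad_separates[of y a Z t x2 x3] t ta y by auto
  next
    assume y: "y = x2"
    have "t' y \<noteq> 0" "t' y \<noteq> a" using triple_not_prime[of t' y] t(2,4,5) p y nz by auto
    moreover have "t y \<noteq> t' y" using fan_anti[OF t] y by (auto simp: anti_def)
    \<comment> \<open>Neither triple's own letter gives a prime minor, so \<open>a\<close> is the
      third letter, which is that of \<open>t + t'\<close>.\<close>
    ultimately have "a = t y + t' y" using letter_third[of "t y" "t' y" a] ta a by auto
    moreover have "t x3 \<noteq> t' x3" using fan_anti[OF t] by (auto simp: anti_def)
    moreover have "supp (t + t') \<subseteq> {y, x1, x3, x4}" using supp_add[of t t'] t y by auto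
    ultimately have "bad y a (X \<union> {x1, x3, x4}) \<or> bad y a (X - {x1, x3, x4})"
      using add_L[OF t(1,2)] t(5) nz z y by (intro bad_majority[OF X, of "t + t'"]) auto
    then obtain Z where "bad y a Z" "x1 \<in> Z \<longleftrightarrow> x3 \<in> Z" by blast
    then show False using bad_separates[of y a Z t x1 x3] t ta y by auto
  qed
qed

lemma fan_not_prime:
  assumes t: "t \<in> L" "t' \<in> L" "supp t = {x1, x2, x3}" "supp t' = {x2, x3, x4}" "distinct [x1, x2, x3, x4]"
    and y: "y \<in> {x1, x2, x3, x4}" and a: "a \<noteq> 0"
  shows "\<not> primef (V - {y}) (ra y a)"
proof -
  consider "y = x1 \<or> y = x2" | "y = x4 \<or> y = x3" using y by blast
  then show ?thesis
  proof cases
    case 1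
    then show ?thesis using fan_not_prime_aux[OF t] a by blast
  next
    case 2
    then show ?thesis
      by (intro fan_not_prime_aux[of t' t x4 x3 x2 x1]) (use t a in auto)
  qed
qed

text \<open>At \<open>x3\<close> the words \<open>t\<close>, \<open>t'\<close>, \<open>u\<close>
  avoid the letter \<open>c\<close>, so they force the alternation of \<open>x1\<close>,
  \<open>x2\<close>, \<open>x4\<close>, \<open>z\<close> across every split for \<open>c\<close>.
  But \<open>t + t'\<close> and \<open>t' + u\<close> have letter \<open>c\<close> there. The first
  can move \<open>x2\<close> to the side of \<open>x1\<close>, the second \<open>x4\<close> to the
  side of \<open>x2\<close>; a side with three vertices can afford to lose one, and at least one
  side is that large.\<close>

lemma no_long_fan:
  assumes t: "t \<in> L" "t' \<in> L" "supp t = {x1, x2, x3}" "supp t' = {x2, x3, x4}" "distinct [x1, x2, x3, x4]"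
    and u: "u \<in> L" "card (supp u) = 3" "anti (u x4) (t' x4)" "u x3 \<noteq> 0"
  shows False
proof -
  have V: "x1 \<in> V" "x2 \<in> V" "x3 \<in> V" "x4 \<in> V" using t supp_L by blast+
  have nz: "t x1 \<noteq> 0" "t x2 \<noteq> 0" "t' x2 \<noteq> 0" "t x3 \<noteq> 0" "t' x3 \<noteq> 0" "t' x4 \<noteq> 0"
    using t(3,4) by (auto simp flip: supp_iff)
  have z0: "t' x1 = 0" "t x4 = 0" using t(3-5) by (auto simp: supp_def)
  have u4: "x4 \<in> supp u" "x3 \<in> supp u" using u by (auto simp: anti_def supp_def)
  then obtain z where z: "supp u = {x3, x4, z}" "z \<noteq> x3" "z \<noteq> x4"
    using card_3_elems[OF u(2), of x3 x4] t(5) by auto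
  have "z \<noteq> x2"
  proof
    assume "z = x2"
    then have "supp u = supp t'" "card (supp t') = 3" using z t by auto
    then have "u = t'" using triple_same_supp u(1,2) t(2) by metis
    then show False using u(3) by (simp add: anti_def)
  qed
  have "z \<noteq> x1"
  proof
    assume "z = x1"
    \<comment> \<open>The word \<open>u\<close> adds \<open>x4\<close> at no cost, and the two
      letters of \<open>t\<close> and \<open>t'\<close> at \<open>x2\<close> then lower the rank to
      1.\<close>
    have "r {x1, x3} \<le> 2" using r_le_card[of "{x1, x3}"] t(5) by simp
    moreover have "r (insert x4 {x1, x3}) \<le> r {x1, x3}"
      by (rule r_insert_le[of _ u]) (use u z \<open>z = x1\<close> in \<open>auto simp: anti_def\<close>)
    moreover have "r (insert x2 {x1, x3, x4}) \<le> r {x1, x3, x4} - 1"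
      by (rule r_insert_le2[of _ _ t t']) (use t fan_anti[OF t] in \<open>auto simp: anti_def\<close>)
    ultimately have "r {x1, x2, x3, x4} \<le> 1" by (simp add: insert_commute)
    moreover have "2 \<le> r {x1, x2, x3, x4}" using V t(5) by (intro r_ge2) auto
    ultimately show False by simp
  qed
  have uz: "u z \<noteq> 0" "u x2 = 0" "u x1 = 0" "t z = 0" "t' z = 0"
    using z t \<open>z \<noteq> x1\<close> \<open>z \<noteq> x2\<close> by (auto simp: supp_def)
  have a3: "anti (t' x3) (u x3)"
  proof -
    have "anti (u x4) (t' x4) \<longleftrightarrow> anti (u x3) (t' x3)"
      using z t u \<open>z \<noteq> x2\<close> by (intro symp_two) auto
    then show ?thesis using u(3) by (auto simp: anti_def)
  qed
  have "\<not> anti (t x3) (u x3)"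
    using z t u \<open>z \<noteq> x1\<close> \<open>z \<noteq> x2\<close> by (intro symp_one) auto
  then have tu: "t x3 = u x3" using nz u(4) by (auto simp: anti_def)
  define c where "c = t x3 + t' x3"
  have c: "c \<noteq> 0" "c \<noteq> t x3" "c \<noteq> t' x3" "c \<noteq> u x3" "t' x3 + u x3 = c"
    using fan_anti[OF t] tu nz by (auto simp: c_def anti_def add.commute)
  have "\<not> primef (V - {x3}) (ra x3 c)"
    using fan_not_prime[OF t, of x3] c by simp
  then obtain Y where Y: "split x3 c Y" using not_prime_split[of x3 c] V c by blast
  obtain X where X: "split x3 c X" "x2 \<in> X"
  proof (cases "x2 \<in> Y")
    case False
    then have "x2 \<in> V - {x3} - Y" using V t(5) by auto
    then show ?thesis using that split_sym[OF Y] by blast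
  qed (use that Y in blast)
  have s: "x1 \<in> Z \<longleftrightarrow> x2 \<notin> Z" "x2 \<in> Z \<longleftrightarrow> x4 \<notin> Z" "x4 \<in> Z \<longleftrightarrow> z \<notin> Z" if "split x3 c Z" for Z
    using split_separates[OF that, of t x1 x2] split_separates[OF that, of t' x2 x4]
      split_separates[OF that, of u x4 z] t u z c nz by auto
  let ?Y = "V - {x3} - X"
  have X3: "X \<subseteq> V - {x3}" using X by (auto simp: split_def)
  have mem: "x1 \<in> ?Y" "x4 \<in> ?Y" "z \<in> X" using s[OF X(1)] X(2) V t(5) by auto
  have "card ?Y = card V - 1 - card X"
    using X3 V finite_sub[of X] finV by (subst card_Diff_subset) auto
  then consider "3 \<le> card X" | "3 \<le> card ?Y" using card_V by linarith
  then show False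
  proof cases
    case 1
    have eq: "V - {x3} - ?Y = X" using X3 by blast
    have "split x3 c (insert x2 ?Y)"
    proof (rule split_insert[OF split_sym[OF X(1)], of "t + t'"])
      show "supp (t + t') \<subseteq> insert x3 (insert x2 ?Y)" using supp_add[of t t'] t mem by auto
      show "(t + t') x2 \<noteq> 0" using fan_anti[OF t] by (auto simp: anti_def)
    qed (use t 1 eq add_L in \<open>auto simp: c_def\<close>)
    then show False using s(1) mem by blast
  next
    case 2
    have "split x3 c (insert x4 X)"
    proof (rule split_insert[OF X(1), of "t' + u"])
      show "supp (t' + u) \<subseteq> insert x3 (insert x4 X)" using supp_add[of t' u] t z mem X by auto
      show "(t' + u) x4 \<noteq> 0" using u(3) by (auto simp: anti_def)
    qed (use t u c 2 add_L in auto)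
    then show False using s(2) X(2) by blast
  qed
qed

text \<open>No minor at \<open>x4\<close> is prime, so two letters other than \<open>t' x4\<close>
  yield a word \<open>u\<close> of weight three anticommuting with \<open>t'\<close> at
  \<open>x4\<close>. By isotropy it meets \<open>t'\<close> again, in \<open>x3\<close> or
  \<open>x2\<close>, which extends the fan; the fan is symmetric in these two.\<close>

lemma no_fan:
  assumes t: "t \<in> L" "t' \<in> L" "supp t = {x1, x2, x3}" "supp t' = {x2, x3, x4}" "distinct [x1, x2, x3, x4]"
  shows False
proof -
  obtain a b where ab: "a \<noteq> 0" "b \<noteq> 0" "a \<noteq> b" "a \<noteq> t' x4" "b \<noteq> t' x4"
    using two_other_letters[of "t' x4"] by blast
  have "x4 \<in> V" using t supp_L by blast
  then obtain u where u: "u \<in> L" "card (supp u) = 3" "u x4 = a \<or> u x4 = b"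
    using two_splits_triple[of x4 a b] ab fan_not_prime[OF t, of x4] by auto
  have "t' x4 \<noteq> 0" using t(4) by (auto simp flip: supp_iff)
  then have an: "anti (u x4) (t' x4)" using u(3) ab by (auto simp: anti_def)
  have "\<not> supp u \<inter> supp t' \<subseteq> {x4}" using an symp_one[OF u(1) t(2)] by blast
  then consider "u x3 \<noteq> 0" | "u x2 \<noteq> 0" using t(4) by (auto simp: supp_def)
  then show False
  proof cases
    case 1
    then show False using no_long_fan[OF t u(1,2) an] by simp
  next
    case 2
    show False
      by (rule no_long_fan[of t t' x1 x3 x2 x4 u]) (use t u an 2 in auto)
  qed
qed

lemma triples_meet:
  assumes "t \<in> L" "card (supp t) = 3" "t' \<in> L" "card (supp t') = 3"
    and pq: "p \<noteq> q" "t p \<noteq> 0" "t q \<noteq> 0" "t' p \<noteq> 0" "t' q \<noteq> 0"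
  shows "t = t'"
proof -
  obtain z where z: "supp t = {p, q, z}" "z \<noteq> p" "z \<noteq> q"
    using card_3_elems[of "supp t" p q] assms by (auto simp: supp_iff)
  obtain z' where z': "supp t' = {p, q, z'}" "z' \<noteq> p" "z' \<noteq> q"
    using card_3_elems[of "supp t'" p q] assms by (auto simp: supp_iff)
  show ?thesis
  proof (cases "z = z'")
    case True
    then show ?thesis using triple_same_supp[of t t'] assms z z' by simp
  next
    case False
    then have False using no_fan[of t t' z p q z'] assms z z' by (simp add: insert_commute)
    then show ?thesis ..
  qed
qed

lemma triple_letter:
  assumes "t \<in> L" "card (supp t) = 3" "t' \<in> L" "card (supp t') = 3" "t v \<noteq> 0" "t' v \<noteq> 0"
  shows "t v = t' v"
proof (rule ccontr)
  assume ne: "t v \<noteq> t' v"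
  then have "t \<noteq> t'" by auto
  then have "x = v" if "t x \<noteq> 0" "t' x \<noteq> 0" for x
    using triples_meet[OF assms(1-4), of v x] assms(5,6) that by blast
  then have "supp t \<inter> supp t' \<subseteq> {v}" by (auto simp: supp_def)
  then have "\<not> anti (t v) (t' v)" using symp_one assms by blast
  then show False using ne assms by (simp add: anti_def)
qed

text \<open>Two words anticommute at an even number of positions, hence at exactly one of the other
  two positions of \<open>t\<close>. At the remaining one, \<open>g\<close> has letter
  \<open>0\<close> or that of \<open>t\<close>, and adding \<open>t\<close> clears the
  latter.\<close>

lemma anti_pair:
  assumes t: "t \<in> L" "card (supp t) = 3" and g: "g \<in> L" and x: "anti (g x) (t x)"
  shows "\<exists>q s g'. (g' = g \<or> g' = g + t) \<and> supp t = {x, q, s} \<and> distinct [x, q, s] \<and>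
    g' s = 0 \<and> anti (g' x) (t x) \<and> anti (g' q) (t q)"
proof -
  have "x \<in> supp t" using x by (simp add: anti_def supp_def)
  then obtain q s where qs: "supp t = {x, q, s}" "distinct [x, q, s]" using card_3_elem[OF t(2)] by blast
  have nz: "t x \<noteq> 0" "t q \<noteq> 0" "t s \<noteq> 0" using qs by (auto simp flip: supp_iff)
  have add: "anti (g y + t y) (t y) \<longleftrightarrow> anti (g y) (t y)" if "t y \<noteq> 0" for y
    using that by (auto simp: anti_def)
  have *: "?thesis" if "distinct [x, q, s]" "supp t = {x, q, s}" "anti (g q) (t q)" "\<not> anti (g s) (t s)"
    "t q \<noteq> 0" "t s \<noteq> 0" for q s
  proof -
    have "g s = 0 \<or> g s = t s" using that by (auto simp: anti_def)
    then show ?thesis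
    proof
      assume "g s = 0"
      then show ?thesis using that x by blast
    next
      assume "g s = t s"
      then have "(g + t) s = 0" "anti ((g + t) x) (t x)" "anti ((g + t) q) (t q)"
        using that x add nz by auto
      then show ?thesis using that by blast
    qed
  qed
  have "anti (g x) (t x) \<longleftrightarrow> anti (g q) (t q) \<noteq> anti (g s) (t s)"
    using qs t g by (intro symp_three) auto
  then consider "anti (g q) (t q)" "\<not> anti (g s) (t s)" | "anti (g s) (t s)" "\<not> anti (g q) (t q)"
    using x by blast
  then show ?thesis
  proof cases
    case 1
    then show ?thesis using *[of q s] qs nz by blast
  next
    case 2
    moreover have "supp t = {x, s, q}" "distinct [x, s, q]" using qs by auto
    ultimately show ?thesis using *[of s q] nz by blast
  qed
qed

text \<open>A word \<open>t\<close> fills \<open>A\<close>. Rank at most 2 on four vertices yields a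
  second word through \<open>x\<close>; modulo \<open>t\<close> it is either too light or a word of
  weight three sharing two positions with \<open>t\<close>.\<close>

lemma r_triple_insert:
  assumes A: "A \<subseteq> V" "card A = 3" "r A \<le> 2" and x: "x \<in> V" "x \<notin> A"
  shows "3 \<le> r (insert x A)"
proof (rule ccontr)
  assume "\<not> ?thesis"
  then have le: "r (insert x A) \<le> 2" by simp
  have fin: "finite A" using finite_sub A by blast
  obtain t where t: "t \<in> L" "t \<noteq> 0" "supp t \<subseteq> A" using r_less_card[of A] A by auto
  then have tA: "supp t = A" using supp_eqI A fin by auto
  obtain g where g: "g \<in> L" "supp g \<subseteq> insert x A" "g x \<noteq> 0"
  proof (rule ccontr)
    assume "\<not> thesis"
    then have *: "g \<in> L \<Longrightarrow> supp g \<subseteq> insert x A \<Longrightarrow> g x = 0" for g using that by blast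
    then have "LX (insert x A) = LX A" by (auto simp: LX_def supp_def)
    then have "r (insert x A) = r A + 1" using fin x by (simp add: r_def)
    moreover have "2 \<le> r A" using A by (intro r_ge2) auto
    ultimately show False using le by simp
  qed
  have tx: "t x = 0" using tA x by (auto simp: supp_def)
  have tri: False if "h \<in> L" "card (supp h) = 3" "h x \<noteq> 0" "anti (h p) (t p)" "anti (h q) (t q)" "p \<noteq> q" for h p q
    using triples_meet[OF t(1) _ that(1,2), of p q] that tA A tx by (auto simp: anti_def)
  have wt: "3 \<le> card (supp h)" if "h \<in> L" "h x \<noteq> 0" for h using card_supp that by force
  show False
  proof (cases "\<exists>y. anti (g y) (t y)")
    case True
    then obtain y where y: "anti (g y) (t y)" by blast
    obtain q s g' where g': "g' = g \<or> g' = g + t" "supp t = {y, q, s}" "distinct [y, q, s]"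
      "g' s = 0" "anti (g' y) (t y)" "anti (g' q) (t q)"
      using anti_pair[OF t(1) _ g(1) y] tA A by auto
    have g'L: "g' \<in> L" "g' x \<noteq> 0" using g'(1) g t tx add_L by auto
    have "supp g' \<subseteq> insert x A" using g'(1) g(2) tA supp_add[of g t] by auto
    then have "supp g' \<subseteq> {x, y, q}" using g'(2,4) tA by (auto simp: supp_def)
    then have "card (supp g') \<le> card {x, y, q}" by (intro card_mono) auto
    also have "\<dots> \<le> 3" by (simp add: card_insert_if)
    finally have "card (supp g') = 3" using wt[OF g'L] by simp
    then show False using tri[OF g'L(1) _ g'L(2) g'(5,6)] g'(3) by auto
  next
    case False
    \<comment> \<open>Now \<open>g\<close> and \<open>g + t\<close> divide \<open>A\<close> between
      them, so one of them has at most one position in \<open>A\<close>; with \<open>x\<close> its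
      weight is at most 2.\<close>
    then have eq: "g y = 0 \<or> g y = t y" if "y \<in> A" for y
      using that tA by (auto simp: anti_def supp_def)
    have fg: "finite (supp g)" using g(2) fin finite_subset by blast
    have "supp (g + t) \<subseteq> insert x (A - supp g)"
    proof
      fix y assume y: "y \<in> supp (g + t)"
      then have "y = x \<or> y \<in> A" using g(2) supp_add[of g t] tA by blast
      then show "y \<in> insert x (A - supp g)" using y eq[of y] by (auto simp: supp_iff)
    qed
    then have "card (supp (g + t)) \<le> card (insert x (A - supp g))" using fin by (intro card_mono) auto
    also have "\<dots> \<le> Suc (card (A - supp g))" using fin by (simp add: card_insert_if)
    finally have 1: "2 \<le> card (A - supp g)" using wt[OF add_L[OF g(1) t(1)]] g tx by simp
    have "A - supp g = A - (A \<inter> supp g)" by blast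
    then have "card (A - supp g) = 3 - card (A \<inter> supp g)"
      using fin A card_Diff_subset[of "A \<inter> supp g" A] by simp
    with 1 have "card (A \<inter> supp g) \<le> 1" by simp
    moreover have "supp g \<subseteq> insert x (A \<inter> supp g)" using g(2) by blast
    then have "card (supp g) \<le> card (insert x (A \<inter> supp g))" using fin by (intro card_mono) auto
    then have "card (supp g) \<le> Suc (card (A \<inter> supp g))"
      using fin by (simp add: card_insert_if split: if_splits)
    ultimately show False using wt[OF g(1,3)] by simp
  qed
qed

section \<open>Sets of rank at most 2, and minors that are not prime\<close>

lemma card_seqf_r: "seqf r A \<Longrightarrow> A \<subseteq> V \<Longrightarrow> card A \<le> 3"
proof (induction rule: seqf.induct)
  case (insert A x)
  have fin: "finite A" using insert finite_seqf by blast
  show ?case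
  proof (cases "x \<in> A \<or> card A < 3")
    case False
    then have "card A = 3" "A \<noteq> {}" using insert by auto
    then have "3 \<le> r (insert x A)"
      using insert False seqf_le2[OF insert.hyps(1)] by (intro r_triple_insert) auto
    then show ?thesis using insert by simp
  qed (use insert fin in \<open>auto simp: card_insert_if insert_absorb\<close>)
qed simp

lemma card_r_le2: "X \<subseteq> V \<Longrightarrow> r X \<le> 2 \<Longrightarrow> card X \<le> 3 \<or> card (V - X) \<le> 3"
  using seq3_r card_seqf_r unfolding seq3_def by blast

text \<open>The upper bound 9 keeps at least 13 - 9 = 4 vertices outside, so neither side is small
  enough for rank 2.\<close>

lemma r_ge3: "X \<subseteq> V \<Longrightarrow> 4 \<le> card X \<Longrightarrow> card X \<le> 9 \<Longrightarrow> 3 \<le> r X"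
  using card_r_le2[of X] card_compl[of X] card_V by linarith

text \<open>A split has rank 2 in the whole graph, so one side has at most three vertices. With
  exactly three, adding \<open>v\<close> would raise the rank to 3, although that rank is also the
  rank of the opposite side. With two, the word through \<open>v\<close> fills the side.\<close>

lemma not_prime_triple:
  assumes "v \<in> V" "a \<noteq> 0" "\<not> primef (V - {v}) (ra v a)"
  shows "\<exists>t\<in>L. card (supp t) = 3 \<and> t v = a"
proof -
  obtain X where X: "split v a X" using not_prime_split assms by blast
  have *: ?thesis if Z: "split v a Z" and c: "card Z \<le> 3" for Z
  proof -
    have Zs: "Z \<subseteq> V - {v}" "Z \<subseteq> V" "2 \<le> card Z" using Z by (auto simp: split_def)
    have fin: "finite Z" using finite_sub Zs by blast
    have "card Z \<noteq> 3"
    proof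
      assume "card Z = 3"
      then have "3 \<le> r (insert v Z)" using split_rank[OF Z] Zs assms by (intro r_triple_insert) auto
      then show False using r_compl_insert[OF assms(1) Zs(1)] split_rank[OF split_sym[OF Z]] by simp
    qed
    then have "card Z = 2" using Zs c by simp
    obtain e where e: "e \<in> L" "supp e \<subseteq> insert v Z" "e v = a" using split_word[OF Z] by blast
    have "supp e = insert v Z"
      using e assms(2) fin \<open>card Z = 2\<close> Zs by (intro supp_eqI) (auto simp: card_insert_if)
    moreover have "card (insert v Z) = 3" using fin \<open>card Z = 2\<close> Zs by (subst card_insert_disjoint) auto
    ultimately show ?thesis using e(1,3) by metis
  qed
  have sub: "X \<subseteq> V" using X by (auto simp: split_def)
  then have "card X \<le> 3 \<or> card (V - X) \<le> 3" using card_r_le2[OF sub] split_rank(1)[OF X] by simp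
  then consider "card X \<le> 3" | "card (V - X) \<le> 3" by blast
  then show ?thesis
  proof cases
    case 2
    have "card (V - {v} - X) \<le> card (V - X)" using finV by (intro card_mono) auto
    then show ?thesis using * split_sym[OF X] 2 by simp
  qed (use * X in blast)
qed

end

subsection \<open>Quads\<close>

lemma anti_add_iff: "b \<noteq> 0 \<Longrightarrow> anti (a + b) b \<longleftrightarrow> anti a b" for a b :: letter
  by (auto simp: anti_def)

context stuck
begin

text \<open>The words \<open>k\<close> and \<open>e\<close> are independent at each position of
  \<open>Q\<close>. They give \<open>Q\<close> rank at most 2 in the minor for \<open>v\<close> and
  \<open>a\<close>, while \<open>k + e\<close> vanishes nowhere on \<open>Q\<close>.\<close>

definition quad :: "'a \<Rightarrow> letter \<Rightarrow> 'a set \<Rightarrow> 'a word \<Rightarrow> 'a word \<Rightarrow> bool" where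
  "quad v a Q k e \<longleftrightarrow> v \<notin> Q \<and> card Q = 4 \<and> k \<in> L \<and> e \<in> L \<and> supp k = Q \<and> supp e = insert v Q \<and>
    e v = a \<and> (\<forall>x\<in>Q. k x \<noteq> e x)"

lemma add_N: "g \<in> N v a X \<Longrightarrow> h \<in> N v a X \<Longrightarrow> g + h \<in> N v a X"
  by (rule add_subgroupD(4)[OF add_subgroup_N])

text \<open>A minor that is not prime would come with a word of weight three having letter
  \<open>b\<close> at \<open>v\<close>, and such words agree where they meet.\<close>

lemma triple_bad:
  assumes "t \<in> L" "card (supp t) = 3" "t v \<noteq> 0" "b \<noteq> 0" "b \<noteq> t v"
  shows "\<exists>X. bad v b X"
proof -
  have v: "v \<in> V" using supp_L[OF assms(1)] assms(3) by (auto simp: supp_def)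
  have "primef (V - {v}) (ra v b)"
  proof (rule ccontr)
    assume "\<not> ?thesis"
    then obtain u where "u \<in> L" "card (supp u) = 3" "u v = b"
      using not_prime_triple v assms(4) by blast
    then show False using triple_letter[OF assms(1,2), of u v] assms by auto
  qed
  then show ?thesis using prime_bad v assms(4) by blast
qed

text \<open>The hypothesis \<open>onto\<close> holds at minimal obstructions. If no word inside
  \<open>X\<close> anticommuted with \<open>t\<close>, every word anticommuting with
  \<open>t\<close> at some \<open>s\<close> would use letter \<open>a\<close> at \<open>v\<close>
  and differ from \<open>e\<close> by a word inside \<open>X\<close>. So \<open>e\<close> would
  anticommute with \<open>t\<close> at all three positions, an odd number.\<close>

lemma minimal_anti:
  assumes b: "bad v a X" and onto: "\<And>z c. z \<in> X \<Longrightarrow> \<exists>g\<in>N v a X. g z = c"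
    and t: "t \<in> L" "card (supp t) = 3" "supp t \<subseteq> X"
  shows "\<exists>g\<in>L. supp g \<subseteq> X \<and> (\<exists>s. anti (g s) (t s))"
proof (rule ccontr)
  assume c: "\<not> ?thesis"
  then have no: "\<not> anti (g s) (t s)" if "g \<in> L" "supp g \<subseteq> X" for g s using that by blast
  have vX: "v \<notin> X" using b by (auto simp: bad_def)
  obtain e where e: "e \<in> L" "supp e \<subseteq> insert v X" "e v = a" using bad_word[OF b] by blast
  have anti_e: "anti (e s) (t s)" if s: "s \<in> supp t" for s
  proof -
    have ts: "t s \<noteq> 0" using s by (simp add: supp_iff)
    obtain c where c: "c \<noteq> 0" "c \<noteq> t s" using two_other_letters[of "t s"] by blast
    obtain h where h: "h \<in> N v a X" "h s = c" using onto s t(3) by blast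
    then have hL: "h \<in> L" "supp h \<subseteq> insert v X" "h v = 0 \<or> h v = a" by (auto simp: N_def)
    have ah: "anti (h s) (t s)" using h c ts by (simp add: anti_def)
    have "h v \<noteq> 0"
    proof
      assume "h v = 0"
      then have "supp h \<subseteq> X" using hL(2) by (auto simp: supp_def)
      then show False using no hL(1) ah by blast
    qed
    then have "(h + e) v = 0" using hL(3) e(3) by simp
    moreover have "supp (h + e) \<subseteq> insert v X" using supp_add[of h e] hL e by blast
    ultimately have "supp (h + e) \<subseteq> X" by (auto simp: supp_def)
    then have "\<not> anti ((h + e) s) (t s)" using no add_L hL(1) e(1) by blast
    then have "h s = e s \<or> h s + e s = t s" using ts by (auto simp: anti_def)
    then show ?thesis
    proof
      assume "h s + e s = t s"
      then have "e s = h s + t s" by (metis letter_add_left_cancel)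
      then show ?thesis using ah ts by (simp add: anti_add_iff)
    qed (use ah in simp)
  qed
  obtain p where "p \<in> supp t" using t(2) by fastforce
  then obtain q s where qs: "supp t = {p, q, s}" "distinct [p, q, s]" using card_3_elem[OF t(2)] by blast
  then have "anti (e p) (t p) \<longleftrightarrow> anti (e q) (t q) \<noteq> anti (e s) (t s)"
    using e t by (intro symp_three) auto
  then show False using anti_e qs by simp
qed

text \<open>In an obstruction at \<open>z\<close>, the word \<open>t\<close> separates
  \<open>s\<close> from \<open>q\<close>, and \<open>t'\<close> can be gathered on one side. That
  side contains one of \<open>s\<close> and \<open>q\<close>; the word \<open>g'\<close>, with
  letter \<open>0\<close> at \<open>z\<close>, pulls in the other.\<close>

lemma bad_six_contra:
  assumes t: "t \<in> L" "card (supp t) = 3" "t' \<in> L" "card (supp t') = 3" "supp t \<inter> supp t' = {}"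
    and g: "g \<in> L" "supp g \<subseteq> supp t \<union> supp t'" "anti (g s) (t s)"
  shows False
proof -
  obtain q z g' where g': "g' = g \<or> g' = g + t" "supp t = {s, q, z}" "distinct [s, q, z]"
    "g' z = 0" "anti (g' s) (t s)" "anti (g' q) (t q)"
    using anti_pair[OF t(1,2) g(1,3)] by blast
  have gL: "g' \<in> L" using g'(1) g t add_L by auto
  have sg: "supp g' \<subseteq> {s, q} \<union> supp t'"
  proof -
    have "supp g' \<subseteq> supp t \<union> supp t'" using g'(1) g(2) supp_add[of g t] by blast
    moreover have "z \<notin> supp g'" using g'(4) by (simp add: supp_iff)
    ultimately show ?thesis using g'(2) by blast
  qed
  have tz: "t z \<noteq> 0" using g'(2) by (auto simp flip: supp_iff)
  obtain b where b: "b \<noteq> 0" "b \<noteq> t z" using two_other_letters[of "t z"] by blast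
  obtain U where U: "bad z b U" using triple_bad[OF t(1,2) tz] b by blast
  obtain x where "x \<in> supp t'" using t(4) by fastforce
  then obtain y w where R: "supp t' = {x, y, w}" using card_3_elem[OF t(4)] by blast
  have nz: "t' x \<noteq> 0" "t' y \<noteq> 0" "t' w \<noteq> 0" using R by (auto simp flip: supp_iff)
  have zR: "z \<notin> supp t'" using t(5) g'(2) by blast
  have "bad z b (U \<union> {x, y, w}) \<or> bad z b (U - {x, y, w})"
  proof (rule bad_majority[OF U t(3)])
    show "x \<noteq> z" "y \<noteq> z" "w \<noteq> z" "supp t' \<subseteq> {z, x, y, w}" using R zR by auto
    show "t' z = 0 \<or> t' z = b" using zR by (simp add: supp_iff)
  qed (use nz in auto)
  then obtain W where W: "bad z b W" "supp t' \<subseteq> W \<or> supp t' \<inter> W = {}" using R by blast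
  have sep: "s \<in> W \<longleftrightarrow> q \<notin> W" if "bad z b W" for W
    using bad_separates[OF that, of t s q] g' t tz b by auto
  have nz: "g' s \<noteq> 0" "g' q \<noteq> 0" using g' by (auto simp: anti_def)
  have ne: "s \<noteq> z" "q \<noteq> z" using g'(3) by auto
  have ins: False if "supp t' \<subseteq> W" "x' \<in> W" and xy: "{x', y'} = {s, q}" for x' y'
  proof -
    have xy': "x' = s \<and> y' = q \<or> x' = q \<and> y' = s" using xy by (simp add: doubleton_eq_iff)
    have "bad z b (insert y' W)"
    proof (rule bad_insert[OF W(1) gL])
      show "supp g' \<subseteq> insert z (insert y' W)" using sg xy' that(1,2) by blast
      show "g' z = 0 \<or> g' z = b" using g'(4) by simp
    qed (use xy' ne nz in auto)
    then show False using sep xy' that(2) by blast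
  qed
  have rem: False if "supp t' \<inter> W = {}" "y' \<notin> W" and xy: "{x', y'} = {s, q}" for x' y'
  proof -
    have xy': "x' = s \<and> y' = q \<or> x' = q \<and> y' = s" using xy by (simp add: doubleton_eq_iff)
    have "bad z b (W - {x'})"
    proof (rule bad_remove[OF W(1) gL])
      show "supp g' \<inter> W \<subseteq> {x'}" using sg xy' that(1,2) by blast
      show "g' z = 0 \<or> g' z = b" using g'(4) by simp
    qed (use xy' ne nz in auto)
    then show False using sep xy' that(2) by blast
  qed
  show False
    using W(2) ins[of s q] ins[of q s] rem[of s q] rem[of q s] sep[OF W(1)] by blast
qed

text \<open>The letter that \<open>h\<close> has at \<open>s0\<close> would give a sequentially 3-rank-connected minor.\<close>

lemma bad_five_contra:
  assumes t: "t \<in> L" "supp t = {s0, s1, s2}" "distinct [s0, s1, s2, y, z, v]"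
    and g: "g \<in> L" "supp g \<subseteq> {s1, s2, y, z}" "g s1 \<noteq> 0" "g s2 \<noteq> 0"
    and h: "h \<in> L" "supp h \<subseteq> {s0, s1, y, z, v}" "anti (h s0) (t s0)" "g s1 = h s1"
    and yz: "h y \<noteq> 0" "h z \<noteq> 0" "g y \<noteq> h y" "g z \<noteq> h z"
  shows False
proof -
  have c3: "card (supp t) = 3" using t by simp
  obtain U where U: "bad s0 (h s0) U"
    using triple_bad[OF t(1) c3, of s0 "h s0"] h(3) by (auto simp: anti_def)
  have sep: "s1 \<in> W \<longleftrightarrow> s2 \<notin> W" if "bad s0 (h s0) W" for W
    using bad_separates[OF that t(1), of s1 s2] t h(3) by (auto simp: anti_def)
  have g0: "g s0 = 0" using g(2) t(3) by (auto simp: supp_def)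
  have V: "s1 \<in> V" "s0 \<in> V" using supp_L[OF t(1)] t(2) by auto
  obtain W where W: "bad s0 (h s0) W" "s1 \<in> W"
  proof (cases "s1 \<in> U")
    case False
    then have "s1 \<in> V - {s0} - U" using V t(3) by auto
    then show ?thesis using that bad_sym[OF U] by blast
  qed (use that U in blast)
  have s2: "s2 \<notin> W" using sep W by blast
  have both: False if "bad s0 (h s0) Z" "y \<in> Z" "z \<in> Z" "s1 \<in> Z" for Z
  proof -
    have "bad s0 (h s0) (insert s2 Z)"
      using that g g0 t(3) by (intro bad_insert[OF that(1), of g]) auto
    then show False using sep[of "insert s2 Z"] that by auto
  qed
  have none: False if "bad s0 (h s0) Z" "y \<notin> Z" "z \<notin> Z" "s2 \<notin> Z" for Z
  proof -
    have "bad s0 (h s0) (Z - {s1})"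
      using that g g0 t(3) by (intro bad_remove[OF that(1), of g]) auto
    then show False using sep[of "Z - {s1}"] that by auto
  qed
  have sup: "supp (h + g) \<subseteq> {s0, s2, y, z, v}"
  proof -
    have "supp (h + g) \<subseteq> {s0, s1, y, z, v} \<union> {s1, s2, y, z}" using supp_add[of h g] g(2) h(2) by blast
    moreover have "s1 \<notin> supp (h + g)" using h(4) by (simp add: supp_iff)
    ultimately show ?thesis by blast
  qed
  \<comment> \<open>With \<open>y\<close> and \<open>z\<close> on different sides, \<open>h\<close>
    or \<open>h + g\<close> first brings them together, depending on the side of \<open>v\<close>;
    after that \<open>g\<close> alone violates the separation of \<open>s1\<close> and
    \<open>s2\<close>.\<close>
  have mixed: False if x: "x \<in> W" "x' \<notin> W" "{x, x'} = {y, z}" for x x'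
  proof (cases "v \<in> W")
    case True
    have xx: "x = y \<and> x' = z \<or> x = z \<and> x' = y" using x(3) by (simp add: doubleton_eq_iff)
    have "bad s0 (h s0) (insert x' W)"
    proof (rule bad_insert[OF W(1) h(1)])
      show "supp h \<subseteq> insert s0 (insert x' W)" using h(2) xx x(1) W(2) True by blast
    qed (use xx yz t(3) in auto)
    then show False by (rule both) (use xx x(1) W in auto)
  next
    case False
    have xx: "x = y \<and> x' = z \<or> x = z \<and> x' = y" using x(3) by (simp add: doubleton_eq_iff)
    have "bad s0 (h s0) (W - {x})"
    proof (rule bad_remove[OF W(1), of "h + g"])
      have "s0 \<notin> W" using W(1) by (auto simp: bad_def)
      then show "supp (h + g) \<inter> W \<subseteq> {x}" using sup False s2 xx x(2) by blast
      show "x \<noteq> s0" using xx t(3) by auto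
      show "(h + g) x \<noteq> 0" using xx yz by auto
      show "h + g \<in> L" using add_L g(1) h(1) by blast
    qed (use g0 in simp)
    then show False by (rule none) (use xx x(2) s2 in auto)
  qed
  show False using both[OF W(1)] none[OF W(1)] mixed[of y z] mixed[of z y] W(2) s2 by blast
qed

lemma ra_two_words:
  assumes "t \<in> N v a X" "h \<in> N v a X" "t \<noteq> 0" "h \<noteq> 0" "h \<noteq> t"
  shows "ra v a X \<le> card X - 2"
proof -
  have z: "add_subgroup {0 :: 'a word}" "add_subgroup {0, t}" by (auto simp: add_subgroup_def)
  have "{0} \<subset> {0, t}" "{0, t} \<subset> N v a X" using assms by (auto simp: N_def)
  then have "dim2 {0 :: 'a word} < dim2 {0, t}" "dim2 {0, t} < dim2 (N v a X)"
    using z by (auto intro: dim2_less)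
  then show ?thesis by (simp add: ra_def)
qed

text \<open>One word \<open>g\<close> avoids \<open>v\<close> and anticommutes with \<open>t\<close>
  away from \<open>s0\<close>; another word \<open>h\<close> anticommutes with \<open>t\<close> at
  \<open>s0\<close>. Minimality makes them independent on the two vertices outside \<open>t\<close>,
  which puts them in the position of \<open>bad_five_contra\<close>.\<close>

lemma bad_minimal_five_contra:
  assumes b: "bad v a X" and min: "\<And>z. z \<in> X \<Longrightarrow> 3 \<le> ra v a (X - {z})"
    and onto: "\<And>z c. z \<in> X \<Longrightarrow> \<exists>g\<in>N v a X. g z = c"
    and t: "t \<in> L" "card (supp t) = 3" "supp t \<subseteq> X" and c: "card X = 5"
  shows False
proof -
  have X: "v \<notin> X" "finite X" "a \<noteq> 0" using b finite_sub[of X] by (auto simp: bad_def)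
  obtain g0 s where g0: "g0 \<in> L" "supp g0 \<subseteq> X" "anti (g0 s) (t s)"
    using minimal_anti[OF b onto t] by blast
  obtain q s0 g where g: "g = g0 \<or> g = g0 + t" "supp t = {s, q, s0}" "distinct [s, q, s0]"
    "g s0 = 0" "anti (g s) (t s)" "anti (g q) (t q)"
    using anti_pair[OF t(1,2) g0(1,3)] by blast
  have gL: "g \<in> L" "supp g \<subseteq> X" using g(1) g0 t supp_add[of g0 t] add_L by auto
  have ts0: "t s0 \<noteq> 0" using g(2) by (auto simp flip: supp_iff)
  then have t0: "t \<noteq> 0" by auto
  have tN: "t \<in> N v a X" using t X by (auto simp: N_def supp_def)
  have gN: "g \<in> N v a X" using gL X by (auto simp: N_def supp_def)
  obtain c' where c': "c' \<noteq> 0" "c' \<noteq> t s0" using two_other_letters[of "t s0"] by blast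
  have "s0 \<in> X" using g(2) t(3) by auto
  then obtain h0 where h0: "h0 \<in> N v a X" "h0 s0 = c'" using onto by blast
  then have h0a: "anti (h0 s0) (t s0)" "h0 \<in> L" using ts0 c' by (auto simp: anti_def N_def)
  obtain s1 s2 h where h: "h = h0 \<or> h = h0 + t" "supp t = {s0, s1, s2}" "distinct [s0, s1, s2]"
    "h s2 = 0" "anti (h s0) (t s0)" "anti (h s1) (t s1)"
    using anti_pair[OF t(1,2) h0a(2,1)] by blast
  have hN: "h \<in> N v a X" using h(1) h0(1) tN add_N by blast
  have s12: "{s1, s2} = {s, q}" using g(2,3) h(2,3) by auto
  then have ga: "anti (g s1) (t s1)" "anti (g s2) (t s2)" using g(5,6) by (auto simp: doubleton_eq_iff)
  have "card (X - supp t) = 2" using c t(2,3) X by (subst card_Diff_subset) (auto intro: finite_subset)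
  then obtain y z where yz: "X - supp t = {y, z}" "y \<noteq> z" by (meson card_2_iff)
  \<comment> \<open>Rank at least 3 on the four vertices other than \<open>x\<close> leaves room for
    only one nonzero word, namely \<open>t\<close>. But \<open>g\<close>, \<open>h\<close> and
    \<open>g + h\<close> all anticommute with \<open>t\<close> somewhere.\<close>
  have key: "g x \<noteq> 0 \<and> h x \<noteq> 0 \<and> g x \<noteq> h x" if x: "x \<in> X - supp t" for x
  proof -
    have tx: "t x = 0" using x by (simp add: supp_iff)
    have "f = 0 \<or> f = t" if f: "f \<in> N v a X" "f x = 0" for f
    proof (rule ccontr)
      assume "\<not> ?thesis"
      moreover have "f \<in> N v a (X - {x})" "t \<in> N v a (X - {x})" using f tN tx by (auto simp: N_def supp_def)
      ultimately have "ra v a (X - {x}) \<le> card (X - {x}) - 2"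
        using ra_two_words[of t v a "X - {x}" f] t0 by auto
      then show False using min[of x] x c X by simp
    qed
    then have *: "f x \<noteq> 0" if "f \<in> N v a X" "anti (f p) (t p)" for f p
      using that by (force simp: anti_def)
    have "g + h \<in> N v a X" using gN hN add_N by blast
    moreover have "anti ((g + h) s0) (t s0)" using h(5) g(4) by simp
    ultimately have "(g + h) x \<noteq> 0" using * by blast
    then show ?thesis using *[OF gN] *[OF hN] g(5) h(5) by auto
  qed
  have y: "y \<in> X" "y \<notin> supp t" "z \<in> X" "z \<notin> supp t" using yz(1) by blast+
  note ky = key[of y] and kz = key[of z]
  have hL: "h \<in> L" "supp h \<subseteq> insert v X" using hN by (auto simp: N_def)
  have Xe: "X = {s0, s1, s2, y, z}" using yz(1) h(2) t(3) by auto
  have hv: "supp h \<subseteq> {s0, s1, y, z, v}"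
  proof -
    have "s2 \<notin> supp h" using h(4) by (simp add: supp_iff)
    then show ?thesis using hL(2) unfolding Xe by blast
  qed
  have gs: "supp g \<subseteq> {s1, s2, y, z}"
  proof -
    have "s0 \<notin> supp g" using g(4) by (simp add: supp_iff)
    then show ?thesis using gL(2) unfolding Xe by blast
  qed
  have "s1 \<in> X" "s2 \<in> X" "s0 \<in> X" using Xe by auto
  then have d: "distinct [s0, s1, s2, y, z, v]" using h(2,3) y yz(2) X(1) by auto
  \<comment> \<open>The words anticommute at both \<open>y\<close> and \<open>z\<close>, so parity
    makes them commute, hence agree, at \<open>s1\<close>.\<close>
  have "anti (g s1) (h s1) \<longleftrightarrow> anti (g y) (h y) \<noteq> anti (g z) (h z)"
    using d gs hv gL hL by (intro symp_three) auto
  then have "\<not> anti (g s1) (h s1)" using ky kz y by (auto simp: anti_def)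
  then have "g s1 = h s1" using ga h(6) by (auto simp: anti_def)
  then show False
    using bad_five_contra[OF t(1) h(2) d gL(1) gs _ _ hL(1) hv h(5)] ga ky kz y
    by (auto simp: anti_def)
qed

text \<open>By minimality no three vertices of \<open>X\<close> carry a nonzero word of the minor,
  so each such word is nonzero on all of \<open>X\<close>. Applied to \<open>k\<close>,
  \<open>e\<close> and \<open>k + e\<close> this is the quad.\<close>

lemma bad_minimal_four:
  assumes b: "bad v a X" and min: "\<And>z. z \<in> X \<Longrightarrow> 3 \<le> ra v a (X - {z})" and c: "card X = 4"
  shows "\<exists>k e. quad v a X k e"
proof -
  have X: "v \<notin> X" "finite X" "a \<noteq> 0" using b finite_sub[of X] by (auto simp: bad_def)
  have full: "g x \<noteq> 0" if "g \<in> L" "supp g \<subseteq> insert v X" "g v = 0 \<or> g v = a" "g \<noteq> 0" "x \<in> X" for g x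
  proof
    assume "g x = 0"
    then have "supp g \<subseteq> insert v (X - {x})" using that(2) by (auto simp: supp_def)
    then have "ra v a (X - {x}) \<le> card (X - {x}) - 1" using ra_supp_less that by blast
    then show False using min[OF that(5)] c X that(5) by simp
  qed
  obtain e where e: "e \<in> L" "supp e \<subseteq> insert v X" "e v = a" using bad_word[OF b] by blast
  have "r X < card X" using bad_rank[OF b] c by simp
  then obtain k where k: "k \<in> L" "k \<noteq> 0" "supp k \<subseteq> X" using r_less_card[of X] by blast
  have kv: "k v = 0" using k(3) X by (auto simp: supp_def)
  have kx: "k x \<noteq> 0" if "x \<in> X" for x using full[of k x] k kv that by auto
  have ex: "e x \<noteq> 0" if "x \<in> X" for x using full[of e x] e X that by fastforce
  have kex: "k x \<noteq> e x" if "x \<in> X" for x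
  proof -
    have "(k + e) v \<noteq> 0" using kv e X by simp
    then have "k + e \<noteq> 0" by (metis zero_fun_apply)
    then have "(k + e) x \<noteq> 0"
      using full[of "k + e" x] k e kv that supp_add[of k e] add_L by auto
    then show ?thesis by simp
  qed
  have "supp k = X" "supp e = insert v X" using k(3) e kx ex X by (auto simp: supp_iff)
  then show ?thesis using X c k e kex unfolding quad_def by blast
qed

lemma r_le2_triple:
  assumes "A \<subseteq> V" "card A = 3" "r A \<le> 2"
  shows "\<exists>t\<in>L. supp t = A"
proof -
  obtain t where t: "t \<in> L" "t \<noteq> 0" "supp t \<subseteq> A" using r_less_card[of A] assms by auto
  then show ?thesis using supp_eqI[of t A] assms finite_sub by auto
qed

text \<open>Shrinking \<open>X\<close> keeps it covered, so it may be taken minimal, and then it has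
  4, 5 or 6 vertices. Five vertices must include all of \<open>A\<close> or of \<open>B\<close>, six
  both; these are supports of words of weight three, and only size four survives.\<close>

lemma bad_quad:
  assumes "bad v a X" "X \<subseteq> A \<union> B" and AB: "A \<subseteq> V" "B \<subseteq> V" "card A \<le> 3" "card B \<le> 3" "r A \<le> 2" "r B \<le> 2"
  shows "\<exists>Q k e. quad v a Q k e"
  using assms(1,2)
proof (induction "card X" arbitrary: X rule: less_induct)
  case less
  note b = less.prems(1)
  have X: "v \<notin> X" "finite X" "a \<noteq> 0" "X \<subseteq> V" using b finite_sub[of X] by (auto simp: bad_def)
  have fin: "finite A" "finite B" using AB finite_sub by auto
  show ?case
  proof (cases "\<exists>z\<in>X. ra v a (X - {z}) \<le> 2")
    case True
    then obtain z where z: "z \<in> X" "ra v a (X - {z}) \<le> 2" by blast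
    then have "bad v a (X - {z})" using bad_remove_rank b by blast
    moreover have "card (X - {z}) < card X" using z X by (meson card_Diff1_less)
    ultimately show ?thesis using less.hyps less.prems(2) by (metis Diff_subset order_trans)
  next
    case False
    then have min: "3 \<le> ra v a (X - {z})" if "z \<in> X" for z using that by force
    have onto: "\<exists>g\<in>N v a X. g z = c" if z: "z \<in> X" for z c
    proof -
      have "insert z (X - {z}) = X" using z by blast
      then show ?thesis
        using ra_insert_onto[of z "X - {z}" v a c] z X min[OF z] bad_rank(2)[OF b] by auto
    qed
    have "card X = card ((X \<inter> A) \<union> (X - A))" by (simp add: Int_Diff_Un)
    then have cX: "card X = card (X \<inter> A) + card (X - A)"
      using X by (subst (asm) card_Un_disjoint) auto
    have cA: "card (X \<inter> A) \<le> card A" using fin by (intro card_mono) auto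
    have "X - A \<subseteq> B" using less.prems by blast
    then have cB: "card (X - A) \<le> card B" using fin by (intro card_mono) auto
    have full: "S \<subseteq> X" if "card (X \<inter> S) = card S" "finite S" for S
      using that by (metis card_subset_eq inf_le1 inf_le2)
    have "card X = 4 \<or> card X = 5 \<or> card X = 6" using cX cA cB AB bad_card[OF b] by linarith
    then consider "card X = 4" | "card X = 5" | "card X = 6" by blast
    then show ?thesis
    proof cases
      case 1
      then show ?thesis using bad_minimal_four[OF b min] by blast
    next
      case 2
      have "\<exists>S. S \<subseteq> X \<and> S \<subseteq> V \<and> card S = 3 \<and> r S \<le> 2"
      proof (cases "card (X \<inter> A) = 3")
        case True
        then have "card A = 3" using cA AB by linarith
        then show ?thesis using full[of A] True fin AB by auto
      next
        case False
        then have c: "card (X - A) = 3" using 2 cX cA cB AB by linarith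
        then have "card B = 3" using cB AB by linarith
        then have "X - A = B" using c \<open>X - A \<subseteq> B\<close> fin by (intro card_subset_eq) auto
        then show ?thesis using \<open>card B = 3\<close> AB by blast
      qed
      then obtain t where "t \<in> L" "card (supp t) = 3" "supp t \<subseteq> X" using r_le2_triple by metis
      then have False using bad_minimal_five_contra[OF b min onto] 2 by blast
      then show ?thesis ..
    next
      case 3
      then have c: "card (X \<inter> A) = 3" "card (X - A) = 3" "card A = 3" "card B = 3"
        using cX cA cB AB by linarith+
      have "A \<subseteq> X" using full[of A] c fin by simp
      have "X - A = B" using c \<open>X - A \<subseteq> B\<close> fin by (intro card_subset_eq) auto
      obtain t where t: "t \<in> L" "supp t = A" using r_le2_triple[of A] c AB by blast
      obtain t' where t': "t' \<in> L" "supp t' = B" using r_le2_triple[of B] c AB by blast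
      obtain g s where "g \<in> L" "supp g \<subseteq> X" "anti (g s) (t s)"
        using minimal_anti[OF b onto t(1)] t c \<open>A \<subseteq> X\<close> by blast
      moreover have "supp t \<inter> supp t' = {}" "X = supp t \<union> supp t'" "card (supp t) = 3" "card (supp t') = 3"
        using t t' c \<open>A \<subseteq> X\<close> \<open>X - A = B\<close> by auto
      ultimately have False using bad_six_contra[of t t' g s] t(1) t'(1) by simp
      then show ?thesis ..
    qed
  qed
qed

text \<open>The crossing inequality bounds the sum of two opposite corner ranks by 2 + 2 + 1, so one
  corner has rank at most 2 and at most three vertices. Doing this also with \<open>Y\<close>
  replaced by its complement leaves some side covered by two such corners.\<close>

lemma two_letters_quad:
  assumes v: "v \<in> V" and ab: "a \<noteq> 0" "b \<noteq> 0" "a \<noteq> b"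
    and p: "primef (V - {v}) (ra v a)" "primef (V - {v}) (ra v b)"
  shows "\<exists>c Q k e. (c = a \<or> c = b) \<and> quad v c Q k e"
proof -
  obtain X where X: "bad v a X" using prime_bad v ab p by blast
  obtain Y where Y: "bad v b Y" using prime_bad v ab p by blast
  define small where "small Z \<longleftrightarrow> Z \<subseteq> V \<and> card Z \<le> 3 \<and> r Z \<le> 2" for Z
  have *: "small (P \<inter> Q) \<or> small ((V - {v} - P) \<inter> (V - {v} - Q))"
    if P: "bad v a P" and Q: "bad v b Q" for P Q
  proof -
    have sub: "P \<subseteq> V - {v}" "Q \<subseteq> V - {v}" using P Q by (auto simp: bad_def)
    have sm: "small (P' \<inter> Z)" if "r (P' \<inter> Z) \<le> 2" "bad v a P'" for P' Z
    proof -
      have P'V: "P' \<subseteq> V" using that by (auto simp: bad_def)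
      have "4 \<le> card (V - {v} - P')" using bad_card[OF bad_sym[OF that(2)]] .
      also have "\<dots> \<le> card (V - (P' \<inter> Z))" using finV by (intro card_mono) auto
      finally show ?thesis using card_r_le2[of "P' \<inter> Z"] that P'V unfolding small_def by fastforce
    qed
    have eq: "(V - {v} - P) \<inter> (V - {v} - Q) = V - insert v (P \<union> Q)" by blast
    have "r ((V - {v} - P) \<inter> (V - {v} - Q)) = r (insert v (P \<union> Q))"
      unfolding eq using sub v by (intro r_sym) auto
    then have "r (P \<inter> Q) \<le> 2 \<or> r ((V - {v} - P) \<inter> (V - {v} - Q)) \<le> 2"
      using crossing[OF sub v ab(3)] bad_rank[OF P] bad_rank[OF Q] by linarith
    then show ?thesis using sm[OF _ P] sm[OF _ bad_sym[OF P]] by blast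
  qed
  have q: "\<exists>Q k e. quad v c Q k e" if "bad v c Z" "small (Z \<inter> Q)" "small (Z \<inter> (V - {v} - Q))" for c Z Q
  proof -
    have "Z \<subseteq> (Z \<inter> Q) \<union> (Z \<inter> (V - {v} - Q))" using that(1) by (auto simp: bad_def)
    then show ?thesis using bad_quad[OF that(1)] that(2,3) unfolding small_def by blast
  qed
  let ?X = "V - {v} - X" and ?Y = "V - {v} - Y"
  have cc: "V - {v} - ?Y = Y" using Y by (auto simp: bad_def)
  note 1 = *[OF X Y] and 2 = *[OF X bad_sym[OF Y], unfolded cc]
  have ic: "?X \<inter> Y = Y \<inter> ?X" "X \<inter> Y = Y \<inter> X" "X \<inter> ?Y = ?Y \<inter> X" "?X \<inter> ?Y = ?Y \<inter> ?X" by blast+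
  consider "small (X \<inter> Y)" "small (X \<inter> ?Y)" | "small (X \<inter> Y)" "small (?X \<inter> Y)"
    | "small (?X \<inter> ?Y)" "small (X \<inter> ?Y)" | "small (?X \<inter> ?Y)" "small (?X \<inter> Y)"
    using 1 2 by blast
  then show ?thesis
  proof cases
    case 1
    then show ?thesis using q[OF X] by blast
  next
    case 2
    then show ?thesis using q[OF Y, of X] ic by metis
  next
    case 3
    then show ?thesis using q[OF bad_sym[OF Y], of X] ic by metis
  next
    case 4
    then show ?thesis using q[OF bad_sym[OF X], of Y] by blast
  qed
qed

end

subsection \<open>Interactions of quads\<close>

text \<open>Both pairs are bases of GF(2) x GF(2), so their Gram matrix under the nondegenerate
  symplectic form has determinant 1.\<close>

lemma letter_gram:
  fixes k e k' e' :: letter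
  assumes "k \<noteq> 0" "e \<noteq> 0" "k \<noteq> e" "k' \<noteq> 0" "e' \<noteq> 0" "k' \<noteq> e'"
  shows "(anti k k' \<and> anti e e') \<noteq> (anti k e' \<and> anti e k')"
  using letter_third[of k e k'] letter_third[of k e e'] assms unfolding anti_def by metis

lemma card_2_elems:
  assumes "card S = 2"
  shows "\<exists>x y. S = {x, y} \<and> x \<noteq> y"
  using assms card_2_iff by blast

context stuck
begin

lemma r_two_words:
  assumes "t \<in> L" "h \<in> L" "supp t \<subseteq> X" "supp h \<subseteq> X" "t \<noteq> 0" "h \<noteq> 0" "h \<noteq> t"
  shows "r X \<le> card X - 2"
proof -
  have z: "add_subgroup {0 :: 'a word}" "add_subgroup {0, t}" by (auto simp: add_subgroup_def)
  have "{0} \<subset> {0, t}" "{0, t} \<subset> LX X" using assms by (auto simp: LX_def)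
  then have "dim2 {0 :: 'a word} < dim2 {0, t}" "dim2 {0, t} < dim2 (LX X)"
    using dim2_less[OF z] dim2_less[OF z(2) add_subgroup_LX] by blast+
  then show ?thesis by (simp add: r_def)
qed

lemma quadD:
  assumes "quad v a Q k e"
  shows "v \<notin> Q" "card Q = 4" "finite Q" "k \<in> L" "e \<in> L" "supp k = Q" "supp e = insert v Q" "e v = a"
    "k v = 0" "a \<noteq> 0" "\<And>x. x \<in> Q \<Longrightarrow> k x \<noteq> 0" "\<And>x. x \<in> Q \<Longrightarrow> e x \<noteq> 0" "\<And>x. x \<in> Q \<Longrightarrow> k x \<noteq> e x"
    "insert v Q \<subseteq> V"
proof -
  note q = assms[unfolded quad_def]
  show "v \<notin> Q" "card Q = 4" "k \<in> L" "e \<in> L" "supp k = Q" "supp e = insert v Q" "e v = a"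
    "\<And>x. x \<in> Q \<Longrightarrow> k x \<noteq> e x" using q by blast+
  show "finite Q" using q card.infinite by fastforce
  have "v \<notin> supp k" "v \<in> supp e" using q by auto
  then show "k v = 0" "a \<noteq> 0" using q by (auto simp: supp_iff)
  show "k x \<noteq> 0" if "x \<in> Q" for x
    using that q by (metis supp_iff)
  show "e x \<noteq> 0" if "x \<in> Q" for x
    using that q by (metis supp_iff insertI2)
  show "insert v Q \<subseteq> V" using supp_L[of e] q by simp
qed

text \<open>As \<open>k\<close> vanishes at \<open>v\<close>, adding it keeps the letter there but
  changes \<open>e\<close> on all of \<open>Q\<close>. This freedom normalizes pairs of quads
  below.\<close>

lemma quad_add:
  assumes q: "quad v a Q k e"
  shows "quad v a Q k (e + k)"
proof -
  note d = quadD[OF q]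
  have "supp (e + k) = insert v Q"
  proof
    show "supp (e + k) \<subseteq> insert v Q" using supp_add[of e k] d(6,7) by blast
    show "insert v Q \<subseteq> supp (e + k)"
    proof
      fix x assume "x \<in> insert v Q"
      then show "x \<in> supp (e + k)" using d(8-10) d(13)[of x] by (auto simp: supp_iff)
    qed
  qed
  then show ?thesis using d add_L by (simp add: quad_def)
qed

text \<open>Take an obstruction for \<open>p\<close> and the letter \<open>k p\<close>. Up to
  complement \<open>k\<close> gathers \<open>q\<close>, \<open>x\<close>, \<open>y\<close> inside,
  and then \<open>e\<close>, whose letter at \<open>p\<close> is inadmissible, keeps
  \<open>v\<close> outside. Next \<open>k'\<close> gathers \<open>q\<close>, \<open>x'\<close>,
  \<open>y'\<close>: if inside, \<open>e + e'\<close> vanishes at \<open>p\<close> and draws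
  \<open>v\<close> in; if outside, all of \<open>e'\<close> apart from \<open>p\<close> is outside,
  with an inadmissible letter.\<close>

lemma two_quads_aligned_contra:
  assumes q: "quad v a {p, q, x, y} k e" "quad v b {p, q, x', y'} k' e'" and ab: "a \<noteq> b"
    and dist: "distinct [p, q, x, y]" "distinct [p, q, x', y']" "{x, y} \<inter> {x', y'} = {}"
    and eq: "k p = k' p" "k q = k' q" "e p = e' p" "e q \<noteq> e' q"
    and no_triple: "\<And>t. t \<in> L \<Longrightarrow> card (supp t) \<noteq> 3"
  shows False
proof -
  note d = quadD[OF q(1)] and d' = quadD[OF q(2)]
  have pV: "p \<in> V" using d(14) by blast
  have kp: "k p \<noteq> 0" using d(11)[of p] by simp
  have "primef (V - {p}) (ra p (k p))"
    using not_prime_triple[OF pV kp] no_triple by blast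
  then obtain U0 where U0: "bad p (k p) U0" using prime_bad pV kp by blast
  have ne: "p \<noteq> v" "q \<noteq> v" "x \<noteq> v" "y \<noteq> v" "x' \<noteq> v" "y' \<noteq> v" using d(1) d'(1) by auto
  have nz: "k q \<noteq> 0" "k x \<noteq> 0" "k y \<noteq> 0" "k' q \<noteq> 0" "k' x' \<noteq> 0" "k' y' \<noteq> 0"
    "e p \<noteq> 0" "e p \<noteq> k p" "e' p \<noteq> 0" "e' p \<noteq> k p"
    using d(11-13) d'(11-13) eq by (metis insertCI)+
  have "bad p (k p) (U0 \<union> {q, x, y}) \<or> bad p (k p) (U0 - {q, x, y})"
    by (rule bad_majority[OF U0 d(4)]) (use d(6) dist(1) nz(1-3) in auto)
  then obtain U where U: "bad p (k p) U" "{q, x, y} \<subseteq> U"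
  proof
    assume b: "bad p (k p) (U0 - {q, x, y})"
    have "{q, x, y} \<subseteq> V - {p} - (U0 - {q, x, y})" using d(14) dist by auto
    then show ?thesis using that bad_sym[OF b] by blast
  qed (use that in blast)
  have e_in: False if "bad p (k p) W" "{q, x, y, v} \<subseteq> W" for W
    using bad_letter_in[OF that(1) d(5)] that(2) d(7) nz by auto
  have vU: "v \<notin> U" using e_in U by blast
  have "bad p (k p) (U \<union> {q, x', y'}) \<or> bad p (k p) (U - {q, x', y'})"
    by (rule bad_majority[OF U(1) d'(4)]) (use d'(6) dist(2) nz(4-6) eq(1) in auto)
  then show False
  proof
    assume b: "bad p (k p) (U \<union> {q, x', y'})"
    let ?f = "e + e'"
    have "bad p (k p) (insert v (U \<union> {q, x', y'}))"
    proof (rule bad_insert[OF b])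
      show "?f \<in> L" by (rule add_L[OF d(5) d'(5)])
      have "supp ?f \<subseteq> insert v {p, q, x, y} \<union> insert v {p, q, x', y'}"
        using supp_add[of e e'] d(7) d'(7) by blast
      then show "supp ?f \<subseteq> insert p (insert v (U \<union> {q, x', y'}))" using U(2) by blast
      show "?f p = 0 \<or> ?f p = k p" using eq by simp
      show "?f v \<noteq> 0" using d(8) d'(8) ab by simp
    qed (use ne in simp)
    then show False by (rule e_in) (use U in auto)
  next
    assume b: "bad p (k p) (U - {q, x', y'})"
    have "p \<notin> U" using U(1) by (auto simp: bad_def)
    then have "supp e' \<inter> (U - {q, x', y'}) = {}" using d'(7) vU by auto
    then show False using bad_letter_out[OF b d'(5)] nz(9,10) by simp
  qed
qed

text \<open>The size of \<open>Q \<inter> Q'\<close> decides: isotropy refutes 0 and 1, rank refutes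
  3 and 4, and size 2 reduces to aligned quads.\<close>

lemma two_quads_contra:
  assumes q: "quad v a Q k e" "quad v b Q' k' e'" and ab: "a \<noteq> b"
    and no_triple: "\<And>t. t \<in> L \<Longrightarrow> card (supp t) \<noteq> 3"
  shows False
proof -
  note d = quadD[OF q(1)] and d' = quadD[OF q(2)]
  have vab: "anti (e v) (e' v)" using ab d(8,10) d'(8,10) by (simp add: anti_def)
  have supI: "supp k \<inter> supp k' \<subseteq> Q \<inter> Q'" "supp k \<inter> supp e' \<subseteq> Q \<inter> Q'" "supp e \<inter> supp k' \<subseteq> Q \<inter> Q'"
    "supp e \<inter> supp e' \<subseteq> insert v (Q \<inter> Q')"
    unfolding d(6) d(7) d'(6) d'(7) using d(1) d'(1) by blast+
  have not_anti: "g x = h x" if "\<not> anti (g x) (h x)" "g x \<noteq> 0" "h x \<noteq> 0" for g h :: "'a word" and x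
    using that by (auto simp: anti_def)
  have rQ: "r Q \<le> 3"
  proof -
    have "k \<noteq> 0" using d(2,6) by auto
    then show ?thesis using r_supp_less[OF d(4), of Q] d(2,6) by simp
  qed
  have "card (Q \<inter> Q') \<le> card Q" using d(3) by (intro card_mono) auto
  then consider "card (Q \<inter> Q') = 0" | "card (Q \<inter> Q') = 1" | "card (Q \<inter> Q') = 2"
    | "card (Q \<inter> Q') = 3" | "card (Q \<inter> Q') = 4"
    using d(2) by linarith
  then show False
  proof cases
    case 1
    then have "Q \<inter> Q' = {}" using d(3) by simp
    then show False using symp_one[OF d(5) d'(5), of v] supI(4) vab by auto
  next
    case 2
    then obtain p where p: "Q \<inter> Q' = {p}" by (metis card_1_singletonE)
    then have "\<not> anti (k p) (k' p)" "\<not> anti (k p) (e' p)"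
      using symp_one[OF d(4) d'(4), of p] symp_one[OF d(4) d'(5), of p] supI by auto
    moreover have "p \<in> Q" "p \<in> Q'" using p by auto
    ultimately have "k p = k' p" "k p = e' p"
      using d(11)[of p] d'(11,12)[of p] not_anti[of k p k'] not_anti[of k p e'] by simp_all
    then show False using d'(13)[of p] \<open>p \<in> Q'\<close> by simp
  next
    case 3
    then obtain p q where pq: "Q \<inter> Q' = {p, q}" "p \<noteq> q" using card_2_elems by blast
    have "card (Q - Q \<inter> Q') = 2" using d(2,3) 3 by (subst card_Diff_subset) auto
    then obtain x y where xy: "Q - Q \<inter> Q' = {x, y}" "x \<noteq> y" using card_2_elems by blast
    have "card (Q' - Q \<inter> Q') = 2" using d'(2,3) 3 by (subst card_Diff_subset) auto
    then obtain x' y' where xy': "Q' - Q \<inter> Q' = {x', y'}" "x' \<noteq> y'" using card_2_elems by blast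
    have Q: "Q = {p, q, x, y}" "Q' = {p, q, x', y'}" using pq xy xy' by blast+
    have dist: "distinct [p, q, x, y]" "distinct [p, q, x', y']" "{x, y} \<inter> {x', y'} = {}"
      using pq xy xy' by auto
    have pQ: "p \<in> Q" "p \<in> Q'" "q \<in> Q" "q \<in> Q'" using Q by auto
    note s = supI[unfolded pq(1)]
    note c1 = symp_two[OF d(4) d'(4) s(1) pq(2)] and c2 = symp_two[OF d(4) d'(5) s(2) pq(2)]
      and c3 = symp_two[OF d(5) d'(4) s(3) pq(2)]
    have "distinct [v, p, q]" using d(1) pQ pq by auto
    note c4 = symp_three[OF d(5) d'(5) s(4) this]
    have gp: "(anti (k p) (k' p) \<and> anti (e p) (e' p)) \<noteq> (anti (k p) (e' p) \<and> anti (e p) (k' p))"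
      using d(11-13) d'(11-13) pQ by (intro letter_gram) auto
    have gq: "(anti (k q) (k' q) \<and> anti (e q) (e' q)) \<noteq> (anti (k q) (e' q) \<and> anti (e q) (k' q))"
      using d(11-13) d'(11-13) pQ by (intro letter_gram) auto
    \<comment> \<open>Three of the four relations agree at \<open>p\<close> and \<open>q\<close>,
      while that of \<open>e\<close> and \<open>e'\<close> differs because these anticommute at
      \<open>v\<close>. Both determinants are 1, so the cofactor of the differing entry
      vanishes.\<close>
    have "\<not> anti (k p) (k' p)" "\<not> anti (k q) (k' q)" using c1 c2 c3 c4 gp gq vab by blast+
    then have kk: "k p = k' p" "k q = k' q"
      using d(11) d'(11) not_anti[of k p k'] not_anti[of k q k'] pQ by simp_all
    have ep: "e p \<noteq> 0" "e p \<noteq> k p" "e' p \<noteq> 0" "e' p \<noteq> k p" "k p \<noteq> 0"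
      "e q \<noteq> 0" "e q \<noteq> k q" "e' q \<noteq> 0" "e' q \<noteq> k q" "k q \<noteq> 0"
      using d(11-13) d'(11-13) pQ kk by (metis+)
    have ne: "(e p = e' p) \<longleftrightarrow> e q \<noteq> e' q" using c4 vab ep by (auto simp: anti_def)
    show False
    proof (cases "e p = e' p")
      case True
      show False
        by (rule two_quads_aligned_contra[OF q(1)[unfolded Q] q(2)[unfolded Q] ab dist kk True _ no_triple])
          (use True ne in auto)
    next
      case False
      \<comment> \<open>Replacing \<open>e'\<close> by \<open>e' + k'\<close> exchanges the position
        of agreement, so \<open>p\<close> is again the one.\<close>
      then have 1: "e p = (e' + k') p" using letter_third[of "e' p" "k p" "e p"] ep kk by simp
      have "e q = e' q" using False ne by simp
      then have 2: "e q \<noteq> (e' + k') q" using ep kk by simp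
      show False
        by (rule two_quads_aligned_contra[OF q(1)[unfolded Q] quad_add[OF q(2)[unfolded Q]] ab dist kk 1 2 no_triple])
    qed
  next
    case 4
    have "card (Q' - Q \<inter> Q') = 1" using d'(2,3) 4 by (subst card_Diff_subset) auto
    then obtain z where "Q' - Q \<inter> Q' = {z}" by (metis card_1_singletonE)
    then have z: "z \<in> Q'" "z \<notin> Q" "Q' \<subseteq> insert z Q" by blast+
    have zv: "z \<noteq> v" using z d'(1) by blast
    \<comment> \<open>From rank 3 on \<open>Q\<close>, the word \<open>e\<close> adds
      \<open>v\<close> for free and the second quad adds \<open>z\<close> with a drop, giving rank 2
      on six vertices.\<close>
    have "r (insert v Q) \<le> r Q"
      using r_insert_le[OF d(3) d(5), of v] d(7,8,10) by simp
    moreover have "r (insert z (insert v Q)) \<le> r (insert v Q) - 1"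
      using d'(11-13)[OF z(1)] z zv d(3) d'(4-7)
      by (intro r_insert_le2[of _ _ k' e']) auto
    moreover have "3 \<le> r (insert z (insert v Q))"
      using d(1,2,3,14) d'(14) z zv by (intro r_ge3) auto
    ultimately show False using rQ by linarith
  next
    case 5
    have "Q \<inter> Q' = Q" by (rule card_subset_eq[OF d(3)]) (use 5 d(2) in auto)
    moreover have "Q \<inter> Q' = Q'" by (rule card_subset_eq[OF d'(3)]) (use 5 d'(2) in auto)
    ultimately have QQ: "Q' = Q" by blast
    have "r (insert v Q) \<le> r Q - 1"
      using d(1,3,5,7,8,10) d'(5,7,8,10) ab QQ by (intro r_insert_le2[of _ _ e e']) auto
    moreover have "3 \<le> r (insert v Q)"
      using d(1,2,3,14) by (intro r_ge3) auto
    ultimately show False using rQ by linarith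
  qed
qed

text \<open>Without such words every minor is prime. One quad uses some letter \<open>c\<close>; the
  two remaining nonzero letters then provide a quad with a letter different from
  \<open>c\<close>.\<close>

lemma exists_triple: "\<exists>t\<in>L. card (supp t) = 3"
proof (rule ccontr)
  assume "\<not> ?thesis"
  then have no: "t \<in> L \<Longrightarrow> card (supp t) \<noteq> 3" for t by blast
  have "V \<noteq> {}" using card_V by auto
  then obtain v where v: "v \<in> V" by blast
  have p: "primef (V - {v}) (ra v a)" if "a \<noteq> 0" for a
    using not_prime_triple[OF v that] no by blast
  obtain a b :: letter where ab: "a \<noteq> 0" "b \<noteq> 0" "a \<noteq> b" using two_other_letters by blast
  then obtain c Q k e where q: "quad v c Q k e" using two_letters_quad[OF v] p by blast
  obtain a b where ab: "a \<noteq> 0" "b \<noteq> 0" "a \<noteq> b" "a \<noteq> c" "b \<noteq> c" using two_other_letters[of c] by blast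
  then obtain c' Q' k' e' where q': "c' = a \<or> c' = b" "quad v c' Q' k' e'"
    using two_letters_quad[OF v ab(1-3)] p by blast
  then have "c \<noteq> c'" using ab by blast
  then show False using two_quads_contra[OF q q'(2)] no by blast
qed

text \<open>\<open>insert c' D\<close> is a quad at \<open>c\<close> that meets the support of \<open>t\<close> only in \<open>c'\<close>.\<close>

definition arm :: "'a word \<Rightarrow> 'a \<Rightarrow> 'a \<Rightarrow> 'a set \<Rightarrow> 'a word \<Rightarrow> 'a word \<Rightarrow> bool" where
  "arm t c c' D k e \<longleftrightarrow> c \<noteq> c' \<and> c \<in> supp t \<and> c' \<in> supp t \<and> D \<inter> supp t = {} \<and> card D = 3 \<and> k \<in> L \<and> e \<in> L \<and>
    supp k = insert c' D \<and> supp e = insert c (insert c' D) \<and> k c' = t c' \<and>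
    e c \<noteq> t c \<and> e c' \<noteq> t c' \<and> (\<forall>x\<in>D. k x \<noteq> e x)"

text \<open>The letter of the quad at \<open>c\<close> differs from \<open>t c\<close>, so
  \<open>e\<close> anticommutes with \<open>t\<close> at exactly one further position, which must
  lie in \<open>Q\<close>. If \<open>Q\<close> contained both, five vertices would have rank at most
  2 + 1 - 1.\<close>

lemma arm_exists:
  assumes t: "t \<in> L" "card (supp t) = 3" and c: "c \<in> supp t"
  shows "\<exists>c' D k e. arm t c c' D k e"
proof -
  have tc: "t c \<noteq> 0" using c by (simp add: supp_iff)
  have cV: "c \<in> V" using supp_L t(1) c by blast
  obtain a b where ab: "a \<noteq> 0" "b \<noteq> 0" "a \<noteq> b" "a \<noteq> t c" "b \<noteq> t c" using two_other_letters[of "t c"] by blast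
  have "primef (V - {c}) (ra c a)" "primef (V - {c}) (ra c b)"
    using triple_bad[OF t tc] ab by (auto simp: bad_def)
  then obtain d0 Q k e where q: "d0 = a \<or> d0 = b" "quad c d0 Q k e"
    using two_letters_quad[OF cV ab(1-3)] by blast
  note d = quadD[OF q(2)]
  obtain u w where T: "supp t = {c, u, w}" "distinct [c, u, w]" using card_3_elem[OF t(2) c] by blast
  have tn: "t u \<noteq> 0" "t w \<noteq> 0" using T(1) by (auto simp flip: supp_iff)
  have ac: "anti (e c) (t c)" using d(8) q(1) ab tc by (auto simp: anti_def)
  have ae: "anti (e c) (t c) \<longleftrightarrow> anti (e u) (t u) \<noteq> anti (e w) (t w)"
    by (rule symp_three[OF d(5) t(1)]) (use T in auto)
  have ak: "anti (k u) (t u) \<longleftrightarrow> anti (k w) (t w)"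
    by (rule symp_two[OF d(4) t(1)]) (use T d(1,6) in auto)
  have out: "k x = 0 \<and> e x = 0" if "x \<notin> Q" "x \<noteq> c" for x
    using that d(6,7) by (metis insertE supp_iff)
  have one: ?thesis if uw: "u \<in> Q" "w \<notin> Q" "supp t = {c, u, w}" "distinct [c, u, w]"
    "anti (e u) (t u)" "\<not> anti (k u) (t u)" "t u \<noteq> 0" for u w
  proof -
    have "k u = t u" using uw d(11) by (auto simp: anti_def)
    moreover have "e u \<noteq> t u" "e c \<noteq> t c" using uw ac by (auto simp: anti_def)
    moreover have "card (Q - {u}) = 3" using uw d by simp
    moreover have "(Q - {u}) \<inter> supp t = {}" using uw d(1) by auto
    moreover have "supp k = insert u (Q - {u})" "supp e = insert c (insert u (Q - {u}))"
      using uw d(6,7) by auto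
    moreover have "\<forall>x\<in>Q - {u}. k x \<noteq> e x" using d(13) by blast
    ultimately have "arm t c u (Q - {u}) k e" using uw d(4,5) unfolding arm_def by auto
    then show ?thesis by blast
  qed
  consider "u \<in> Q" "w \<in> Q" | "u \<in> Q" "w \<notin> Q" | "u \<notin> Q" "w \<in> Q" | "u \<notin> Q" "w \<notin> Q" by blast
  then show ?thesis
  proof cases
    case 1
    have "card (Q - {u, w}) = 2" using d(2,3) 1 T(2) by (subst card_Diff_subset) auto
    then obtain y z where yz: "Q - {u, w} = {y, z}" "y \<noteq> z" using card_2_elems by blast
    have m: "y \<in> Q" "z \<in> Q" "y \<noteq> u" "y \<noteq> w" "z \<noteq> u" "z \<noteq> w" "y \<noteq> c" "z \<noteq> c" using yz d(1) by auto
    have Q: "Q \<subseteq> {u, w, y, z}" using yz by blast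
    have "t \<noteq> 0" using tc by auto
    then have "r {c, u, w} \<le> 2" using r_supp_less[OF t(1), of "{c, u, w}"] T by simp
    moreover have "r (insert y {c, u, w}) \<le> r {c, u, w} + 1" by (rule r_insert_le_Suc) simp
    moreover have "r (insert z {y, c, u, w}) \<le> r {y, c, u, w} - 1"
      using d(11-13)[OF m(2)] d(4-7) Q yz m by (intro r_insert_le2[of _ _ k e]) auto
    moreover have "3 \<le> r {z, y, c, u, w}"
      using d(14) supp_L[OF t(1)] m yz T by (intro r_ge3) auto
    ultimately have False by linarith
    then show ?thesis ..
  next
    case 2
    then have "e w = 0" "k w = 0" using out[of w] T by auto
    then have "anti (e u) (t u)" "\<not> anti (k u) (t u)" using ac ae ak by (auto simp: anti_def)
    then show ?thesis using one[of u w] 2 T tn by blast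
  next
    case 3
    then have "e u = 0" "k u = 0" using out[of u] T by auto
    then have "anti (e w) (t w)" "\<not> anti (k w) (t w)" using ac ae ak by (auto simp: anti_def)
    moreover have "supp t = {c, w, u}" "distinct [c, w, u]" using T by auto
    ultimately show ?thesis using one[of w u] 3 tn by blast
  next
    case 4
    then have "e u = 0" "e w = 0" using out[of u] out[of w] T by auto
    then have False using ac ae by (auto simp: anti_def)
    then show ?thesis ..
  qed
qed

lemma armD:
  assumes "arm t c c' D k e"
  shows "c \<noteq> c'" "c \<in> supp t" "c' \<in> supp t" "D \<inter> supp t = {}" "card D = 3" "finite D" "k \<in> L" "e \<in> L"
    "supp k = insert c' D" "supp e = insert c (insert c' D)" "k c' = t c'"
    "e c' \<noteq> t c'" "e c' \<noteq> 0" "\<And>x. x \<in> D \<Longrightarrow> k x \<noteq> 0" "\<And>x. x \<in> D \<Longrightarrow> e x \<noteq> 0"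
    "\<And>x. x \<in> D \<Longrightarrow> k x \<noteq> e x" "D \<subseteq> V" "e c \<noteq> t c" "e c \<noteq> 0"
proof -
  note a = assms[unfolded arm_def]
  show "c \<noteq> c'" "c \<in> supp t" "c' \<in> supp t" "D \<inter> supp t = {}" "card D = 3" "k \<in> L" "e \<in> L"
    "supp k = insert c' D" "supp e = insert c (insert c' D)" "k c' = t c'"
    "e c' \<noteq> t c'" "\<And>x. x \<in> D \<Longrightarrow> k x \<noteq> e x" "e c \<noteq> t c" using a by blast+
  show "finite D" using a card.infinite by fastforce
  show "k x \<noteq> 0" if "x \<in> D" for x using that a by (metis supp_iff insertI2)
  show "e x \<noteq> 0" if "x \<in> D" for x using that a by (metis supp_iff insertI2)
  show "e c' \<noteq> 0" "e c \<noteq> 0" using a by (metis supp_iff insertI2 insertI1)+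
  show "D \<subseteq> V" using supp_L[of k] a by auto
qed

text \<open>The words of the two arms can share only vertices of \<open>D \<inter> D'\<close> and,
  for \<open>k\<close> and \<open>e'\<close>, also \<open>c'\<close>. Each possible size of the
  intersection fails, by isotropy if it is 0 or 1 and by rank if it is 2 or 3.\<close>

lemma arms_contra:
  assumes t: "t \<in> L" "card (supp t) = 3" and arms: "arm t c c' D k e" "arm t c' c'' D' k' e'" and ne: "c'' \<noteq> c"
  shows False
proof -
  note d = armD[OF arms(1)] and d' = armD[OF arms(2)]
  let ?T = "supp t"
  have T: "?T = {c, c', c''}"
    using card_3_elems[OF t(2) d(2,3,1)] d'(1,3) ne by auto
  have TV: "?T \<subseteq> V" "finite ?T" using supp_L[OF t(1)] finite_sub by auto
  have tn: "t c \<noteq> 0" "t c' \<noteq> 0" "t c'' \<noteq> 0" using T by (auto simp flip: supp_iff)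
  have t0: "t \<noteq> 0" using tn by auto
  have rT: "r ?T \<le> 2" using r_supp_less[OF t(1) t0, of ?T] t(2) by simp
  have out: "c \<notin> D" "c' \<notin> D" "c'' \<notin> D" "c \<notin> D'" "c' \<notin> D'" "c'' \<notin> D'"
    using d(4) d'(4) T by auto
  let ?I = "D \<inter> D'"
  have s: "supp k \<inter> supp k' \<subseteq> ?I" "supp e \<inter> supp k' \<subseteq> ?I" "supp k \<inter> supp e' \<subseteq> insert c' ?I"
    using d(1,9,10) d'(1,9,10) out ne by auto
  have ac: "anti (k c') (e' c')" using d(11) d'(18,19) tn by (simp add: anti_def)
  have cup: "card (?T \<union> D) = 6" using d(4-6) TV t(2) by (subst card_Un_disjoint) auto
  \<comment> \<open>Rank 2 on the support of \<open>t\<close>, plus 1 for each of two vertices of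
    \<open>D\<close>, minus 1 for the third, where \<open>k\<close> and \<open>e\<close> have
    different letters.\<close>
  have rTD: "r (?T \<union> D) \<le> 3"
  proof -
    obtain x where x: "x \<in> D" using d(5) by fastforce
    then obtain y z where xyz: "D = {x, y, z}" "distinct [x, y, z]" using card_3_elem[OF d(5)] by blast
    have xT: "x \<notin> ?T" using x d(4) by blast
    have "r (insert y ?T) \<le> r ?T + 1" "r (insert z (insert y ?T)) \<le> r (insert y ?T) + 1"
      using TV by (auto intro: r_insert_le_Suc)
    moreover have "r (insert x (insert z (insert y ?T))) \<le> r (insert z (insert y ?T)) - 1"
      using d(14-16)[OF x] d(2,3,7-10) xyz xT TV by (intro r_insert_le2[of _ _ k e]) auto
    moreover have "insert x (insert z (insert y ?T)) = ?T \<union> D" using xyz by auto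
    ultimately show ?thesis using rT by simp
  qed
  have "card ?I \<le> card D" using d(6) by (intro card_mono) auto
  then consider "card ?I = 0" | "card ?I = 1" | "card ?I = 2" | "card ?I = 3" using d(5) by linarith
  then show False
  proof cases
    case 1
    then have "?I = {}" using d(6) by simp
    then show False using symp_one[OF d(7) d'(8), of c'] s(3) ac by auto
  next
    case 2
    then obtain x where x: "?I = {x}" by (metis card_1_singletonE)
    then have "\<not> anti (k x) (k' x)" "\<not> anti (e x) (k' x)"
      using symp_one[OF d(7) d'(7), of x] symp_one[OF d(8) d'(7), of x] s by auto
    moreover have "x \<in> D" "x \<in> D'" using x by auto
    ultimately show False using d(14-16)[of x] d'(14)[of x] by (auto simp: anti_def)
  next
    case 3
    have "card (D' - D \<inter> D') = 1" using d'(5,6) 3 by (subst card_Diff_subset) auto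
    then obtain z where "D' - D \<inter> D' = {z}" by (metis card_1_singletonE)
    then have z: "z \<in> D'" "z \<notin> D" "D' \<subseteq> insert z D" by blast+
    have zT: "z \<notin> ?T" using z d'(4) by blast
    \<comment> \<open>The second arm has one new vertex, so seven vertices would have rank at most
      2.\<close>
    have "r (insert z (?T \<union> D)) \<le> r (?T \<union> D) - 1"
      using d'(14-16)[OF z(1)] d'(2,3,7-10) z zT TV d(6) by (intro r_insert_le2[of _ _ k' e']) auto
    moreover have "3 \<le> r (insert z (?T \<union> D))"
      using cup z zT d'(17) d(6,17) TV by (intro r_ge3) auto
    ultimately show False using rTD by linarith
  next
    case 4
    have "?I = D" by (rule card_subset_eq[OF d(6)]) (use 4 d(5) in auto)
    moreover have "?I = D'" by (rule card_subset_eq[OF d'(6)]) (use 4 d'(5) in auto)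
    ultimately have DD: "D' = D" "?I = D" by blast+
    \<comment> \<open>The supports of \<open>k\<close> and \<open>k'\<close> meet exactly in
      \<open>D\<close>; differing on all three vertices would mean an odd number of
      anticommutations.\<close>
    obtain x where x: "x \<in> D" "k x = k' x"
    proof (rule ccontr)
      assume "\<not> thesis"
      then have n: "\<And>x. x \<in> D \<Longrightarrow> k x \<noteq> k' x" using that by blast
      obtain x where x: "x \<in> D" using d(5) by fastforce
      then obtain y z where xyz: "D = {x, y, z}" "distinct [x, y, z]" using card_3_elem[OF d(5)] by blast
      have "anti (k x) (k' x) \<longleftrightarrow> anti (k y) (k' y) \<noteq> anti (k z) (k' z)"
        by (rule symp_three[OF d(7) d'(7)]) (use s(1) DD xyz in auto)
      moreover have "anti (k w) (k' w)" if "w \<in> D" for w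
        using n[OF that] d(14)[OF that] d'(14)[of w] that DD by (simp add: anti_def)
      ultimately show False using xyz by auto
    qed
    let ?Y = "?T \<union> (D - {x})" and ?g = "k + k'"
    have xT: "x \<notin> ?T" using x d(4) by blast
    have gL: "?g \<in> L" by (rule add_L[OF d(7) d'(7)])
    have "supp ?g \<subseteq> insert c' D \<union> insert c'' D" using supp_add[of k k'] d(9) d'(9) DD by blast
    moreover have "x \<notin> supp ?g" using x by (simp add: supp_iff)
    ultimately have gs: "supp ?g \<subseteq> ?Y" using T by blast
    have "c \<notin> supp k" "c \<notin> supp k'" "c' \<notin> supp k'" using d(1,9) d'(1,9) out ne by auto
    then have z0: "k c = 0" "k' c = 0" "k' c' = 0" by (auto simp: supp_iff)
    have "?g c' \<noteq> 0" "?g c \<noteq> t c" using z0 d(11) tn by auto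
    then have "?g \<noteq> 0" "?g \<noteq> t" by auto
    \<comment> \<open>Since \<open>k + k'\<close> cancels at \<open>x\<close>, it and
      \<open>t\<close> are two words on five vertices, of rank at most 3. Adding \<open>x\<close>
      drops this to 2 on six vertices.\<close>
    then have "r ?Y \<le> card ?Y - 2" using r_two_words[OF t(1) gL _ gs t0] by simp
    moreover have "card (D - {x}) = 2" using d(5,6) x by simp
    then have "card ?Y = 5" using d(4,6) TV t(2) by (subst card_Un_disjoint) auto
    moreover have "r (insert x ?Y) \<le> r ?Y - 1"
      using d(14-16)[OF x(1)] d(2,3,6-10) xT TV by (intro r_insert_le2[of _ _ k e]) auto
    moreover have "insert x ?Y = ?T \<union> D" using x by blast
    moreover have "3 \<le> r (?T \<union> D)" using cup d(17) TV by (intro r_ge3) auto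
    ultimately show False by simp
  qed
qed

text \<open>By \<open>arms_contra\<close> any choice of arms is a fixed-point-free involution on the
  three positions of \<open>t\<close>, which does not exist.\<close>

lemma not_stuck: False
proof -
  obtain t where t: "t \<in> L" "card (supp t) = 3" using exists_triple by blast
  obtain u where u: "u \<in> supp t" using t(2) by fastforce
  then obtain v w where T: "supp t = {u, v, w}" "distinct [u, v, w]" using card_3_elem[OF t(2)] by blast
  have *: "\<exists>c'. c' \<in> {u, v, w} \<and> c' \<noteq> c \<and> (\<exists>D k e. arm t c c' D k e)" if "c \<in> {u, v, w}" for c
    using arm_exists[OF t, of c] that armD(1,3) T(1) by metis
  have no: "c'' = c" if "\<exists>D k e. arm t c c' D k e" "\<exists>D k e. arm t c' c'' D k e" for c c' c''
    using arms_contra[OF t] that by blast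
  obtain cu where cu: "cu \<in> {u, v, w}" "cu \<noteq> u" "\<exists>D k e. arm t u cu D k e" using *[of u] by auto
  obtain cv where cv: "cv \<in> {u, v, w}" "cv \<noteq> v" "\<exists>D k e. arm t v cv D k e" using *[of v] by auto
  obtain cw where cw: "cw \<in> {u, v, w}" "cw \<noteq> w" "\<exists>D k e. arm t w cw D k e" using *[of w] by auto
  have 1: "cu = v \<Longrightarrow> cv = u" "cu = w \<Longrightarrow> cw = u" using no[of u cu] cu cv cw by blast+
  have 2: "cv = u \<Longrightarrow> cu = v" "cv = w \<Longrightarrow> cw = v" using no[of v cv] cu cv cw by blast+
  have 3: "cw = u \<Longrightarrow> cu = w" "cw = v \<Longrightarrow> cv = w" using no[of w cw] cu cv cw by blast+
  have d: "u \<noteq> v" "u \<noteq> w" "v \<noteq> w" using T(2) by auto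
  have "cu = v \<or> cu = w" "cv = u \<or> cv = w" "cw = u \<or> cw = v" using cu(1,2) cv(1,2) cw(1,2) by blast+
  then show False using 1 2 3 d by metis
qed

end

subsection \<open>Cut-rank functions\<close>

text \<open>The library rewrites bit arithmetic to bitwise operations, which hides the field structure.\<close>

declare mult_bit_eq_and [simp del] add_bit_eq_xor [simp del] uminus_bit_def [simp del]
  minus_bit_def [simp del]

lemma sum_word_apply: "(\<Sum>x\<in>X. F x) y = (\<Sum>x\<in>X. F x y)" for F :: "'b \<Rightarrow> 'a \<Rightarrow> bit"
  by (induction X rule: infinite_finite_induct) simp_all

lemma UNIV_bit_eq: "(UNIV :: bit set) = {0, 1}"
  by (auto intro: bit_not_zero_iff[THEN iffD1])

lemma finite_bit_functions: "finite X \<Longrightarrow> finite {f :: 'a \<Rightarrow> bit. \<forall>x. x \<notin> X \<longrightarrow> f x = 0}"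
  and card_bit_functions: "finite X \<Longrightarrow> card {f :: 'a \<Rightarrow> bit. \<forall>x. x \<notin> X \<longrightarrow> f x = 0} = 2 ^ card X"
proof -
  let ?F = "{f :: 'a \<Rightarrow> bit. \<forall>x. x \<notin> X \<longrightarrow> f x = 0}"
  have bij: "bij_betw (\<lambda>f. {x. f x \<noteq> 0}) ?F (Pow X)"
  proof (rule bij_betw_byWitness[where f' = "\<lambda>S x. of_bool (x \<in> S)"])
    show "\<forall>f\<in>?F. (\<lambda>x. of_bool (x \<in> {x. f x \<noteq> 0})) = f" by (auto simp: fun_eq_iff)
  qed auto
  show "finite X \<Longrightarrow> finite ?F" using bij_betw_finite[OF bij] by simp
  show "finite X \<Longrightarrow> card ?F = 2 ^ card X" using bij_betw_same_card[OF bij] by (simp add: card_Pow)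
qed

lemma card_span_independent:
  fixes B :: "('a \<Rightarrow> bit) set"
  assumes "finite B" "gf2.independent B"
  shows "finite (gf2.span B) \<and> card (gf2.span B) = 2 ^ card B"
  using assms
proof (induction B rule: finite_induct)
  case (insert b B)
  have ind: "gf2.independent B" "b \<notin> gf2.span B"
    using insert.prems insert.hyps gf2.independent_insert[of b B] by auto
  let ?S = "gf2.span B"
  have IH: "finite ?S" "card ?S = 2 ^ card B" using insert.IH ind by auto
  have two: "k = 0 \<or> k = 1" for k :: bit using UNIV_bit_eq by blast
  have "gf2.span (insert b B) = ?S \<union> (\<lambda>x. x + b) ` ?S"
  proof (intro equalityI subsetI)
    fix x assume "x \<in> gf2.span (insert b B)"
    then obtain k where k: "x - (\<lambda>y. k * b y) \<in> ?S" by (auto simp: gf2.span_insert)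
    show "x \<in> ?S \<union> (\<lambda>x. x + b) ` ?S"
    proof (cases "k = 0")
      case True
      then have "x - (\<lambda>y. k * b y) = x" by (simp add: fun_eq_iff)
      then have "x \<in> ?S" using k by (simp only:)
      then show ?thesis ..
    next
      case False
      then have "x - (\<lambda>y. k * b y) = x - b" using two[of k] by (simp add: fun_eq_iff)
      then have "x - b \<in> ?S" using k by (simp only:)
      then have "x - b + b \<in> (\<lambda>x. x + b) ` ?S" by (rule imageI)
      then show ?thesis by simp
    qed
  next
    fix x assume "x \<in> ?S \<union> (\<lambda>x. x + b) ` ?S"
    moreover have "?S \<subseteq> gf2.span (insert b B)" by (intro gf2.span_mono) auto
    moreover have "b \<in> gf2.span (insert b B)" by (intro gf2.span_base) auto
    ultimately show "x \<in> gf2.span (insert b B)" using gf2.span_add by blast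
  qed
  moreover have "?S \<inter> (\<lambda>x. x + b) ` ?S = {}"
  proof (rule ccontr)
    assume "\<not> ?thesis"
    then obtain x where "x \<in> ?S" "x + b \<in> ?S" by blast
    then have "x + b - x \<in> ?S" by (intro gf2.span_diff)
    then show False using ind by simp
  qed
  moreover have "card ((\<lambda>x. x + b) ` ?S) = card ?S" by (simp add: card_image)
  ultimately show ?case using IH insert.hyps by (simp add: card_Un_disjoint)
qed (simp add: gf2.span_empty)

text \<open>This links the rank in the definition of cut-rank to the cardinalities behind
  \<open>dim2\<close>.\<close>

lemma card_span:
  fixes S :: "('a \<Rightarrow> bit) set"
  assumes "finite S"
  shows "card (gf2.span S) = 2 ^ gf2.dim S"
proof -
  obtain B where B: "B \<subseteq> S" "gf2.independent B" "S \<subseteq> gf2.span B" "card B = gf2.dim S"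
    using gf2.basis_exists[of S] by blast
  have "gf2.span S = gf2.span B" using B by (metis gf2.span_eq gf2.span_superset subset_trans)
  then show ?thesis using card_span_independent[of B] B assms finite_subset by metis
qed

definition block_row :: "('a \<Rightarrow> 'a \<Rightarrow> bit) \<Rightarrow> 'a set \<Rightarrow> 'a \<Rightarrow> 'a \<Rightarrow> bit" where
  "block_row A Y x = (\<lambda>y. if y \<in> Y then A x y else 0)"

text \<open>Rank-nullity, both spaces being counted by their cardinality.\<close>

lemma card_kernel_block:
  fixes A :: "'a \<Rightarrow> 'a \<Rightarrow> bit"
  assumes X: "finite X"
  shows "2 ^ card X = 2 ^ gf2.dim (block_row A Y ` X) *
    card {f :: 'a \<Rightarrow> bit. (\<forall>x. x \<notin> X \<longrightarrow> f x = 0) \<and> (\<forall>y\<in>Y. (\<Sum>x\<in>X. A x y * f x) = 0)}"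
proof -
  let ?F = "{f :: 'a \<Rightarrow> bit. \<forall>x. x \<notin> X \<longrightarrow> f x = 0}"
  let ?m = "\<lambda>f y. \<Sum>x\<in>X. f x * block_row A Y x y"
  have F: "add_subgroup ?F" using finite_bit_functions[OF X] by (auto simp: add_subgroup_def)
  have hom: "?m (f + g) = ?m f + ?m g" for f g
    by (simp add: fun_eq_iff sum.distrib distrib_right)
  have "?m ` ?F = gf2.span (block_row A Y ` X)"
  proof
    show "?m ` ?F \<subseteq> gf2.span (block_row A Y ` X)"
    proof
      fix h assume "h \<in> ?m ` ?F"
      then obtain f where "h = ?m f" by blast
      then have "h = (\<Sum>x\<in>X. (\<lambda>y. f x * block_row A Y x y))" by (simp add: fun_eq_iff sum_word_apply)
      also have "\<dots> \<in> gf2.span (block_row A Y ` X)"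
        by (intro gf2.span_sum gf2.span_scale gf2.span_base imageI)
      finally show "h \<in> gf2.span (block_row A Y ` X)" .
    qed
    show "gf2.span (block_row A Y ` X) \<subseteq> ?m ` ?F"
    proof (rule gf2.span_minimal)
      show "block_row A Y ` X \<subseteq> ?m ` ?F"
      proof
        fix h assume "h \<in> block_row A Y ` X"
        then obtain x where x: "x \<in> X" "h = block_row A Y x" by blast
        have "?m (\<lambda>z. of_bool (z = x)) y = h y" for y
        proof -
          have "?m (\<lambda>z. of_bool (z = x)) y = (\<Sum>z\<in>X. if z = x then block_row A Y x y else 0)"
            by (intro sum.cong) auto
          then show ?thesis using x X by simp
        qed
        then have "?m (\<lambda>z. of_bool (z = x)) = h" by (rule ext)
        moreover have "(\<lambda>z. of_bool (z = x)) \<in> ?F" using x by auto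
        ultimately show "h \<in> ?m ` ?F" by (rule image_eqI[OF sym])
      qed
      have im: "add_subgroup (?m ` ?F)" by (rule add_subgroup_image[OF F, of ?m]) (rule hom)
      show "gf2.subspace (?m ` ?F)"
      proof (rule gf2.subspaceI)
        fix c :: bit and h assume h: "h \<in> ?m ` ?F"
        have "c = 0 \<or> c = 1" using UNIV_bit_eq by blast
        then show "(\<lambda>x. c * h x) \<in> ?m ` ?F"
          using h add_subgroupD(2)[OF im] by (auto simp: zero_fun_def)
      qed (use add_subgroupD[OF im] in blast)+
    qed
  qed
  moreover have m: "?m f y = (if y \<in> Y then \<Sum>x\<in>X. A x y * f x else 0)" for f y
    by (auto simp: block_row_def mult.commute intro!: sum.neutral sum.cong)
  have "{f \<in> ?F. ?m f = 0} =
    {f. (\<forall>x. x \<notin> X \<longrightarrow> f x = 0) \<and> (\<forall>y\<in>Y. (\<Sum>x\<in>X. A x y * f x) = 0)}"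
    unfolding fun_eq_iff m zero_fun_apply by auto
  ultimately show ?thesis
    using card_hom[OF F, of ?m, OF hom] card_bit_functions[OF X]
      card_span[of "block_row A Y ` X"] X by simp
qed

lemma dim_block_transpose_le:
  fixes A :: "'a \<Rightarrow> 'a \<Rightarrow> bit"
  assumes X: "finite X" and sym: "\<And>x y. A x y = A y x"
  shows "gf2.dim (block_row A X ` Y) \<le> gf2.dim (block_row A Y ` X)"
proof -
  let ?R = "block_row A Y ` X"
  obtain B where B: "B \<subseteq> ?R" "gf2.independent B" "?R \<subseteq> gf2.span B" "card B = gf2.dim ?R"
    using gf2.basis_exists[of ?R] by blast
  have fin: "finite B" using B X finite_subset by blast
  have "\<exists>c. \<forall>x\<in>X. block_row A Y x = (\<Sum>b\<in>B. (\<lambda>y. c x b * b y))"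
  proof (rule bchoice, rule ballI)
    fix x assume "x \<in> X"
    then have "block_row A Y x \<in> gf2.span B" using B by blast
    then show "\<exists>d. block_row A Y x = (\<Sum>b\<in>B. (\<lambda>y. d b * b y))"
      unfolding gf2.span_finite[OF fin] by auto
  qed
  then obtain c where c: "\<And>x. x \<in> X \<Longrightarrow> block_row A Y x = (\<Sum>b\<in>B. (\<lambda>y. c x b * b y))" by blast
  \<comment> \<open>Coordinates of the rows in a row basis, read as one vector per basis element;
    they span the columns, and symmetry of \<open>A\<close> turns columns into rows.\<close>
  let ?C = "\<lambda>b x. if x \<in> X then c x b else 0"
  have "block_row A X ` Y \<subseteq> gf2.span (?C ` B)"
  proof
    fix h assume "h \<in> block_row A X ` Y"
    then obtain y where y: "y \<in> Y" "h = block_row A X y" by blast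
    have "h x = (\<Sum>b\<in>B. b y * ?C b x)" for x
    proof (cases "x \<in> X")
      case True
      then have "h x = block_row A Y x y" using y sym by (simp add: block_row_def)
      also have "\<dots> = (\<Sum>b\<in>B. c x b * b y)" using c[OF True] by (simp add: sum_word_apply)
      finally show ?thesis using True by (simp add: mult.commute)
    qed (simp add: y block_row_def)
    then have "h = (\<Sum>b\<in>B. (\<lambda>x. b y * ?C b x))" by (simp add: fun_eq_iff sum_word_apply)
    also have "\<dots> \<in> gf2.span (?C ` B)"
      by (intro gf2.span_sum gf2.span_scale[where x = "?C _"] gf2.span_base imageI)
    finally show "h \<in> gf2.span (?C ` B)" .
  qed
  then have "gf2.dim (block_row A X ` Y) \<le> card (?C ` B)"
    using fin by (intro gf2.dim_le_card) auto
  also have "\<dots> \<le> card B" using fin by (rule card_image_le)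
  finally show ?thesis using B(4) by simp
qed

lemma dim_block_transpose:
  fixes A :: "'a \<Rightarrow> 'a \<Rightarrow> bit"
  assumes "finite X" "finite Y" "\<And>x y. A x y = A y x"
  shows "gf2.dim (block_row A X ` Y) = gf2.dim (block_row A Y ` X)"
  using assms by (intro antisym dim_block_transpose_le) auto

lemma cut_rank_block: "cut_rank G X = gf2.dim (block_row (adjacency G) (pverts G - X) ` X)"
proof -
  have "cut_row G X = block_row (adjacency G) (pverts G - X)"
    by (simp add: fun_eq_iff cut_row_def block_row_def)
  then show ?thesis by (simp add: cut_rank_def)
qed

lemma adjacency_sym:
  assumes "pair_graph G"
  shows "adjacency G x y = adjacency G y x"
proof -
  interpret pair_graph G by fact
  show ?thesis using arcs_symmetric[of x y] arcs_symmetric[of y x] by (auto simp: adjacency_def)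
qed

lemma cut_rank_compl:
  assumes G: "pair_graph G" and X: "X \<subseteq> pverts G"
  shows "cut_rank G (pverts G - X) = cut_rank G X"
proof -
  interpret pair_graph G by fact
  have "pverts G - (pverts G - X) = X" using X by blast
  moreover have "finite X" using finite_subset[OF X pair_finite_verts] .
  then have "gf2.dim (block_row (adjacency G) X ` (pverts G - X)) =
    gf2.dim (block_row (adjacency G) (pverts G - X) ` X)"
    by (rule dim_block_transpose) (use adjacency_sym[OF G] in auto)
  ultimately show ?thesis unfolding cut_rank_block by simp
qed

lemma sequential_iff_seqf:
  assumes "A \<subseteq> pverts G"
  shows "sequential G A \<longleftrightarrow> seqf (\<lambda>X. int (cut_rank G X)) A"
proof
  assume "sequential G A"
  then obtain as where as: "set as = A"
    "\<And>i. 1 \<le> i \<Longrightarrow> i \<le> length as \<Longrightarrow> cut_rank G (set (take i as)) \<le> 2"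
    unfolding sequential_def by blast
  have "i \<le> length as \<Longrightarrow> seqf (\<lambda>X. int (cut_rank G X)) (set (take i as))" for i
  proof (induction i)
    case (Suc i)
    have "set (take (Suc i) as) = insert (as ! i) (set (take i as))"
      using Suc.prems by (simp add: take_Suc_conv_app_nth)
    then show ?case using seqf.insert[of _ "set (take i as)" "as ! i"] Suc as(2)[of "Suc i"] by simp
  qed (simp add: seqf.empty)
  from this[of "length as"] show "seqf (\<lambda>X. int (cut_rank G X)) A" using as(1) by simp
next
  assume "seqf (\<lambda>X. int (cut_rank G X)) A"
  then show "sequential G A" using assms
  proof (induction rule: seqf.induct)
    case empty
    show ?case unfolding sequential_def by (auto intro!: exI[of _ "[]"])
  next
    case (insert A x)
    then obtain as where as: "distinct as" "set as = A"
      "\<And>i. 1 \<le> i \<Longrightarrow> i \<le> length as \<Longrightarrow> cut_rank G (set (take i as)) \<le> 2"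
      unfolding sequential_def by auto
    show ?case
    proof (cases "x \<in> A")
      case True
      then show ?thesis using insert by (simp add: insert_absorb)
    next
      case False
      have "cut_rank G (set (take i (as @ [x]))) \<le> 2" if "1 \<le> i" "i \<le> length (as @ [x])" for i
      proof (cases "i \<le> length as")
        case True
        then show ?thesis using as(3) that by simp
      next
        case False
        then have "i = Suc (length as)" using that by simp
        then show ?thesis using insert.hyps as(2) by simp
      qed
      moreover have "distinct (as @ [x])" "set (as @ [x]) = insert x A" using as False by auto
      ultimately show ?thesis using insert.prems unfolding sequential_def by blast
    qed
  qed
qed

lemma prime_graph_iff_primef: "prime_graph G \<longleftrightarrow> primef (pverts G) (\<lambda>X. int (cut_rank G X))"
proof -
  have *: "A \<union> B = pverts G \<and> A \<inter> B = {} \<longleftrightarrow> A \<subseteq> pverts G \<and> B = pverts G - A" for A B :: "'a set"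
    by blast
  have n: "\<not> (2 \<le> m \<and> 2 \<le> n) \<longleftrightarrow> m \<le> 1 \<or> n \<le> 1" for m n :: nat by linarith
  show ?thesis unfolding prime_graph_def primef_def using * n
    by (smt (verit) of_nat_1 of_nat_le_iff)
qed

lemma seq3_connected_iff:
  assumes f: "\<And>X. X \<subseteq> pverts G \<Longrightarrow> f X = int (cut_rank G X)"
  shows "sequentially_3_rank_connected G \<longleftrightarrow> seq3 (pverts G) f"
proof -
  let ?c = "\<lambda>X. int (cut_rank G X)"
  have "primef (pverts G) f \<longleftrightarrow> prime_graph G"
    unfolding prime_graph_iff_primef primef_def using f by auto
  moreover have "seqf f X \<longleftrightarrow> sequential G X" if "X \<subseteq> pverts G" for X
    unfolding sequential_iff_seqf[OF that]
    by (intro iffI; erule seqf_mono) (use f that in \<open>force dest: subset_trans\<close>)+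
  then have "(\<forall>X\<subseteq>pverts G. f X \<le> 2 \<longrightarrow> seqf f X \<or> seqf f (pverts G - X)) \<longleftrightarrow>
    (\<forall>X\<subseteq>pverts G. cut_rank G X \<le> 2 \<longrightarrow> sequential G X \<or> sequential G (pverts G - X))"
    using f by auto
  ultimately show ?thesis unfolding sequentially_3_rank_connected_def seq3_def by blast
qed

subsection \<open>The words of a graph\<close>

definition graph_word :: "'a pair_pre_digraph \<Rightarrow> ('a \<Rightarrow> bit) \<Rightarrow> 'a word" where
  "graph_word G f = (\<lambda>x. (f x, \<Sum>y\<in>pverts G. adjacency G x y * f y))"

definition graph_words :: "'a pair_pre_digraph \<Rightarrow> 'a word set" where
  "graph_words G = graph_word G ` {f. \<forall>x. x \<notin> pverts G \<longrightarrow> f x = 0}"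

lemma graph_words_iff:
  "g \<in> graph_words G \<longleftrightarrow> (\<exists>f. g = graph_word G f \<and> (\<forall>x. x \<notin> pverts G \<longrightarrow> f x = 0))"
  by (auto simp: graph_words_def)

lemma bit_add_self: "(a :: bit) + a = 0"
  by (cases a) simp_all

lemma inj_graph_word: "inj_on (graph_word G) S"
  by (rule inj_onI) (simp add: graph_word_def fun_eq_iff)

lemma adjacency_outside:
  assumes "pair_graph G" "x \<notin> pverts G"
  shows "adjacency G x y = 0" "adjacency G y x = 0"
proof -
  interpret pair_graph G by fact
  show "adjacency G x y = 0" "adjacency G y x = 0"
    using assms(2) in_arcsD1 in_arcsD2 by (auto simp: adjacency_def)
qed

lemma graph_word_supp:
  assumes G: "pair_graph G" and f: "\<forall>x. x \<notin> pverts G \<longrightarrow> f x = 0"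
  shows "supp (graph_word G f) \<subseteq> pverts G"
proof
  fix x assume x: "x \<in> supp (graph_word G f)"
  show "x \<in> pverts G"
  proof (rule ccontr)
    assume "x \<notin> pverts G"
    then have "graph_word G f x = 0"
      using f adjacency_outside(1)[OF G] by (simp add: graph_word_def zero_prod_def)
    then show False using x by (simp add: supp_iff)
  qed
qed

lemma words_graph_words:
  assumes G: "pair_graph G"
  shows "words (pverts G) (graph_words G)"
proof
  interpret pair_graph G by fact
  let ?A = "adjacency G" and ?V = "pverts G"
  show "finite ?V" by simp
  have "add_subgroup {f :: 'a \<Rightarrow> bit. \<forall>x. x \<notin> ?V \<longrightarrow> f x = 0}"
    using finite_bit_functions[of ?V] by (auto simp: add_subgroup_def)
  then show "add_subgroup (graph_words G)"
    unfolding graph_words_def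
    by (rule add_subgroup_image)
      (simp add: graph_word_def fun_eq_iff sum.distrib distrib_left)
  show "supp g \<subseteq> ?V" if "g \<in> graph_words G" for g
    using that graph_word_supp[OF G] by (auto simp: graph_words_def)
  fix g h assume "g \<in> graph_words G" "h \<in> graph_words G"
  then obtain a b where ab: "g = graph_word G a" "h = graph_word G b" by (auto simp: graph_words_def)
  \<comment> \<open>Both double sums evaluate the adjacency form at \<open>a\<close> and
    \<open>b\<close>; by its symmetry they coincide and cancel over GF(2).\<close>
  have "(\<Sum>x\<in>?V. symp (g x) (h x)) =
    (\<Sum>x\<in>?V. \<Sum>y\<in>?V. a x * (?A x y * b y)) + (\<Sum>x\<in>?V. \<Sum>y\<in>?V. (?A x y * a y) * b x)"
    by (simp add: symp_def ab graph_word_def sum.distrib sum_distrib_left sum_distrib_right)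
  also have "(\<Sum>x\<in>?V. \<Sum>y\<in>?V. (?A x y * a y) * b x) = (\<Sum>y\<in>?V. \<Sum>x\<in>?V. (?A x y * a y) * b x)"
    by (rule sum.swap)
  also have "\<dots> = (\<Sum>x\<in>?V. \<Sum>y\<in>?V. a x * (?A x y * b y))"
  proof (rule sum.cong[OF HOL.refl], rule sum.cong[OF HOL.refl])
    fix x y
    show "?A y x * a x * b y = a x * (?A x y * b y)"
      unfolding adjacency_sym[OF G, of y x] by (simp add: ac_simps)
  qed
  finally show "(\<Sum>x\<in>?V. symp (g x) (h x)) = 0" by (simp add: bit_add_self)
qed

lemma graph_word_row:
  assumes G: "pair_graph G" and X: "X \<subseteq> pverts G" and f: "\<forall>x. x \<notin> X \<longrightarrow> f x = 0"
  shows "(\<Sum>y\<in>pverts G. adjacency G x y * f y) = (\<Sum>y\<in>X. adjacency G y x * f y)"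
proof -
  interpret pair_graph G by fact
  have "(\<Sum>y\<in>pverts G. adjacency G x y * f y) = (\<Sum>y\<in>X. adjacency G x y * f y)"
    using X f by (intro sum.mono_neutral_right) auto
  then show ?thesis using adjacency_sym[OF G] by (metis (no_types, lifting) sum.cong)
qed

text \<open>A word lies in \<open>X\<close> when \<open>f\<close> does and the matrix sends
  \<open>f\<close> to zero outside \<open>X\<close>. These \<open>f\<close> form the kernel of the
  block defining the cut-rank, so rank-nullity applies.\<close>

lemma r_graph_words:
  assumes G: "pair_graph G" and X: "X \<subseteq> pverts G"
  shows "words.r (graph_words G) X = int (cut_rank G X)"
proof -
  interpret words "pverts G" "graph_words G" by (rule words_graph_words[OF G])
  let ?K = "{f. (\<forall>x. x \<notin> X \<longrightarrow> f x = 0) \<and> (\<forall>y\<in>pverts G - X. (\<Sum>x\<in>X. adjacency G x y * f x) = 0)}"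
  have "LX X = graph_word G ` ?K"
  proof
    show "LX X \<subseteq> graph_word G ` ?K"
    proof
      fix g assume "g \<in> LX X"
      then obtain f where f: "g = graph_word G f" "supp g \<subseteq> X" by (auto simp: LX_def graph_words_iff)
      then have z: "g x = 0" if "x \<notin> X" for x using that by (auto simp: supp_def)
      have f0: "\<forall>x. x \<notin> X \<longrightarrow> f x = 0" using z by (auto simp: f graph_word_def zero_prod_def)
      have "(\<Sum>x\<in>X. adjacency G x y * f x) = 0" if "y \<in> pverts G - X" for y
        using z[of y] that graph_word_row[OF G X f0, of y] by (simp add: f graph_word_def zero_prod_def)
      then show "g \<in> graph_word G ` ?K" using f f0 by auto
    qed
    show "graph_word G ` ?K \<subseteq> LX X"
    proof
      fix g assume "g \<in> graph_word G ` ?K"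
      then obtain f where f: "g = graph_word G f" "\<forall>x. x \<notin> X \<longrightarrow> f x = 0"
        "\<And>y. y \<in> pverts G \<Longrightarrow> y \<notin> X \<Longrightarrow> (\<Sum>x\<in>X. adjacency G x y * f x) = 0" by blast
      have fV: "\<forall>x. x \<notin> pverts G \<longrightarrow> f x = 0" using f(2) X by blast
      have "g x = 0" if "x \<notin> X" for x
      proof (cases "x \<in> pverts G")
        case True
        then show ?thesis
          using f(2,3) that graph_word_row[OF G X f(2), of x] by (simp add: f(1) graph_word_def zero_prod_def)
      next
        case False
        then show ?thesis using graph_word_supp[OF G fV] f(1) by (auto simp: supp_def)
      qed
      then show "g \<in> LX X" using f(1) fV by (auto simp: LX_def graph_words_iff supp_def)
    qed
  qed
  then have "card (LX X) = card ?K" by (simp only: card_image[OF inj_graph_word])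
  then have "(2::nat) ^ card X = 2 ^ (cut_rank G X + dim2 (LX X))"
    using card_kernel_block[of X "adjacency G" "pverts G - X"] card_dim2[OF add_subgroup_LX]
      finite_subset[OF X finV]
    by (simp add: cut_rank_block power_add)
  then have "card X = cut_rank G X + dim2 (LX X)" by (subst (asm) power_inject_exp) auto
  then show ?thesis by (simp add: r_def)
qed

text \<open>Letter \<open>0\<close> or \<open>(0, 1)\<close> at \<open>v\<close> means
  \<open>f v = 0\<close> with no equation imposed at \<open>v\<close>: exactly the kernel after
  deleting \<open>v\<close>.\<close>

lemma ra_graph_words:
  assumes G: "pair_graph G" and v: "v \<in> pverts G" and X: "X \<subseteq> pverts G - {v}"
  shows "words.ra (graph_words G) v (0, 1) X = int (cut_rank (delete_vertex G v) X)"
proof -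
  interpret words "pverts G" "graph_words G" by (rule words_graph_words[OF G])
  let ?Y = "pverts G - {v} - X"
  have XV: "X \<subseteq> pverts G" "v \<notin> X" using X by auto
  let ?K = "{f. (\<forall>x. x \<notin> X \<longrightarrow> f x = 0) \<and> (\<forall>y\<in>?Y. (\<Sum>x\<in>X. adjacency G x y * f x) = 0)}"
  have "N v (0, 1) X = graph_word G ` ?K"
  proof
    show "N v (0, 1) X \<subseteq> graph_word G ` ?K"
    proof
      fix g assume "g \<in> N v (0, 1) X"
      then obtain f where f: "g = graph_word G f" "supp g \<subseteq> insert v X" "g v = 0 \<or> g v = (0, 1)"
        by (auto simp: N_def graph_words_iff)
      have z: "g x = 0" if "x \<notin> insert v X" for x using f(2) that by (auto simp: supp_def)
      have "f x = 0" if "x \<notin> X" for x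
        using z[of x] that f(3) by (cases "x = v") (auto simp: f(1) graph_word_def zero_prod_def)
      then have f0: "\<forall>x. x \<notin> X \<longrightarrow> f x = 0" by blast
      have "(\<Sum>x\<in>X. adjacency G x y * f x) = 0" if "y \<in> ?Y" for y
        using z[of y] that graph_word_row[OF G XV(1) f0, of y] by (simp add: f graph_word_def zero_prod_def)
      then show "g \<in> graph_word G ` ?K" using f f0 by auto
    qed
    show "graph_word G ` ?K \<subseteq> N v (0, 1) X"
    proof
      fix g assume "g \<in> graph_word G ` ?K"
      then obtain f where f: "g = graph_word G f" "\<forall>x. x \<notin> X \<longrightarrow> f x = 0"
        "\<And>y. y \<in> ?Y \<Longrightarrow> (\<Sum>x\<in>X. adjacency G x y * f x) = 0" by blast
      have fV: "\<forall>x. x \<notin> pverts G \<longrightarrow> f x = 0" using f(2) XV by blast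
      have "g x = 0" if "x \<notin> insert v X" for x
      proof (cases "x \<in> pverts G")
        case True
        then show ?thesis
          using f(2,3) that graph_word_row[OF G XV(1) f(2), of x] by (simp add: f(1) graph_word_def zero_prod_def)
      next
        case False
        then show ?thesis using graph_word_supp[OF G fV] f(1) by (auto simp: supp_def)
      qed
      then have "supp g \<subseteq> insert v X" by (auto simp: supp_def)
      moreover have "fst (g v) = 0" using f(1,2) XV by (simp add: graph_word_def)
      then have "g v = 0 \<or> g v = (0, 1)" using letter_cases[of "g v"] by auto
      ultimately show "g \<in> N v (0, 1) X" using f(1) fV by (auto simp: N_def graph_words_iff)
    qed
  qed
  then have card: "card (N v (0, 1) X) = card ?K" by (simp only: card_image[OF inj_graph_word])
  have "block_row (adjacency (delete_vertex G v)) (pverts (delete_vertex G v) - X) x =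
    block_row (adjacency G) ?Y x" if "x \<in> X" for x
    using that XV by (auto simp: fun_eq_iff block_row_def adjacency_def delete_vertex_def)
  then have "block_row (adjacency (delete_vertex G v)) (pverts (delete_vertex G v) - X) ` X =
    block_row (adjacency G) ?Y ` X" by (intro image_cong) auto
  then have "cut_rank (delete_vertex G v) X = gf2.dim (block_row (adjacency G) ?Y ` X)"
    by (simp add: cut_rank_block)
  then have "(2::nat) ^ card X = 2 ^ (cut_rank (delete_vertex G v) X + dim2 (N v (0, 1) X))"
    using card_kernel_block[of X "adjacency G" ?Y] card_dim2[OF add_subgroup_N] card
      finite_subset[OF XV(1) finV] by (simp add: power_add)
  then have "card X = cut_rank (delete_vertex G v) X + dim2 (N v (0, 1) X)"
    by (subst (asm) power_inject_exp) auto
  then show ?thesis by (simp add: ra_def)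
qed

subsection \<open>Local complementation\<close>

text \<open>The effect on letters of local complementation at \<open>v\<close>.\<close>

definition twist :: "'a pair_pre_digraph \<Rightarrow> 'a \<Rightarrow> 'a \<Rightarrow> letter \<Rightarrow> letter" where
  "twist G v x a = (if x = v then (fst a + snd a, snd a)
    else if x \<in> neighbourhood G v then (fst a, snd a + fst a) else a)"

lemma twist_eq_iff: "twist G v x a = twist G v x b \<longleftrightarrow> a = b"
  by (cases a; cases b) (auto simp: twist_def)

lemma twist_0: "twist G v x 0 = 0"
  by (simp add: twist_def zero_prod_def)

lemma adjacency_local_complement:
  assumes G: "pair_graph G"
  shows "adjacency (local_complement G v) x y = adjacency G x y +
    of_bool (x \<in> neighbourhood G v \<and> y \<in> neighbourhood G v \<and> x \<noteq> y)"
proof -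
  interpret pair_graph G by fact
  show ?thesis using no_loops'
    by (auto simp: adjacency_def local_complement_def Let_def bit_add_self)
qed

text \<open>Changing \<open>f v\<close> by the sum of \<open>f\<close> over the neighbours of
  \<open>v\<close> cancels the terms that the complemented neighbourhood creates, except the missing
  diagonal term \<open>f x\<close> at each neighbour \<open>x\<close>.\<close>

lemma graph_word_local_complement:
  assumes G: "pair_graph G" and v: "v \<in> pverts G"
  shows "graph_word (local_complement G v) (f(v := f v + snd (graph_word G f v))) =
    (\<lambda>x. twist G v x (graph_word G f x))"
proof
  interpret pair_graph G by fact
  fix x
  let ?A = "adjacency G" and ?V = "pverts G" and ?N = "neighbourhood G v"
  let ?q = "\<lambda>x. \<Sum>y\<in>?V. ?A x y * f y"
  let ?f = "f(v := f v + ?q v)"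
  have vN: "v \<notin> ?N" using no_loops' by (auto simp: neighbourhood_def)
  have N: "?N \<subseteq> ?V" "finite ?N" by (auto simp: neighbourhood_def)
  have A: "?A x v = of_bool (x \<in> ?N)" "?A v x = of_bool (x \<in> ?N)" for x
  proof -
    show "?A v x = of_bool (x \<in> ?N)" using in_arcsD2 by (auto simp: adjacency_def neighbourhood_def)
    then show "?A x v = of_bool (x \<in> ?N)" using adjacency_sym[OF G] by simp
  qed
  have qv: "?q v = (\<Sum>y\<in>?N. f y)"
  proof -
    have "?q v = (\<Sum>y\<in>?V. if y \<in> ?N then f y else 0)" by (intro sum.cong) (auto simp: A)
    also have "\<dots> = (\<Sum>y\<in>?V \<inter> ?N. f y)" using pair_finite_verts by (simp add: sum.inter_restrict)
    finally show ?thesis using N by (simp add: Int_absorb1)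
  qed
  let ?B = "\<lambda>y. of_bool (x \<in> ?N \<and> y \<in> ?N \<and> x \<noteq> y) :: bit"
  have "(\<Sum>y\<in>?V. adjacency (local_complement G v) x y * ?f y) =
    (\<Sum>y\<in>?V. ?A x y * f y + (if y = v then ?A x v * ?q v else 0) + ?B y * f y)"
    by (intro sum.cong HOL.refl) (use vN in \<open>auto simp: adjacency_local_complement[OF G] distrib_left distrib_right\<close>)
  also have "\<dots> = ?q x + ?A x v * ?q v + (\<Sum>y\<in>?V. ?B y * f y)"
    using v pair_finite_verts by (simp add: sum.distrib)
  also have "(\<Sum>y\<in>?V. ?B y * f y) = of_bool (x \<in> ?N) * (?q v + f x)"
  proof (cases "x \<in> ?N")
    case True
    have "(\<Sum>y\<in>?V. ?B y * f y) = (\<Sum>y\<in>?V. if y \<in> ?N - {x} then f y else 0)"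
      using True by (intro sum.cong) auto
    also have "\<dots> = (\<Sum>y\<in>?V \<inter> (?N - {x}). f y)" using pair_finite_verts by (simp add: sum.inter_restrict)
    also have "?V \<inter> (?N - {x}) = ?N - {x}" using N by blast
    finally have 1: "(\<Sum>y\<in>?V. ?B y * f y) = (\<Sum>y\<in>?N - {x}. f y)" .
    have "(\<Sum>y\<in>?N. f y) = f x + (\<Sum>y\<in>?N - {x}. f y)" using True N by (simp add: sum.remove)
    then have "(\<Sum>y\<in>?N - {x}. f y) = (\<Sum>y\<in>?N. f y) + f x"
      using bit_add_self[of "f x"] by (metis add.assoc add.commute add.left_neutral)
    then show ?thesis using 1 qv True by simp
  qed simp
  finally have q: "(\<Sum>y\<in>?V. adjacency (local_complement G v) x y * ?f y) =
    ?q x + ?A x v * ?q v + of_bool (x \<in> ?N) * (?q v + f x)" .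
  have V: "pverts (local_complement G v) = ?V" by (simp add: local_complement_def Let_def)
  show "graph_word (local_complement G v) (f(v := f v + snd (graph_word G f v))) x =
    twist G v x (graph_word G f x)"
  proof (cases "x \<in> ?N")
    case True
    have "?q v + (?q v + f x) = f x" using bit_add_self[of "?q v"] by (metis add.assoc add.left_neutral)
    then have "?q x + ?A x v * ?q v + of_bool (x \<in> ?N) * (?q v + f x) = ?q x + f x"
      using True by (simp add: A add.assoc)
    note q' = q[unfolded this]
    have "x \<noteq> v" using True vN by blast
    then show ?thesis unfolding graph_word_def V snd_conv q' using True by (simp add: twist_def)
  next
    case False
    then have "?q x + ?A x v * ?q v + of_bool (x \<in> ?N) * (?q v + f x) = ?q x" by (simp add: A)
    note q' = q[unfolded this]
    show ?thesis unfolding graph_word_def V snd_conv q' using False by (simp add: twist_def)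
  qed
qed

lemma graph_words_local_complement:
  assumes G: "pair_graph G" and v: "v \<in> pverts G"
  shows "graph_words (local_complement G v) = (\<lambda>g x. twist G v x (g x)) ` graph_words G"
proof
  have V: "pverts (local_complement G v) = pverts G" by (simp add: local_complement_def Let_def)
  let ?F = "{f :: 'a \<Rightarrow> bit. \<forall>x. x \<notin> pverts G \<longrightarrow> f x = 0}"
  let ?t = "\<lambda>f. f(v := f v + snd (graph_word G f v))"
  have tF: "?t f \<in> ?F" if "f \<in> ?F" for f using that v by auto
  show "(\<lambda>g x. twist G v x (g x)) ` graph_words G \<subseteq> graph_words (local_complement G v)"
  proof
    fix h assume "h \<in> (\<lambda>g x. twist G v x (g x)) ` graph_words G"
    then obtain f where "f \<in> ?F" "h = (\<lambda>x. twist G v x (graph_word G f x))" by (auto simp: graph_words_def)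
    then have "h = graph_word (local_complement G v) (?t f)" "?t f \<in> ?F"
      using graph_word_local_complement[OF G v, of f] tF[of f] by simp_all
    then show "h \<in> graph_words (local_complement G v)" unfolding graph_words_def V by (rule image_eqI)
  qed
  show "graph_words (local_complement G v) \<subseteq> (\<lambda>g x. twist G v x (g x)) ` graph_words G"
  proof
    fix h assume "h \<in> graph_words (local_complement G v)"
    then obtain f where f: "f \<in> ?F" "h = graph_word (local_complement G v) f"
      unfolding graph_words_def V by blast
    have loop: "adjacency G v v = 0"
    proof -
      interpret pair_graph G by fact
      show ?thesis using no_loops' by (auto simp: adjacency_def)
    qed
    \<comment> \<open>There is no loop at \<open>v\<close>, so changing \<open>f v\<close> does not
      affect the correction, and correcting twice restores \<open>f\<close>.\<close>
    have "snd (graph_word G (?t f) v) = snd (graph_word G f v)"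
      unfolding graph_word_def snd_conv by (intro sum.cong HOL.refl) (simp add: loop)
    then have "?t (?t f) = f" by (simp add: fun_eq_iff add.assoc bit_add_self)
    then have "h = (\<lambda>x. twist G v x (graph_word G (?t f) x))"
      using graph_word_local_complement[OF G v, of "?t f"] f(2) by simp
    moreover have "graph_word G (?t f) \<in> graph_words G"
      using tF[OF f(1)] unfolding graph_words_def by (rule imageI)
    ultimately show "h \<in> (\<lambda>g x. twist G v x (g x)) ` graph_words G" by (rule image_eqI)
  qed
qed

text \<open>At each position the twist permutes the letters and fixes \<open>0\<close>, so it
  preserves supports and matches the spaces for \<open>a\<close> and its image.\<close>

lemma ra_local_complement:
  assumes G: "pair_graph G" and u: "u \<in> pverts G"
  shows "words.ra (graph_words (local_complement G u)) v (twist G u v a) X = words.ra (graph_words G) v a X"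
proof -
  interpret words "pverts G" "graph_words G" by (rule words_graph_words[OF G])
  interpret H: words "pverts (local_complement G u)" "graph_words (local_complement G u)"
    by (rule words_graph_words[OF pair_graph_local_complement[OF G]])
  let ?T = "\<lambda>g x. twist G u x (g x)"
  have supp: "supp (?T g) = supp g" for g
    using twist_eq_iff[of G u _ _ 0] by (simp add: supp_def twist_0)
  have zero: "?T g v = 0 \<longleftrightarrow> g v = 0" for g
    using twist_eq_iff[of G u v "g v" 0] by (simp add: twist_0)
  have mem: "h \<in> graph_words (local_complement G u) \<longleftrightarrow> (\<exists>g\<in>graph_words G. h = ?T g)" for h
    unfolding graph_words_local_complement[OF G u] by blast
  have "H.N v (twist G u v a) X = ?T ` N v a X"
    unfolding H.N_def N_def mem using supp zero by (auto simp: twist_eq_iff)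
  moreover have "inj_on ?T (N v a X)" by (rule inj_onI) (simp add: fun_eq_iff twist_eq_iff)
  ultimately have "card (H.N v (twist G u v a) X) = card (N v a X)" by (simp add: card_image)
  then have "dim2 (H.N v (twist G u v a) X) = dim2 (N v a X)" by (simp add: dim2_def)
  then show ?thesis by (simp add: H.ra_def ra_def)
qed

text \<open>The letters \<open>(0, 1)\<close>, \<open>(1, 1)\<close> and \<open>(1, 0)\<close> at \<open>v\<close> correspond to deleting \<open>v\<close> from \<open>G\<close>, from \<open>G * v\<close>,
  and from \<open>G * u * v\<close> for a neighbour \<open>u\<close> of \<open>v\<close>.\<close>

lemma minor_of_letter:
  assumes G: "pair_graph G" and v: "v \<in> pverts G" and a: "a \<noteq> 0" and nb: "neighbourhood G v \<noteq> {}"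
  shows "\<exists>H. vertex_minor G H \<and> pverts H = pverts G - {v} \<and>
    (\<forall>X\<subseteq>pverts G - {v}. words.ra (graph_words G) v a X = int (cut_rank H X))"
proof -
  interpret pair_graph G by fact
  have V: "pverts (local_complement G u) = pverts G" "pverts (delete_vertex G u) = pverts G - {u}"
    for G :: "'a pair_pre_digraph" and u by (auto simp: local_complement_def delete_vertex_def Let_def)
  consider "a = (0, 1)" | "a = (1, 1)" | "a = (1, 0)" using letter_cases[of a] a by blast
  then show ?thesis
  proof cases
    case 1
    show ?thesis
      by (rule exI[of _ "delete_vertex G v"])
        (use 1 v V(2)[of G v] ra_graph_words[OF G v] vertex_minor.delete_vertex[OF vertex_minor.refl v] in simp)
  next
    case 2
    let ?H = "local_complement G v"
    have H: "pair_graph ?H" "v \<in> pverts ?H" using pair_graph_local_complement[OF G] v V by auto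
    have tw: "twist G v v (1, 1) = (0, 1)" by (simp add: twist_def bit_add_self)
    have "vertex_minor G (delete_vertex ?H v)"
      using H v by (intro vertex_minor.intros)
    moreover have "words.ra (graph_words G) v a X = int (cut_rank (delete_vertex ?H v) X)"
      if "X \<subseteq> pverts G - {v}" for X
      using ra_local_complement[OF G v, of v "(1, 1)" X] ra_graph_words[OF H, of X] that 2 V tw by simp
    moreover have "pverts (delete_vertex ?H v) = pverts G - {v}" using V by simp
    ultimately show ?thesis by blast
  next
    case 3
    obtain u where u: "u \<in> neighbourhood G v" using nb by blast
    then have uv: "u \<in> pverts G" "v \<in> neighbourhood G u" "u \<noteq> v"
      using v arcs_symmetric no_loops' by (auto simp: neighbourhood_def)
    let ?G = "local_complement G u" let ?H = "local_complement ?G v"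
    have G': "pair_graph ?G" "v \<in> pverts ?G" using pair_graph_local_complement[OF G] v V by auto
    have H: "pair_graph ?H" "v \<in> pverts ?H" using pair_graph_local_complement[OF G'(1)] v V by auto
    have tw: "twist G u v (1, 0) = (1, 1)" "twist ?G v v (1, 1) = (0, 1)"
      using uv by (simp_all add: twist_def bit_add_self)
    have "vertex_minor G (delete_vertex ?H v)"
      using H G' uv by (intro vertex_minor.intros)
    moreover have "words.ra (graph_words G) v a X = int (cut_rank (delete_vertex ?H v) X)"
      if "X \<subseteq> pverts G - {v}" for X
      using ra_local_complement[OF G uv(1), of v "(1, 0)" X] ra_local_complement[OF G', of v "(1, 1)" X]
        ra_graph_words[OF H, of X] that 3 V tw by simp
    moreover have "pverts (delete_vertex ?H v) = pverts G - {v}" using V by simp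
    ultimately show ?thesis by blast
  qed
qed

text \<open>An isolated vertex together with any other vertex has cut-rank at most 1. A neighbour is
  what the letter \<open>(1, 0)\<close> needs.\<close>

lemma prime_neighbourhood:
  assumes G: "pair_graph G" and p: "prime_graph G" and c: "4 \<le> card (pverts G)" and v: "v \<in> pverts G"
  shows "neighbourhood G v \<noteq> {}"
proof
  assume N: "neighbourhood G v = {}"
  interpret G: pair_graph G by fact
  have "card (pverts G - {v}) \<noteq> 0" using c v by simp
  then obtain w where w: "w \<in> pverts G" "w \<noteq> v" by (metis Diff_iff card.empty ex_in_conv insertI1)
  have "cut_row G {v, w} v = 0"
    using N by (auto simp: cut_row_def adjacency_def neighbourhood_def fun_eq_iff)
  then have "cut_row G {v, w} ` {v, w} \<subseteq> gf2.span {cut_row G {v, w} w}"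
    using gf2.span_zero gf2.span_base[of "cut_row G {v, w} w"] by auto
  then have "cut_rank G {v, w} \<le> card {cut_row G {v, w} w}"
    unfolding cut_rank_def by (rule gf2.dim_le_card) simp
  then have r: "cut_rank G {v, w} \<le> 1" by simp
  have "card (pverts G - {v, w}) = card (pverts G) - 2"
    using v w by (subst card_Diff_subset) auto
  then have "2 \<le> card (pverts G - {v, w})" "card {v, w} = 2" using c w by auto
  moreover have "{v, w} \<union> (pverts G - {v, w}) = pverts G" "{v, w} \<inter> (pverts G - {v, w}) = {}"
    using v w by auto
  ultimately show False using p r unfolding prime_graph_def
    by (metis order_refl)
qed

theorem theorem1p2:
  fixes G :: "'a pair_pre_digraph"
  assumes "pair_graph G"
    and "sequentially_3_rank_connected G"
    and "card (pverts G) \<ge> 13"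
  shows "\<exists>H. vertex_minor G H \<and> sequentially_3_rank_connected H \<and>
    card (pverts H) = card (pverts G) - 1"
proof (rule ccontr)
  assume no: "\<not> ?thesis"
  note G = assms(1)
  interpret G: pair_graph G by fact
  interpret words "pverts G" "graph_words G" by (rule words_graph_words[OF G])
  have minor: "\<exists>H. vertex_minor G H \<and> pverts H = pverts G - {v} \<and>
    (\<forall>X\<subseteq>pverts G - {v}. ra v a X = int (cut_rank H X))" if "v \<in> pverts G" "a \<noteq> 0" for v a
    using minor_of_letter[OF G that] prime_neighbourhood[OF G _ _ that(1)] assms(2,3)
    by (auto simp: sequentially_3_rank_connected_def)
  have "stuck (pverts G) (graph_words G)"
  proof
    show "r (pverts G - X) = r X" if "X \<subseteq> pverts G" for X
      using that cut_rank_compl[OF G that] by (simp add: r_graph_words[OF G])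
    \<comment> \<open>Symmetry is inherited from the cut-rank of the graph that realizes the
      letter.\<close>
    show "ra v a (pverts G - {v} - X) = ra v a X"
      if va: "v \<in> pverts G" "a \<noteq> 0" and X: "X \<subseteq> pverts G - {v}" for v a X
    proof -
      obtain H where H: "vertex_minor G H" "pverts H = pverts G - {v}"
        "\<And>X. X \<subseteq> pverts G - {v} \<Longrightarrow> ra v a X = int (cut_rank H X)" using minor[OF va] by blast
      have "cut_rank H (pverts H - X) = cut_rank H X"
        using X H(2) by (intro cut_rank_compl pair_graph_vertex_minor[OF H(1) G]) auto
      then show ?thesis using H(2,3) X by simp
    qed
    show "seq3 (pverts G) r"
      using seq3_connected_iff[of G r] r_graph_words[OF G] assms(2) by blast
    show "13 \<le> card (pverts G)" by fact
    show "\<not> seq3 (pverts G - {v}) (ra v a)" if va: "v \<in> pverts G" "a \<noteq> 0" for v a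
    proof
      assume s: "seq3 (pverts G - {v}) (ra v a)"
      obtain H where H: "vertex_minor G H" "pverts H = pverts G - {v}"
        "\<And>X. X \<subseteq> pverts G - {v} \<Longrightarrow> ra v a X = int (cut_rank H X)" using minor[OF va] by blast
      have "sequentially_3_rank_connected H"
        using seq3_connected_iff[of H "ra v a"] H(2,3) s by simp
      moreover have "card (pverts H) = card (pverts G) - 1" using H(2) va by simp
      ultimately show False using no H(1) by blast
    qed
  qed
  then show False by (rule stuck.not_stuck)
qed

end
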